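(* Let $\alpha>-1$, and let $\varphi$ be a nonconstant analytic self-map of $\mathbb{D}$ such that $C_\varphi$ is bounded on $\mathcal{D}_\alpha$. Suppose that $\psi(w)=\frac{N_{\varphi,\alpha}(w)}{(1-|w|^2)^\alpha}$ belongs to $\mathrm{VO}_\partial(\mathbb{D})$. Then $$\|C_\varphi\|_e^2=\limsup_{|z|\to1^-}\psi(z)=\limsup_{|z|\to1^-}\mathcal{B}_\alpha\psi(z).$$ Moreover, for every fixed $r>0$, $$\|C_\varphi\|_e^2=(1+\alpha)\limsup_{|z|\to1^-}\frac{\int_{D(z,r)}N_{\varphi,\alpha}(w)\,dA(w)}{A_\alpha(D(z,r))}.$$
   Context: $\mathbb{D}$ is the open unit disk and $dA$ is normalized area measure on $\mathbb{D}$. For $\alpha>-1$, $dA_\alpha(z)=(1+\alpha)(1-|z|^2)^\alpha dA(z)$ and $A_\alpha(E)=\int_E dA_\alpha$. The weighted Bergman space $A_\alpha^2$ consists of analytic $g$ on $\mathbb{D}$ with $\|g\|_{A_\alpha^2}^2=\int_{\mathbb{D}}|g|^2dA_\alpha<\infty$. The weighted Dirichlet space $\mathcal{D}_\alpha$ consists of analytic $f$ on $\mathbb{D}$ with $\|f\|_{\mathcal{D}_\alpha}^2=|f(0)|^2+\int_{\mathbb{D}}|f'|^2dA_\alpha<\infty$. $C_\varphi f=f\circ\varphi$. Counting function: $N_{\varphi,\alpha}(w)=\sum_{\varphi(z)=w}(1-|z|^2)^\alpha\in[0,+\infty]$, preimages counted with multiplicity, and $N_{\varphi,\alpha}(w)=0$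 if $w\notin\varphi(\mathbb{D})$. Bergman disks: $D(z,r)=\{w\in\mathbb{D}:\beta(z,w)<r\}$ with $\beta(z,w)=\operatorname{arctanh}\left|\frac{z-w}{1-\overline z w}\right|$, $r>0$. Vanishing oscillation at the boundary: a Borel function $q:\mathbb{D}\to[0,+\infty]$ which is finite on some outer annulus $\{\rho<|z|<1\}$ belongs to $\mathrm{VO}_\partial(\mathbb{D})$ if $\lim_{|z|\to1^-}\sup_{w\in D(z,s)}|q(w)-q(z)|=0$ for every fixed $s>0$. Berezin transform: for a nonnegative Borel function $q$ such that the measure $q\,dA_\alpha$ induces a bounded embedding $A_\alpha^2\hookrightarrow L^2(q\,dA_\alpha)$ (which holds for $q=\psi$ when $C_\varphi$ is bounded on $\mathcal{D}_\alpha$), $\mathcal{B}_\alpha q(z)=\int_{\mathbb{D}}|\kappa_z^\alpha(w)|^2q(w)\,dA_\alpha(w)$, where $\kappa_z^\alpha(w)=\frac{(1-|z|^2)^{(\alpha+2)/2}}{(1-\overline z w)^{\alpha+2}}$. Essential norm of a bounded operator $T:H_1\to H_2$ between Hilbert spaces: $\|T\|_e=\inf\{\|T-K\|:K:H_1\to H_2\text{ compact}\}$; here $C_\varphi$ acts on $\mathcal{D}_\alpha$. *)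

theory Defs
  imports "HOL-Complex_Analysis.Complex_Analysis"
begin

section \<open>The disk, its measures and its boundary filter\<close>

abbreviation unit_disk :: "complex set"
  where "unit_disk \<equiv> ball 0 1"

definition area_measure :: "complex measure"
  where "area_measure = density (restrict_space lborel unit_disk) (\<lambda>_. ennreal (1 / pi))"

definition weighted_area :: "real \<Rightarrow> complex measure"
  where "weighted_area \<alpha> =
    density area_measure (\<lambda>z. ennreal ((1 + \<alpha>) * (1 - (norm z)\<^sup>2) powr \<alpha>))"

text \<open>The filter \<open>|z| \<rightarrow> 1-\<close>.\<close>

definition at_boundary :: "complex filter"
  where "at_boundary = filtercomap norm (at_left 1)"

definition bergman_disk :: "complex \<Rightarrow> real \<Rightarrow> complex set"
  where "bergman_disk z r =
    {w \<in> unit_disk. artanh (norm ((z - w) / (1 - cnj z * w))) < r}"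

section \<open>Operators on a normed space of functions\<close>

text \<open>
  A normed space is given by a carrier \<open>H\<close>, closed under the pointwise vector space operations,
  and a norm function \<open>nrm\<close>; only the values of an operator on \<open>H\<close> matter.
\<close>

definition linear_op ::
  "(complex \<Rightarrow> complex) set \<Rightarrow> ((complex \<Rightarrow> complex) \<Rightarrow> (complex \<Rightarrow> complex)) \<Rightarrow> bool"
  where "linear_op H T \<longleftrightarrow>
    (\<forall>f\<in>H. T f \<in> H) \<and>
    (\<forall>f\<in>H. \<forall>g\<in>H. T (\<lambda>z. f z + g z) = (\<lambda>z. T f z + T g z)) \<and>
    (\<forall>c. \<forall>f\<in>H. T (\<lambda>z. c * f z) = (\<lambda>z. c * T f z))"

definition bounded_op ::
  "(complex \<Rightarrow> complex) set \<Rightarrow> ((complex \<Rightarrow> complex) \<Rightarrow> real) \<Rightarrow>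
   ((complex \<Rightarrow> complex) \<Rightarrow> (complex \<Rightarrow> complex)) \<Rightarrow> bool"
  where "bounded_op H nrm T \<longleftrightarrow>
    linear_op H T \<and> (\<exists>C. \<forall>f\<in>H. nrm (T f) \<le> C * nrm f)"

definition compact_op ::
  "(complex \<Rightarrow> complex) set \<Rightarrow> ((complex \<Rightarrow> complex) \<Rightarrow> real) \<Rightarrow>
   ((complex \<Rightarrow> complex) \<Rightarrow> (complex \<Rightarrow> complex)) \<Rightarrow> bool"
  where "compact_op H nrm K \<longleftrightarrow>
    linear_op H K \<and>
    (\<forall>f :: nat \<Rightarrow> complex \<Rightarrow> complex. (\<forall>n. f n \<in> H \<and> nrm (f n) \<le> 1) \<longrightarrow>
      (\<exists>s g. strict_mono s \<and> g \<in> H \<and>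
        (\<lambda>n. nrm (\<lambda>z. K (f (s n)) z - g z)) \<longlonglongrightarrow> 0))"

definition op_norm ::
  "(complex \<Rightarrow> complex) set \<Rightarrow> ((complex \<Rightarrow> complex) \<Rightarrow> real) \<Rightarrow>
   ((complex \<Rightarrow> complex) \<Rightarrow> (complex \<Rightarrow> complex)) \<Rightarrow> real"
  where "op_norm H nrm T = (SUP f\<in>{f \<in> H. nrm f \<le> 1}. nrm (T f))"

definition essential_norm ::
  "(complex \<Rightarrow> complex) set \<Rightarrow> ((complex \<Rightarrow> complex) \<Rightarrow> real) \<Rightarrow>
   ((complex \<Rightarrow> complex) \<Rightarrow> (complex \<Rightarrow> complex)) \<Rightarrow> real"
  where "essential_norm H nrm T =
    (INF K\<in>{K. compact_op H nrm K}. op_norm H nrm (\<lambda>f z. T f z - K f z))"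

section \<open>Weighted Dirichlet spaces and composition operators\<close>

text \<open>
  A function on the disk is represented by its extension by 0 to the complex plane, so that
  equality of representatives is equality on the disk and \<open>dirichlet_norm\<close> is a genuine norm.
\<close>

definition dirichlet_space :: "real \<Rightarrow> (complex \<Rightarrow> complex) set"
  where "dirichlet_space \<alpha> =
    {f. f holomorphic_on unit_disk \<and> (\<forall>z. z \<notin> unit_disk \<longrightarrow> f z = 0) \<and>
        integrable (weighted_area \<alpha>) (\<lambda>z. (norm (deriv f z))\<^sup>2)}"

definition dirichlet_norm :: "real \<Rightarrow> (complex \<Rightarrow> complex) \<Rightarrow> real"
  where "dirichlet_norm \<alpha> f =
    sqrt ((norm (f 0))\<^sup>2 + (\<integral>z. (norm (deriv f z))\<^sup>2 \<partial>weighted_area \<alpha>))"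

definition comp_op :: "(complex \<Rightarrow> complex) \<Rightarrow> (complex \<Rightarrow> complex) \<Rightarrow> (complex \<Rightarrow> complex)"
  where "comp_op \<phi> f = (\<lambda>z. if z \<in> unit_disk then f (\<phi> z) else 0)"

section \<open>Counting function, vanishing oscillation, Berezin transform\<close>

text \<open>
  The multiplicity of a preimage \<open>z\<close> of \<open>w\<close> is the order of the zero of \<open>\<phi> - w\<close> at \<open>z\<close>;
  it is a positive integer when \<open>\<phi>\<close> is holomorphic and nonconstant on the disk.
\<close>

definition counting_fun :: "(complex \<Rightarrow> complex) \<Rightarrow> real \<Rightarrow> complex \<Rightarrow> ennreal"
  where "counting_fun \<phi> \<alpha> w =
    (\<Sum>\<^sub>\<infinity>z\<in>{z \<in> unit_disk. \<phi> z = w}.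
      ennreal (of_int (zorder (\<lambda>u. \<phi> u - w) z) * (1 - (norm z)\<^sup>2) powr \<alpha>))"

definition counting_ratio :: "(complex \<Rightarrow> complex) \<Rightarrow> real \<Rightarrow> complex \<Rightarrow> ennreal"
  where "counting_ratio \<phi> \<alpha> w = counting_fun \<phi> \<alpha> w / ennreal ((1 - (norm w)\<^sup>2) powr \<alpha>)"

definition VO_boundary :: "(complex \<Rightarrow> ennreal) set"
  where "VO_boundary =
    {q. q \<in> borel_measurable (restrict_space borel unit_disk) \<and>
        (\<exists>\<rho><1. \<forall>z. \<rho> < norm z \<and> norm z < 1 \<longrightarrow> q z < \<infinity>) \<and>
        (\<forall>s>0. ((\<lambda>z. SUP w\<in>bergman_disk z s. \<bar>enn2ereal (q w) - enn2ereal (q z)\<bar>)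
                  \<longlongrightarrow> 0) at_boundary)}"

text \<open>
  For \<open>z, w\<close> in the disk, \<open>1 - cnj z * w\<close> lies in the right half-plane, where the principal
  branch used by \<open>powr\<close> is holomorphic.
\<close>

definition bergman_kernel :: "real \<Rightarrow> complex \<Rightarrow> complex \<Rightarrow> complex"
  where "bergman_kernel \<alpha> z w =
    complex_of_real ((1 - (norm z)\<^sup>2) powr ((\<alpha> + 2) / 2))
      / (1 - cnj z * w) powr complex_of_real (\<alpha> + 2)"

definition berezin :: "real \<Rightarrow> (complex \<Rightarrow> ennreal) \<Rightarrow> complex \<Rightarrow> ennreal"
  where "berezin \<alpha> q z =
    (\<integral>\<^sup>+w. ennreal ((norm (bergman_kernel \<alpha> z w))\<^sup>2) * q w \<partial>weighted_area \<alpha>)"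

end

theory Submission
  imports Defs
begin

text \<open>
  Write \<open>\<psi>\<close> for the counting ratio of \<open>\<phi>\<close>, \<open>C\<^sub>\<phi>\<close> for composition with \<open>\<phi>\<close>, \<open>\<kappa>\<^sub>z\<close> for the normalised Bergman
  kernels and \<open>A\<^sup>2\<close> for the weighted Bergman space. The change of variables \<open>w = \<phi> z\<close> shows that the
  derivative of \<open>f \<circ> \<phi>\<close> has squared norm \<open>\<integral> |f'|\<^sup>2 \<psi> dA\<^sub>\<alpha>\<close> (\<open>nn_integral_comp_counting_ratio\<close>). Apart from
  the evaluation at \<open>\<phi> 0\<close>, the operator \<open>C\<^sub>\<phi>\<close> is therefore the embedding of \<open>A\<^sup>2\<close> into \<open>L\<^sup>2(\<psi> dA\<^sub>\<alpha>)\<close>, and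
  only the boundary behaviour of \<open>\<psi>\<close> survives modulo compact operators. The equalities come from a cycle of
  three inequalities between the squared essential norm, the limit superior of \<open>\<psi>\<close> and the limit superior
  of its Berezin transform.

  The squared essential norm is at most \<open>limsup \<psi>\<close> (\<open>essential_norm_squared_le\<close>): composition with the
  \<open>n\<close>-th Taylor polynomial has finite rank, and the remaining Taylor tails are uniformly small on compact
  subdisks while, by orthogonality of the monomials, their norm in \<open>A\<^sup>2\<close> does not exceed that of the
  function. So only the values of \<open>\<psi>\<close> near the boundary matter.

  \<open>limsup \<psi>\<close> is at most the limit superior of the Berezin transform (\<open>Limsup_le_Limsup_berezin\<close>): by
  conformal invariance \<open>|\<kappa>\<^sub>z|\<^sup>2 dA\<^sub>\<alpha>\<close> gives to the Bergman disk of radius \<open>s\<close> about \<open>z\<close> a mass that is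
  independent of \<open>z\<close> and tends to 1 as \<open>s\<close> grows, and on this disk \<open>\<psi>\<close> is nearly constant by vanishing
  oscillation.

  The limit superior of the Berezin transform is at most the squared essential norm
  (\<open>Limsup_berezin_le_essential_norm\<close>): the Berezin transform at \<open>z\<close> is the squared norm of \<open>C\<^sub>\<phi> f\<close> modulo
  constants, where \<open>f' = \<kappa>\<^sub>z\<close>. Along a sequence of such functions on which a compact operator converges,
  differences of two members are nearly annihilated by the compact operator, but kernels at points that
  tend to the boundary are nearly orthogonal both in \<open>A\<^sup>2\<close> and in \<open>L\<^sup>2(\<psi> dA\<^sub>\<alpha>)\<close>.

  The formula with averages over Bergman disks of fixed radius is again vanishing oscillation: the average
  of \<open>\<psi>\<close> over such a disk differs little from the value at its centre (\<open>Limsup_averages_eq_Limsup\<close>).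
\<close>

section \<open>Change of variables for holomorphic maps\<close>

text \<open>
  Jacobian determinants are computed in coordinates, so the plane is identified with \<open>real^2\<close>.
\<close>

definition vec_complex :: "real^2 \<Rightarrow> complex"
  where "vec_complex v = Complex (v $ 1) (v $ 2)"

definition complex_vec :: "complex \<Rightarrow> real^2"
  where "complex_vec z = vector [Re z, Im z]"

lemma vec_complex_inverse [simp]: "complex_vec (vec_complex v) = v"
  by (simp add: vec_complex_def complex_vec_def vec_eq_iff forall_2)

lemma complex_vec_inverse [simp]: "vec_complex (complex_vec z) = z"
  by (simp add: vec_complex_def complex_vec_def)

lemma linear_vec_complex: "linear vec_complex"
  by (rule linearI) (auto simp: vec_complex_def complex_eq_iff)

lemma linear_complex_vec: "linear complex_vec"
  by (rule linearI) (auto simp: complex_vec_def vec_eq_iff forall_2)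

lemma vec_complex_borel [measurable]: "vec_complex \<in> borel_measurable borel"
  using linear_continuous_on[OF linear_vec_complex[unfolded linear_conv_bounded_linear]]
  by (rule borel_measurable_continuous_onI)

lemma distr_vec_complex: "distr lborel borel vec_complex = lborel"
proof (rule lborel_eqI[symmetric])
  fix l u :: complex
  assume lu: "\<And>b. b \<in> Basis \<Longrightarrow> l \<bullet> b \<le> u \<bullet> b"
  have le: "Re l \<le> Re u" "Im l \<le> Im u"
    using lu[of 1] lu[of \<i>] by (auto simp: Basis_complex_def)
  have "vec_complex -` box l u = box (complex_vec l) (complex_vec u)"
    by (auto simp: box_complex_eq mem_box_cart vec_complex_def complex_vec_def forall_2)
  then have "emeasure (distr lborel borel vec_complex) (box l u)
      = emeasure lborel (box (complex_vec l) (complex_vec u))"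
    by (subst emeasure_distr) auto
  also have "\<dots> = (\<Prod>b\<in>Basis. (complex_vec u - complex_vec l) \<bullet> b)"
    by (rule emeasure_lborel_box)
      (use le in \<open>auto simp: Basis_vec_def inner_axis complex_vec_def forall_2 UNIV_2\<close>)
  also have "\<dots> = ennreal ((Re u - Re l) * (Im u - Im l))"
    by (auto simp: Basis_vec_def UNIV_2 axis_eq_axis inner_axis complex_vec_def mult.commute)
  also have "\<dots> = (\<Prod>b\<in>Basis. (u - l) \<bullet> b)"
    by (simp add: Basis_complex_def)
  finally show "emeasure (distr lborel borel vec_complex) (box l u) = (\<Prod>b\<in>Basis. (u - l) \<bullet> b)" .
qed simp

text \<open>
  Multiplication by \<open>c\<close> is a rotation followed by a dilation by \<open>|c|\<close>, so the area distortion of a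
  holomorphic map is the square of the modulus of its derivative.
\<close>

lemma det_matrix_complex_mult:
  "det (matrix (\<lambda>h. complex_vec (c * vec_complex h))) = (norm c)\<^sup>2"
  by (simp add: det_2 matrix_def complex_vec_def vec_complex_def axis_def cmod_power2 flip: power2_eq_square)

text \<open>
  The real Jacobian of \<open>f\<close> is \<open>|f'|\<^sup>2\<close>. The boundedness assumptions make both sides finite, so that they
  can be compared through real-valued integrals over \<open>real^2\<close>.
\<close>

lemma emeasure_holomorphic_image:
  assumes S: "open S" "bounded S" and f: "f holomorphic_on S" "inj_on f S" "bounded (deriv f ` S)"
    and E: "E \<subseteq> S" "E \<in> sets borel" and fE: "f ` E \<in> sets borel"
  shows "emeasure lborel (f ` E) = (\<integral>\<^sup>+z\<in>E. ennreal ((norm (deriv f z))\<^sup>2) \<partial>lborel)"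
proof -
  obtain B where B: "\<And>z. z \<in> S \<Longrightarrow> norm (deriv f z) \<le> B"
    using f(3) unfolding bounded_iff by auto
  define h where "h = (\<lambda>z. indicator E z * (norm (deriv f z))\<^sup>2)"
  have cd: "continuous_on S (deriv f)"
    using f S by (intro holomorphic_on_imp_continuous_on holomorphic_deriv)
  have [measurable]: "E \<in> sets borel" "S \<in> sets borel" using E S by auto
  have hm [measurable]: "h \<in> borel_measurable borel"
  proof -
    have "(\<lambda>z. indicator S z *\<^sub>R (norm (deriv f z))\<^sup>2) \<in> borel_measurable borel"
      by (intro borel_measurable_continuous_on_indicator continuous_intros cd) auto
    then have "(\<lambda>z. indicator E z * (indicator S z *\<^sub>R (norm (deriv f z))\<^sup>2)) \<in> borel_measurable borel"
      by measurable
    also have "(\<lambda>z. indicator E z * (indicator S z *\<^sub>R (norm (deriv f z))\<^sup>2)) = h"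
      using E(1) by (auto simp: h_def fun_eq_iff indicator_def)
    finally show ?thesis .
  qed
  have h0: "0 \<le> h z" for z by (simp add: h_def)
  define I where "I = (\<integral>\<^sup>+z. ennreal (h z) \<partial>lborel)"
  have I_eq: "I = (\<integral>\<^sup>+z\<in>E. ennreal ((norm (deriv f z))\<^sup>2) \<partial>lborel)"
    unfolding I_def by (intro nn_integral_cong) (auto simp: h_def indicator_def)
  have "I \<le> (\<integral>\<^sup>+z. ennreal (B\<^sup>2) * indicator S z \<partial>lborel)"
    unfolding I_def
  proof (intro nn_integral_mono)
    fix z show "ennreal (h z) \<le> ennreal (B\<^sup>2) * indicator S z"
      using E(1) B[of z] by (auto simp: h_def indicator_def intro!: ennreal_leI power_mono)
  qed
  also have "\<dots> = ennreal (B\<^sup>2) * emeasure lborel S"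
    by (subst nn_integral_cmult_indicator) auto
  also have "\<dots> < \<infinity>"
    using emeasure_bounded_finite[OF S(2)] by (simp add: ennreal_mult_less_top)
  finally have Ifin: "I < \<infinity>" .
  then obtain m where m: "I = ennreal m" "0 \<le> m"
    by (cases I) auto
  let ?F = "complex_vec \<circ> f \<circ> vec_complex" and ?E = "vec_complex -` E"
  have EL: "?E \<in> sets borel"
    using measurable_sets[OF vec_complex_borel E(2)] by simp
  have "(\<integral>\<^sup>+v. ennreal (h (vec_complex v)) \<partial>lborel) = ennreal m"
    unfolding m(1)[symmetric] I_def
    by (subst distr_vec_complex[symmetric], subst nn_integral_distr) auto
  then have hU: "((\<lambda>v. h (vec_complex v)) has_integral m) UNIV"
    by (intro nn_integral_has_integral) (use m h0 in auto)
  have hi: "((\<lambda>v. \<bar>det (matrix (\<lambda>h. complex_vec (deriv f (vec_complex v) * vec_complex h)))\<bar>)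
      has_integral m) ?E"
  proof -
    have "(\<lambda>v. if v \<in> ?E then \<bar>(norm (deriv f (vec_complex v)))\<^sup>2\<bar> else 0) = (\<lambda>v. h (vec_complex v))"
      by (auto simp: h_def)
    with hU show ?thesis
      unfolding det_matrix_complex_mult
      by (subst has_integral_restrict_UNIV[symmetric]) simp
  qed
  have der: "(?F has_derivative (\<lambda>h. complex_vec (deriv f (vec_complex v) * vec_complex h))) (at v within ?E)"
    if "v \<in> ?E" for v
  proof -
    have "vec_complex v \<in> S" using that E by auto
    then have 1: "(f has_derivative (*) (deriv f (vec_complex v))) (at (vec_complex v))"
      using holomorphic_derivI[OF f(1) S(1)] by (simp add: has_field_derivative_def)
    have 2: "(vec_complex has_derivative vec_complex) (at v within ?E)"
      using linear_vec_complex by (simp add: linear_imp_has_derivative)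
    have 3: "(complex_vec has_derivative complex_vec) (at x)" for x
      using linear_complex_vec by (simp add: linear_imp_has_derivative)
    show ?thesis
      unfolding o_def by (rule has_derivative_compose[OF has_derivative_compose[OF 2 1] 3])
  qed
  have inj: "inj_on ?F ?E"
  proof (rule inj_onI)
    fix u v assume uv: "u \<in> ?E" "v \<in> ?E" "?F u = ?F v"
    then have "f (vec_complex u) = f (vec_complex v)"
      by (metis complex_vec_inverse o_apply)
    then have "vec_complex u = vec_complex v"
      using uv E(1) f(2) by (auto dest: inj_onD)
    then show "u = v" by (metis vec_complex_inverse)
  qed
  have "?F ` ?E \<in> lmeasurable \<and> measure lebesgue (?F ` ?E) = m"
    by (rule has_measure_differentiable_image[OF _ der inj, THEN iffD2, OF _ _ hi])
      (use EL in auto)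
  then have "emeasure lebesgue (?F ` ?E) = I"
    using emeasure_eq_measure2[of "?F ` ?E" lebesgue] unfolding m(1) by metis
  moreover have "?F ` ?E = vec_complex -` (f ` E)"
  proof (intro set_eqI iffI)
    fix v assume "v \<in> vec_complex -` (f ` E)"
    then obtain z where "z \<in> E" "vec_complex v = f z" by auto
    then show "v \<in> ?F ` ?E"
      by (intro image_eqI[of _ _ "complex_vec z"]) (auto simp flip: \<open>vec_complex v = f z\<close>)
  qed auto
  ultimately have "emeasure lborel (vec_complex -` (f ` E)) = I"
    using measurable_sets[OF vec_complex_borel fE] by simp
  then have "emeasure (distr lborel borel vec_complex) (f ` E) = I"
    using fE by (simp add: emeasure_distr)
  then show ?thesis
    unfolding distr_vec_complex I_eq .
qed

text \<open>
  The preceding lemma says that Lebesgue measure on \<open>f ` S\<close> and the image under \<open>f\<close> of the measure with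
  density \<open>|f'|\<^sup>2\<close> on \<open>S\<close> agree on Borel sets, hence they integrate every \<open>F\<close> alike.
\<close>

lemma nn_integral_holomorphic_inj:
  fixes F :: "complex \<Rightarrow> ennreal"
  assumes S: "open S" "bounded S" and f: "f holomorphic_on S" "inj_on f S" "bounded (deriv f ` S)"
    and [measurable]: "F \<in> borel_measurable borel"
  shows "(\<integral>\<^sup>+w\<in>f ` S. F w \<partial>lborel) = (\<integral>\<^sup>+z\<in>S. F (f z) * ennreal ((norm (deriv f z))\<^sup>2) \<partial>lborel)"
proof -
  define f1 where "f1 = (\<lambda>z. indicator S z *\<^sub>R f z)"
  define h where "h = (\<lambda>z. indicator S z *\<^sub>R (norm (deriv f z))\<^sup>2)"
  have f1m [measurable]: "f1 \<in> borel_measurable borel" unfolding f1_def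
    using S f by (intro borel_measurable_continuous_on_indicator holomorphic_on_imp_continuous_on) auto
  have hm [measurable]: "h \<in> borel_measurable borel" unfolding h_def
    using S f by (intro borel_measurable_continuous_on_indicator continuous_intros
        holomorphic_on_imp_continuous_on holomorphic_deriv) auto
  have [measurable]: "S \<in> sets borel" "f ` S \<in> sets borel"
    using S open_mapping_thm3[OF f(1) S(1) f(2)] by auto
  have "distr (density lborel (\<lambda>z. ennreal (h z))) borel f1 = density lborel (indicator (f ` S))"
  proof (rule measure_eqI)
    fix A :: "complex set"
    assume "A \<in> sets (distr (density lborel (\<lambda>z. ennreal (h z))) borel f1)"
    then have [measurable]: "A \<in> sets borel" by simp
    have [measurable]: "f1 -` A \<in> sets borel"
      using measurable_sets[OF f1m, of A] by simp
    have "emeasure (distr (density lborel (\<lambda>z. ennreal (h z))) borel f1) A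
        = (\<integral>\<^sup>+z. ennreal (h z) * indicator (f1 -` A) z \<partial>lborel)"
      by (simp add: emeasure_distr emeasure_density)
    also have "\<dots> = (\<integral>\<^sup>+z\<in>S \<inter> f1 -` A. ennreal ((norm (deriv f z))\<^sup>2) \<partial>lborel)"
      by (intro nn_integral_cong) (auto simp: h_def indicator_def)
    also have "\<dots> = emeasure lborel (f ` (S \<inter> f1 -` A))"
    proof (rule emeasure_holomorphic_image[symmetric, OF S f])
      have "f ` (S \<inter> f1 -` A) = f ` S \<inter> A" by (auto simp: f1_def)
      then show "f ` (S \<inter> f1 -` A) \<in> sets borel" by simp
    qed auto
    also have "f ` (S \<inter> f1 -` A) = f ` S \<inter> A"
      by (auto simp: f1_def)
    also have "emeasure lborel (f ` S \<inter> A) = emeasure (density lborel (indicator (f ` S))) A"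
      by (simp add: emeasure_density flip: indicator_inter_arith)
    finally show "emeasure (distr (density lborel (\<lambda>z. ennreal (h z))) borel f1) A
        = emeasure (density lborel (indicator (f ` S))) A" .
  qed simp
  then have "nn_integral (density lborel (indicator (f ` S))) F
      = nn_integral (distr (density lborel (\<lambda>z. ennreal (h z))) borel f1) F"
    by simp
  also have "\<dots> = (\<integral>\<^sup>+z. ennreal (h z) * F (f1 z) \<partial>lborel)"
    by (simp add: nn_integral_distr nn_integral_density)
  also have "\<dots> = (\<integral>\<^sup>+z\<in>S. F (f z) * ennreal ((norm (deriv f z))\<^sup>2) \<partial>lborel)"
    by (intro nn_integral_cong) (auto simp: h_def f1_def indicator_def mult.commute)
  finally show ?thesis
    by (simp add: nn_integral_density mult.commute)
qed

lemma open_imp_fsigma: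
  fixes S :: "'a::euclidean_space set"
  assumes "open S"
  shows "fsigma S"
proof -
  obtain \<D> where D: "\<D> \<subseteq> Pow S" "countable \<D>" "\<Union>\<D> = S"
     and cb: "\<And>X. X \<in> \<D> \<Longrightarrow> \<exists>a b. X = cbox a b"
    using open_countable_Union_open_cbox[OF assms] by metis
  have "range (from_nat_into (insert {} \<D>)) = insert {} \<D>"
    using D by (intro range_from_nat_into) auto
  moreover have "compact X" if "X \<in> insert {} \<D>" for X
    using that cb[of X] compact_cbox by auto
  ultimately show ?thesis
    unfolding fsigma_Union_compact using D(3)
    by (intro exI[of _ "from_nat_into (insert {} \<D>)"]) auto
qed

lemma zorder_diff_eq_1:
  assumes "f holomorphic_on S" "open S" "z \<in> S" "deriv f z \<noteq> 0" "f z = w"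
  shows "zorder (\<lambda>u. f u - w) z = 1"
proof -
  have "deriv (\<lambda>u. f u - w) z = deriv f z"
    using assms by (subst deriv_diff) (auto intro: holomorphic_on_imp_differentiable_at)
  moreover have "(\<lambda>u. f u - w) analytic_on {z}"
  proof -
    have "(\<lambda>u. f u - w) holomorphic_on S" by (intro holomorphic_intros assms)
    then show ?thesis unfolding analytic_at using assms by (intro exI[of _ S]) simp
  qed
  ultimately show ?thesis
    using zorder_zero_eqI'[of "\<lambda>u. f u - w" z 1] assms by simp
qed

text \<open>
  The critical points of \<open>f\<close> form a countable set, and so do the critical values; both are null sets.
  The remaining part of \<open>S\<close> is a countable disjoint union of Borel pieces on each of which \<open>f\<close> is
  injective. Adding the injective changes of variables over the pieces counts every preimage of a
  noncritical value exactly once, and its multiplicity is 1.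
\<close>

theorem nn_integral_holomorphic_counting:
  fixes F :: "complex \<Rightarrow> ennreal" and h :: "complex \<Rightarrow> real"
  assumes S: "open S" "connected S" and f: "f holomorphic_on S" "\<not> f constant_on S"
    and h [measurable]: "h \<in> borel_measurable borel"
    and F [measurable]: "F \<in> borel_measurable borel"
  shows "(\<integral>\<^sup>+z\<in>S. F (f z) * ennreal (h z) * ennreal ((norm (deriv f z))\<^sup>2) \<partial>lborel)
    = (\<integral>\<^sup>+w. F w * (\<Sum>\<^sub>\<infinity>z\<in>{z\<in>S. f z = w}. ennreal (of_int (zorder (\<lambda>u. f u - w) z) * h z)) \<partial>lborel)"
proof -
  define C where "C = {z\<in>S. deriv f z = 0}"
  define U where "U = S - C"
  have hd: "deriv f holomorphic_on S" using f S by (intro holomorphic_deriv)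
  have "countable C"
  proof (cases "C = {}")
    case False
    then obtain z0 where z0: "z0 \<in> S" "deriv f z0 = 0" by (auto simp: C_def)
    have "\<not> deriv f constant_on S"
    proof
      assume "deriv f constant_on S"
      then have "deriv f z = 0" if "z \<in> S" for z
        using that z0 by (metis constant_on_def)
      then have "f constant_on S"
        using holomorphic_derivI[OF f(1) S(1)] f S
        by (intro DERIV_zero_connected_constant_on[of S "{}"])
          (fastforce intro: holomorphic_on_imp_continuous_on)+
      with f(2) show False by simp
    qed
    then show ?thesis
      unfolding C_def by (intro holomorphic_countable_zeros[OF hd S] open_imp_fsigma S)
  qed simp
  have U: "open U" "U \<subseteq> S"
  proof -
    have "U = {z\<in>S. deriv f z \<noteq> 0}" unfolding U_def C_def by auto
    moreover have "open {z\<in>S. deriv f z \<in> -{0}}"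
      by (rule continuous_open_preimage[unfolded vimage_def Int_def, simplified])
        (use S hd holomorphic_on_imp_continuous_on in auto)
    ultimately show "open U" by simp
  qed (auto simp: U_def)
  \<comment> \<open>The pieces: small enough for the injective change of variables, with bounded derivative.\<close>
  define good where "good = (\<lambda>B. open B \<and> bounded B \<and> B \<subseteq> U \<and> inj_on f B \<and> bounded (deriv f ` B))"
  have ex: "\<exists>B. good B \<and> x \<in> B" if xU: "x \<in> U" for x
  proof -
    have fU: "f holomorphic_on U" "deriv f x \<noteq> 0"
      using f U xU holomorphic_on_subset by (auto simp: U_def C_def)
    obtain r where r: "r > 0" "ball x r \<subseteq> U" "inj_on f (ball x r)"
      using has_complex_derivative_locally_injective[OF fU(1) xU U(1) fU(2)] by blast
    have sub: "cball x (r/2) \<subseteq> ball x r" "ball x (r/2) \<subseteq> cball x (r/2)" using r by auto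
    have "continuous_on (cball x (r/2)) (deriv f)"
      using hd sub r U by (meson continuous_on_subset holomorphic_on_imp_continuous_on subset_trans)
    then have "bounded (deriv f ` cball x (r/2))"
      by (intro compact_imp_bounded compact_continuous_image) auto
    then have "good (ball x (r/2))"
      unfolding good_def using sub r
      by (meson bounded_ball bounded_subset image_mono inj_on_subset open_ball order_trans)
    then show ?thesis using r by (intro exI[of _ "ball x (r/2)"]) auto
  qed
  obtain \<F> where \<F>: "\<F> \<subseteq> Collect good" "countable \<F>" "\<Union>\<F> = \<Union>(Collect good)"
    using Lindelof[of "Collect good"] by (auto simp: good_def)
  have "good {}" by (simp add: good_def)
  define B where "B = from_nat_into (insert {} \<F>)"
  have rB: "range B = insert {} \<F>"
    unfolding B_def using \<F> by (intro range_from_nat_into) auto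
  then have gB: "good (B n)" for n
    using \<F>(1) \<open>good {}\<close> by (metis insert_iff mem_Collect_eq rangeI subsetD)
  have UB: "(\<Union>n. B n) = U"
  proof -
    have "(\<Union>n. B n) = \<Union>(Collect good)" using rB \<F>(3) by auto
    also have "\<dots> = U" using ex by (auto simp: good_def)
    finally show ?thesis .
  qed
  define E where "E = disjointed B"
  have EB: "E n \<subseteq> B n" for n unfolding E_def by (rule disjointed_subset)
  have dE: "disjoint_family E" unfolding E_def by (rule disjoint_family_disjointed)
  have UE: "(\<Union>n. E n) = U" unfolding E_def UN_disjointed_eq UB ..
  have ES: "E n \<subseteq> S" for n using EB[of n] gB[of n] U(2) by (auto simp: good_def)
  have Bm [measurable]: "B n \<in> sets borel" for n using gB by (auto simp: good_def)
  have "range E \<subseteq> sets borel" unfolding E_def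
    by (rule sets.range_disjointed_sets) (use Bm in auto)
  then have Em [measurable]: "E n \<in> sets borel" for n by auto
  have fB: "f holomorphic_on B n" for n
    using gB[of n] f U holomorphic_on_subset unfolding good_def by blast
  have "\<exists>g. g holomorphic_on (f ` B n) \<and> (\<forall>z\<in>B n. g (f z) = z)" for n
  proof -
    have "open (B n)" "inj_on f (B n)" using gB[of n] by (auto simp: good_def)
    from holomorphic_has_inverse[OF fB this] show ?thesis by metis
  qed
  then obtain g where g: "\<And>n. g n holomorphic_on (f ` B n)" "\<And>n z. z \<in> B n \<Longrightarrow> g n (f z) = z"
    by metis
  have ofB: "open (f ` B n)" for n
    using open_mapping_thm3[OF fB] gB[of n] by (auto simp: good_def)
  define g1 where "g1 = (\<lambda>n w. indicator (f ` B n) w *\<^sub>R g n w)"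
  have g1m [measurable]: "g1 n \<in> borel_measurable borel" for n
    unfolding g1_def using ofB g(1)
    by (intro borel_measurable_continuous_on_indicator holomorphic_on_imp_continuous_on) auto
  have fBm [measurable]: "f ` B n \<in> sets borel" for n using ofB by auto
  \<comment> \<open>The part of the sum over preimages that comes from the piece \<open>E n\<close>.\<close>
  define G where "G = (\<lambda>n w. indicator (f ` B n) w * indicator (E n) (g1 n w) * ennreal (h (g1 n w)))"
  have Gm [measurable]: "G n \<in> borel_measurable borel" for n
    unfolding G_def by measurable
  have G_f: "G n (f z) = indicator (E n) z * ennreal (h z)" if "z \<in> B n" for n z
    using that g(2)[OF that] by (auto simp: G_def g1_def indicator_def)
  have G_0: "G n w = 0" if "w \<notin> f ` E n" for n w
    using that g(2) by (auto simp: G_def g1_def indicator_def)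
  have step: "(\<integral>\<^sup>+z\<in>E n. F (f z) * ennreal (h z) * ennreal ((norm (deriv f z))\<^sup>2) \<partial>lborel)
      = (\<integral>\<^sup>+w. F w * G n w \<partial>lborel)" for n
  proof -
    have "(\<integral>\<^sup>+z\<in>E n. F (f z) * ennreal (h z) * ennreal ((norm (deriv f z))\<^sup>2) \<partial>lborel)
        = (\<integral>\<^sup>+z\<in>B n. F (f z) * G n (f z) * ennreal ((norm (deriv f z))\<^sup>2) \<partial>lborel)"
      using EB[of n] by (intro nn_integral_cong) (auto simp: G_f indicator_def)
    also have "\<dots> = (\<integral>\<^sup>+w\<in>f ` B n. F w * G n w \<partial>lborel)"
      by (subst nn_integral_holomorphic_inj) (use gB[of n] fB[of n] in \<open>auto simp: good_def\<close>)
    also have "\<dots> = (\<integral>\<^sup>+w. F w * G n w \<partial>lborel)"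
      by (intro nn_integral_cong) (auto simp: G_def indicator_def)
    finally show ?thesis .
  qed
  define k where "k = (\<lambda>z. F (f z) * ennreal (h z) * ennreal ((norm (deriv f z))\<^sup>2))"
  have nC: "C \<in> null_sets lborel"
    using \<open>countable C\<close> by (rule countable_imp_null_set_lborel)
  have nfC: "f ` C \<in> null_sets lborel"
    using \<open>countable C\<close> by (intro countable_imp_null_set_lborel) auto
  \<comment> \<open>Cut-offs, because \<open>f\<close> and its derivative are Borel only on \<open>S\<close>.\<close>
  define f1 where "f1 = (\<lambda>z. indicator S z *\<^sub>R f z)"
  define d1 where "d1 = (\<lambda>z. indicator S z *\<^sub>R deriv f z)"
  have [measurable]: "f1 \<in> borel_measurable borel" "d1 \<in> borel_measurable borel"
    unfolding f1_def d1_def using S f hd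
    by (auto intro!: borel_measurable_continuous_on_indicator holomorphic_on_imp_continuous_on)
  define k1 where "k1 = (\<lambda>z. F (f1 z) * ennreal (h z) * ennreal ((norm (d1 z))\<^sup>2))"
  have kk: "k z = k1 z" if "z \<in> S" for z using that by (simp add: k_def k1_def f1_def d1_def)
  have "(\<integral>\<^sup>+z\<in>S. k z \<partial>lborel) = (\<integral>\<^sup>+z\<in>(\<Union>n. E n). k1 z \<partial>lborel)"
  proof (rule nn_integral_cong_AE)
    show "AE z in lborel. k z * indicator S z = k1 z * indicator (\<Union>n. E n) z"
      using AE_not_in[OF nC] by eventually_elim (auto simp: UE U_def indicator_def kk)
  qed
  also have "\<dots> = (\<Sum>n. \<integral>\<^sup>+z\<in>E n. k1 z \<partial>lborel)"
    by (rule nn_integral_disjoint_family[OF _ _ dE]) (auto simp: k1_def)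
  also have "\<dots> = (\<Sum>n. \<integral>\<^sup>+z\<in>E n. k z \<partial>lborel)"
  proof -
    have "k1 z = k z" if "z \<in> E n" for z n
      using kk[of z] ES[of n] that by auto
    then show ?thesis by (intro suminf_cong nn_integral_cong) (auto simp: indicator_def)
  qed
  also have "\<dots> = (\<Sum>n. \<integral>\<^sup>+w. F w * G n w \<partial>lborel)"
    unfolding k_def step ..
  also have "\<dots> = (\<integral>\<^sup>+w. (\<Sum>n. F w * G n w) \<partial>lborel)"
    by (rule nn_integral_suminf[symmetric]) auto
  also have "\<dots> = (\<integral>\<^sup>+w. F w * (\<Sum>\<^sub>\<infinity>z\<in>{z\<in>S. f z = w}. ennreal (of_int (zorder (\<lambda>u. f u - w) z) * h z)) \<partial>lborel)"
  proof (rule nn_integral_cong_AE)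
    have *: "(\<Sum>n. F w * G n w) = F w * (\<Sum>\<^sub>\<infinity>z\<in>{z\<in>S. f z = w}. ennreal (of_int (zorder (\<lambda>u. f u - w) z) * h z))"
      if w: "w \<notin> f ` C" for w
    proof -
      have nz: "z \<in> U" if "z \<in> S" "f z = w" for z using w that by (auto simp: U_def)
      have "(\<Sum>\<^sub>\<infinity>z\<in>{z\<in>S. f z = w}. ennreal (of_int (zorder (\<lambda>u. f u - w) z) * h z))
          = (\<Sum>\<^sub>\<infinity>z\<in>{z\<in>S. f z = w}. ennreal (h z))"
      proof (rule infsum_cong)
        fix z assume "z \<in> {z\<in>S. f z = w}"
        then show "ennreal (of_int (zorder (\<lambda>u. f u - w) z) * h z) = ennreal (h z)"
          using nz[of z] zorder_diff_eq_1[OF f(1) S(1), of z w] by (auto simp: U_def C_def)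
      qed
      also have "\<dots> = (\<Sum>\<^sub>\<infinity>n\<in>{n. w \<in> f ` E n}. ennreal (h (g n w)))"
      proof (rule infsum_reindex_bij_betw[symmetric])
        show "bij_betw (\<lambda>n. g n w) {n. w \<in> f ` E n} {z\<in>S. f z = w}"
        proof (rule bij_betw_imageI)
          show "inj_on (\<lambda>n. g n w) {n. w \<in> f ` E n}"
          proof (rule inj_onI)
            fix n m assume "n \<in> {n. w \<in> f ` E n}" "m \<in> {n. w \<in> f ` E n}" and eq: "g n w = g m w"
            then obtain x y where xy: "x \<in> E n" "y \<in> E m" "w = f x" "w = f y" by auto
            then have "x = y" using eq g(2) EB by (metis subsetD)
            with xy dE show "n = m" by (auto simp: disjoint_family_on_def)
          qed
          show "(\<lambda>n. g n w) ` {n. w \<in> f ` E n} = {z\<in>S. f z = w}"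
          proof (intro set_eqI iffI)
            fix z assume "z \<in> {z\<in>S. f z = w}"
            then have "z \<in> U" and z: "f z = w" using nz by auto
            then obtain n where "z \<in> E n" using UE by auto
            then show "z \<in> (\<lambda>n. g n w) ` {n. w \<in> f ` E n}"
              using z g(2)[of z n] EB[of n] by (intro image_eqI[of _ _ n]) auto
          next
            fix z assume "z \<in> (\<lambda>n. g n w) ` {n. w \<in> f ` E n}"
            then obtain n x where x: "z = g n w" "x \<in> E n" "w = f x" by auto
            then have "x \<in> B n" "x \<in> S" using EB[of n] ES[of n] by auto
            then show "z \<in> {z\<in>S. f z = w}" using g(2)[of x n] x by simp
          qed
        qed
      qed
      also have "\<dots> = (\<Sum>\<^sub>\<infinity>n. G n w)"
      proof (rule infsum_cong_neutral)
        fix n assume "n \<in> {n. w \<in> f ` E n} \<inter> UNIV"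
        then obtain x where x: "x \<in> E n" "w = f x" by auto
        then have "x \<in> B n" using EB by auto
        then show "ennreal (h (g n w)) = G n w"
          using G_f[of x n] g(2)[of x n] x by simp
      qed (auto intro!: G_0)
      also have "\<dots> = (\<Sum>n. G n w)"
        by (rule sums_unique[OF has_sum_imp_sums[OF has_sum_infsum]])
          (simp add: nonneg_summable_on_complete)
      finally show ?thesis by (simp only: ennreal_suminf_cmult)
    qed
    show "AE w in lborel. (\<Sum>n. F w * G n w)
        = F w * (\<Sum>\<^sub>\<infinity>z\<in>{z\<in>S. f z = w}. ennreal (of_int (zorder (\<lambda>u. f u - w) z) * h z))"
      using AE_not_in[OF nfC] by (rule eventually_mono) (rule *)
  qed
  finally show ?thesis unfolding k_def .
qed

section \<open>The weighted area measure\<close>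

text \<open>
  The measure \<open>dA\<^sub>\<alpha>\<close> in the notation of the classical literature.
\<close>

abbreviation dA :: "real \<Rightarrow> complex measure"
  where "dA \<equiv> weighted_area"

text \<open>
  The density of \<open>dA \<alpha>\<close> with respect to Lebesgue measure.
\<close>

definition weight :: "real \<Rightarrow> complex \<Rightarrow> real"
  where "weight \<alpha> z = (1 + \<alpha>) / pi * (1 - (norm z)\<^sup>2) powr \<alpha>"

lemma weight_borel [measurable]: "weight \<alpha> \<in> borel_measurable borel"
  unfolding weight_def by measurable

lemma weight_nonneg: "\<alpha> > -1 \<Longrightarrow> 0 \<le> weight \<alpha> z"
  by (simp add: weight_def)

lemma sets_weighted_area [measurable_cong]:
  "sets (dA \<alpha>) = sets (restrict_space borel unit_disk)"
  by (simp add: weighted_area_def area_measure_def sets_restrict_space)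

lemma space_weighted_area [simp]: "space (dA \<alpha>) = unit_disk"
  by (simp add: weighted_area_def area_measure_def space_restrict_space)

lemma borel_measurable_weighted_areaI:
  "F \<in> borel_measurable borel \<Longrightarrow> F \<in> borel_measurable (dA \<alpha>)"
  by (simp add: measurable_cong_sets[OF sets_weighted_area refl] measurable_restrict_space1)

lemma borel_measurable_weighted_area_iff:
  "F \<in> borel_measurable (dA \<alpha>) \<longleftrightarrow> F \<in> borel_measurable (restrict_space borel unit_disk)"
  by (simp add: measurable_cong_sets[OF sets_weighted_area refl])

lemma borel_measurable_weighted_area_continuous:
  fixes f :: "complex \<Rightarrow> 'a::topological_space"
  assumes "continuous_on unit_disk f"
  shows "f \<in> borel_measurable (dA \<alpha>)"
  using borel_measurable_continuous_on_restrict[OF assms] by (simp add: borel_measurable_weighted_area_iff)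

lemma borel_measurable_weighted_area_holomorphic:
  assumes "f holomorphic_on unit_disk"
  shows "f \<in> borel_measurable (dA \<alpha>)"
  using assms by (intro borel_measurable_weighted_area_continuous holomorphic_on_imp_continuous_on)

lemma nn_integral_area_measure:
  fixes F :: "complex \<Rightarrow> ennreal"
  assumes "F \<in> borel_measurable (restrict_space borel unit_disk)"
  shows "nn_integral area_measure F = (\<integral>\<^sup>+z\<in>unit_disk. ennreal (1 / pi) * F z \<partial>lborel)"
proof -
  have F: "F \<in> borel_measurable (restrict_space lborel unit_disk)"
    using assms by (simp add: measurable_cong_sets[OF sets_restrict_space_cong[OF sets_lborel] refl])
  have "nn_integral area_measure F = (\<integral>\<^sup>+z. ennreal (1 / pi) * F z \<partial>restrict_space lborel unit_disk)"
    unfolding area_measure_def using F by (intro nn_integral_density) auto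
  also have "\<dots> = (\<integral>\<^sup>+z\<in>unit_disk. ennreal (1 / pi) * F z \<partial>lborel)"
    by (subst nn_integral_restrict_space) (auto simp: mult.commute)
  finally show ?thesis .
qed

lemma nn_integral_weighted_area_eq_area:
  fixes F :: "complex \<Rightarrow> ennreal"
  assumes "F \<in> borel_measurable (dA \<alpha>)"
  shows "nn_integral (dA \<alpha>) F
    = (\<integral>\<^sup>+z. ennreal ((1 + \<alpha>) * (1 - (norm z)\<^sup>2) powr \<alpha>) * F z \<partial>area_measure)"
proof -
  have s: "sets area_measure = sets (restrict_space borel unit_disk)"
    by (simp add: area_measure_def sets_restrict_space)
  show ?thesis
    unfolding weighted_area_def
    using assms[unfolded borel_measurable_weighted_area_iff]
    by (intro nn_integral_density)
      (auto simp: measurable_cong_sets[OF s refl] intro!: measurable_restrict_space1)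
qed

lemma nn_integral_weighted_area:
  fixes F :: "complex \<Rightarrow> ennreal"
  assumes "\<alpha> > -1" and F: "F \<in> borel_measurable (dA \<alpha>)"
  shows "nn_integral (dA \<alpha>) F = (\<integral>\<^sup>+z\<in>unit_disk. ennreal (weight \<alpha> z) * F z \<partial>lborel)"
proof -
  have [measurable]: "F \<in> borel_measurable (restrict_space borel unit_disk)"
    using F by (simp add: borel_measurable_weighted_area_iff)
  have [measurable]: "(\<lambda>z. ennreal ((1 + \<alpha>) * (1 - (norm z)\<^sup>2) powr \<alpha>)) \<in> borel_measurable (restrict_space borel unit_disk)"
    by (intro measurable_restrict_space1) measurable
  show ?thesis
    unfolding nn_integral_weighted_area_eq_area[OF F]
    using assms(1)
    by (subst nn_integral_area_measure)
      (auto intro!: nn_integral_cong simp: weight_def ennreal_mult[symmetric] mult.assoc[symmetric])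
qed

text \<open>
  The disk of radius \<open>sqrt t\<close> has area \<open>pi * t\<close>, so \<open>|z|\<^sup>2\<close> is uniformly distributed. Radial integrals thereby
  become integrals over the unit interval.
\<close>

lemma distr_norm_squared_disk:
  "distr (restrict_space lborel unit_disk) borel (\<lambda>z. (norm z)\<^sup>2)
    = density lborel (\<lambda>t. ennreal pi * indicator {0..1} t)" (is "?M = ?N")
proof (rule measure_eqI_lessThan)
  have mN: "emeasure ?N {x<..} = ennreal (pi * (1 - max 0 (min 1 x)))" for x
  proof -
    have "emeasure ?N {x<..} = (\<integral>\<^sup>+t. ennreal pi * indicator ({0..1} \<inter> {x<..}) t \<partial>lborel)"
      by (subst emeasure_density) (auto intro!: nn_integral_cong simp: indicator_def)
    also have "\<dots> = ennreal pi * emeasure lborel ({0..1} \<inter> {x<..})"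
      by (subst nn_integral_cmult_indicator) auto
    also have "emeasure lborel ({0..1} \<inter> {x<..}) = ennreal (1 - max 0 (min 1 x))"
    proof -
      have "{0..1} \<inter> {x<..} = (if x < 0 then {0..1} else {x<..1})" by auto
      then show ?thesis by (auto simp: max_def min_def)
    qed
    finally show ?thesis by (simp add: ennreal_mult')
  qed
  have mM: "emeasure ?M {x<..} = ennreal (pi * (1 - max 0 (min 1 x)))" for x
  proof -
    let ?S = "{z \<in> unit_disk. x < (norm z)\<^sup>2}"
    have "emeasure ?M {x<..} = emeasure lborel ?S"
      by (subst emeasure_distr)
        (auto simp: emeasure_restrict_space space_restrict_space intro!: measurable_restrict_space1 arg_cong[where f="emeasure lborel"])
    also have "\<dots> = ennreal (pi * (1 - max 0 (min 1 x)))"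
    proof -
      consider "x < 0" | "0 \<le> x" "x < 1" | "1 \<le> x" by linarith
      then show ?thesis
      proof cases
        case 1
        then have "?S = unit_disk" by (auto intro: less_le_trans)
        then show ?thesis using 1 by (simp add: emeasure_ball unit_ball_vol_2)
      next
        case 2
        have "?S = unit_disk - cball 0 (sqrt x)"
          using 2 by (auto simp: not_le real_less_rsqrt sqrt_le_D real_sqrt_less_iff)
            (metis norm_ge_zero real_less_lsqrt not_le real_sqrt_le_iff real_sqrt_unique sqrt_le_D)+
        moreover have "cball (0::complex) (sqrt x) \<subseteq> unit_disk"
        proof -
          have "sqrt x < 1" using 2 by simp
          then show ?thesis by (simp only: cball_subset_ball_iff dist_self) simp
        qed
        ultimately have "emeasure lborel ?S = emeasure lborel unit_disk - emeasure lborel (cball (0::complex) (sqrt x))"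
          using emeasure_Diff[of lborel "cball (0::complex) (sqrt x)" unit_disk] 2
          by (simp add: emeasure_cball)
        also have "\<dots> = ennreal pi - ennreal (pi * x)"
          using 2 by (simp add: emeasure_ball emeasure_cball unit_ball_vol_2)
        also have "\<dots> = ennreal (pi * (1 - x))"
          using 2 by (simp add: ennreal_minus algebra_simps)
        finally show ?thesis using 2 by simp
      next
        case 3
        have "(norm z)\<^sup>2 < 1" if "z \<in> unit_disk" for z :: complex
          using that by (simp add: power_less_one_iff abs_square_less_1)
        then have "?S = {}" using 3 by (force simp: not_less)
        then have "emeasure lborel ?S = 0" by (simp only: emeasure_empty)
        then show ?thesis using 3 by simp
      qed
    qed
    finally show ?thesis .
  qed
  show "emeasure ?M {x<..} = emeasure ?N {x<..}" for x by (simp only: mM mN)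
  show "emeasure ?M {x<..} < \<infinity>" for x by (simp only: mM) simp
qed simp_all

text \<open>
  With \<open>t = |z|\<^sup>2\<close> the total mass is the integral of \<open>(1 + \<alpha>) * (1 - t) powr \<alpha>\<close> over the unit interval.
\<close>

lemma emeasure_weighted_area_disk:
  assumes "\<alpha> > -1"
  shows "emeasure (dA \<alpha>) unit_disk = 1"
proof -
  have "emeasure (dA \<alpha>) unit_disk = (\<integral>\<^sup>+z. 1 \<partial>dA \<alpha>)"
    by simp
  also have "\<dots> = (\<integral>\<^sup>+z\<in>unit_disk. ennreal (weight \<alpha> z) \<partial>lborel)"
    using assms by (subst nn_integral_weighted_area) auto
  also have "\<dots> = (\<integral>\<^sup>+z. ennreal ((1 + \<alpha>) / pi * (1 - (norm z)\<^sup>2) powr \<alpha>) \<partial>restrict_space lborel unit_disk)"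
    by (subst nn_integral_restrict_space) (auto simp: weight_def)
  also have "\<dots> = (\<integral>\<^sup>+t. ennreal ((1 + \<alpha>) / pi * (1 - t) powr \<alpha>) \<partial>distr (restrict_space lborel unit_disk) borel (\<lambda>z. (norm z)\<^sup>2))"
    by (subst nn_integral_distr) (auto intro!: measurable_restrict_space1)
  also have "\<dots> = (\<integral>\<^sup>+t. ennreal pi * indicator {0..1} t * ennreal ((1 + \<alpha>) / pi * (1 - t) powr \<alpha>) \<partial>lborel)"
    unfolding distr_norm_squared_disk by (subst nn_integral_density) auto
  also have "\<dots> = (\<integral>\<^sup>+t. ennreal (indicator {0..1} t * ((1 + \<alpha>) * (1 - t) powr \<alpha>)) \<partial>lborel)"
    using assms by (intro nn_integral_cong) (auto simp: indicator_def ennreal_mult[symmetric])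
  also have "\<dots> = (\<integral>\<^sup>+t. ennreal (indicator {0..1} (1 + (-1) * t) * ((1 + \<alpha>) * (1 - (1 + (-1) * t)) powr \<alpha>)) \<partial>lborel)"
    by (subst nn_integral_real_affine[of _ "-1" 1]) auto
  also have "\<dots> = (\<integral>\<^sup>+t. ennreal (indicator {0..1} t * ((1 + \<alpha>) * t powr \<alpha>)) \<partial>lborel)"
    by (intro nn_integral_cong) (auto simp: indicator_def)
  also have "\<dots> = ennreal 1"
  proof (rule nn_integral_has_integral_lborel)
    have "((\<lambda>t. (1 + \<alpha>) * t powr \<alpha>) has_integral ((1 + \<alpha>) * (1 powr (\<alpha> + 1) / (\<alpha> + 1)))) {0..1}"
      using assms by (intro has_integral_mult_right has_integral_powr_from_0) auto
    then have "((\<lambda>t. if t \<in> {0..1} then (1 + \<alpha>) * t powr \<alpha> else 0) has_integral 1) UNIV"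
      using assms by (subst has_integral_restrict_UNIV) (simp add: add.commute)
    moreover have "(\<lambda>t. if t \<in> {0..1} then (1 + \<alpha>) * t powr \<alpha> else 0)
        = (\<lambda>t. indicator {0..1} t * ((1 + \<alpha>) * t powr \<alpha>))" by auto
    ultimately show "((\<lambda>t. indicator {0..1} t * ((1 + \<alpha>) * t powr \<alpha>)) has_integral 1) UNIV" by simp
  qed (use assms in auto)
  finally show ?thesis by simp
qed

lemma finite_measure_weighted_area: "\<alpha> > -1 \<Longrightarrow> finite_measure (dA \<alpha>)"
  by (rule finite_measureI) (simp add: emeasure_weighted_area_disk)

section \<open>The counting ratio as the density of an image measure\<close>

lemma one_minus_norm_squared_pos: "z \<in> unit_disk \<Longrightarrow> 0 < 1 - (norm z)\<^sup>2"
  by (simp add: abs_square_less_1)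

lemma counting_fun_eq_ratio:
  assumes "w \<in> unit_disk"
  shows "counting_fun \<phi> \<alpha> w = ennreal ((1 - (norm w)\<^sup>2) powr \<alpha>) * counting_ratio \<phi> \<alpha> w"
proof -
  have "0 < (1 - (norm w)\<^sup>2) powr \<alpha>"
    using one_minus_norm_squared_pos[OF assms] by simp
  then show ?thesis
    unfolding counting_ratio_def ennreal_times_divide mult.commute[of "ennreal _"]
    by (subst ennreal_mult_divide_eq) (auto simp: ennreal_eq_0_iff simp del: powr_gt_zero)
qed

text \<open>
  The measure \<open>\<psi> dA\<^sub>\<alpha>\<close> is the image of \<open>|\<phi>'|\<^sup>2 dA\<^sub>\<alpha>\<close> under \<open>\<phi>\<close>: in the change of variables the weight
  \<open>(1 - |z|\<^sup>2) powr \<alpha>\<close> at the preimages \<open>z\<close> of \<open>w\<close> adds up to the counting function at \<open>w\<close>.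
\<close>

lemma nn_integral_comp_counting_ratio:
  fixes F :: "complex \<Rightarrow> ennreal"
  assumes \<alpha>: "\<alpha> > -1" and \<phi>: "\<phi> holomorphic_on unit_disk" "\<phi> ` unit_disk \<subseteq> unit_disk"
    and nc: "\<not> \<phi> constant_on unit_disk"
    and \<psi>: "counting_ratio \<phi> \<alpha> \<in> borel_measurable (restrict_space borel unit_disk)"
    and F: "F \<in> borel_measurable (dA \<alpha>)"
  shows "(\<integral>\<^sup>+z. F (\<phi> z) * ennreal ((norm (deriv \<phi> z))\<^sup>2) \<partial>dA \<alpha>)
    = (\<integral>\<^sup>+w. F w * counting_ratio \<phi> \<alpha> w \<partial>dA \<alpha>)"
proof -
  define c where "c = (1 + \<alpha>) / pi"
  define h where "h = (\<lambda>z::complex. (1 - (norm z)\<^sup>2) powr \<alpha>)"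
  define F1 where "F1 = (\<lambda>z. indicator unit_disk z * F z)"
  have wt: "ennreal (weight \<alpha> z) = ennreal c * ennreal (h z)" for z
    unfolding weight_def c_def h_def using \<alpha> by (intro ennreal_mult) auto
  have hm [measurable]: "h \<in> borel_measurable borel" unfolding h_def by measurable
  have F1m [measurable]: "F1 \<in> borel_measurable borel"
    unfolding F1_def using F
    by (subst (asm) borel_measurable_weighted_area_iff, subst (asm) borel_measurable_restrict_space_iff_ennreal)
      (auto simp: mult.commute)
  have dm: "(\<lambda>z. ennreal ((norm (deriv \<phi> z))\<^sup>2)) \<in> borel_measurable (dA \<alpha>)"
    using holomorphic_deriv[OF \<phi>(1)]
    by (intro measurable_compose[OF _ measurable_ennreal] borel_measurable_weighted_area_continuous
        continuous_intros holomorphic_on_imp_continuous_on) auto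
  have \<phi>m: "\<phi> \<in> borel_measurable (dA \<alpha>)"
    by (rule borel_measurable_weighted_area_holomorphic[OF \<phi>(1)])
  have lm: "(\<lambda>z. F (\<phi> z) * ennreal ((norm (deriv \<phi> z))\<^sup>2)) \<in> borel_measurable (dA \<alpha>)"
  proof -
    have "(\<lambda>z. F1 (\<phi> z) * ennreal ((norm (deriv \<phi> z))\<^sup>2)) \<in> borel_measurable (dA \<alpha>)"
      using measurable_compose[OF \<phi>m F1m] dm by measurable
    then show ?thesis
      by (rule measurable_cong[THEN iffD1, rotated]) (use \<phi>(2) in \<open>auto simp: F1_def image_subset_iff\<close>)
  qed
  have "(\<integral>\<^sup>+z. F (\<phi> z) * ennreal ((norm (deriv \<phi> z))\<^sup>2) \<partial>dA \<alpha>)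
      = (\<integral>\<^sup>+z\<in>unit_disk. (ennreal c * F1 (\<phi> z)) * ennreal (h z) * ennreal ((norm (deriv \<phi> z))\<^sup>2) \<partial>lborel)"
    unfolding nn_integral_weighted_area[OF \<alpha> lm] using \<phi>(2) \<alpha>
    by (intro nn_integral_cong)
      (auto simp: indicator_def wt F1_def mult_ac image_subset_iff)
  also have "\<dots> = (\<integral>\<^sup>+w. (ennreal c * F1 w) * (\<Sum>\<^sub>\<infinity>z\<in>{z \<in> unit_disk. \<phi> z = w}.
      ennreal (of_int (zorder (\<lambda>u. \<phi> u - w) z) * h z)) \<partial>lborel)"
    by (rule nn_integral_holomorphic_counting) (use \<phi> nc in auto)
  also have "\<dots> = (\<integral>\<^sup>+w. (ennreal c * F1 w) * counting_fun \<phi> \<alpha> w \<partial>lborel)"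
    by (simp only: counting_fun_def h_def)
  also have "\<dots> = (\<integral>\<^sup>+w\<in>unit_disk. ennreal (weight \<alpha> w) * (F w * counting_ratio \<phi> \<alpha> w) \<partial>lborel)"
    using \<alpha> by (intro nn_integral_cong)
      (auto simp: indicator_def wt F1_def counting_fun_eq_ratio h_def mult_ac)
  also have "\<dots> = (\<integral>\<^sup>+w. F w * counting_ratio \<phi> \<alpha> w \<partial>dA \<alpha>)"
    by (rule nn_integral_weighted_area[OF \<alpha>, symmetric])
      (use F \<psi> in \<open>auto simp: borel_measurable_weighted_area_iff\<close>)
  finally show ?thesis .
qed

section \<open>Disk involutions and the Bergman kernel\<close>

text \<open>
  The conformal involution of the disk that exchanges \<open>0\<close> and \<open>a\<close>; its modulus is the pseudohyperbolic
  distance to \<open>a\<close>.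
\<close>

definition disk_involution :: "complex \<Rightarrow> complex \<Rightarrow> complex"
  where "disk_involution a w = (a - w) / (1 - cnj a * w)"

lemma norm_one_minus_cnj_mult_ge:
  assumes "w \<in> unit_disk"
  shows "1 - norm a \<le> norm (1 - cnj a * w)"
proof -
  have "norm (cnj a * w) \<le> norm a * 1"
    unfolding norm_mult complex_mod_cnj using assms by (intro mult_left_mono) auto
  then show ?thesis using norm_triangle_ineq2[of 1 "cnj a * w"] by simp
qed

lemma one_minus_cnj_mult_nz:
  assumes "a \<in> unit_disk" "w \<in> unit_disk"
  shows "1 - cnj a * w \<noteq> 0"
proof
  assume "1 - cnj a * w = 0"
  then have "norm (cnj a * w) = 1" by (metis eq_iff_diff_eq_0 norm_one)
  moreover have "norm a * norm w < 1 * 1" using assms by (intro mult_strict_mono') auto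
  ultimately show False by (simp add: norm_mult)
qed

lemma one_minus_norm_disk_involution:
  assumes "a \<in> unit_disk" "w \<in> unit_disk"
  shows "1 - (norm (disk_involution a w))\<^sup>2
    = (1 - (norm a)\<^sup>2) * (1 - (norm w)\<^sup>2) / (norm (1 - cnj a * w))\<^sup>2"
proof -
  have "(norm (1 - cnj a * w))\<^sup>2 - (norm (a - w))\<^sup>2 = (1 - (norm a)\<^sup>2) * (1 - (norm w)\<^sup>2)"
    unfolding cmod_power2 by (simp add: algebra_simps power2_eq_square)
  moreover have "(norm (1 - cnj a * w))\<^sup>2 \<noteq> 0" using one_minus_cnj_mult_nz[OF assms] by simp
  ultimately show ?thesis
    unfolding disk_involution_def norm_divide power_divide
    by (simp add: field_simps)
qed

lemma disk_involution_in_disk: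
  assumes "a \<in> unit_disk" "w \<in> unit_disk"
  shows "disk_involution a w \<in> unit_disk"
proof -
  have "0 < 1 - (norm (disk_involution a w))\<^sup>2"
    unfolding one_minus_norm_disk_involution[OF assms]
    using one_minus_norm_squared_pos[OF assms(1)] one_minus_norm_squared_pos[OF assms(2)]
      one_minus_cnj_mult_nz[OF assms] by simp
  then show ?thesis by (simp add: abs_square_less_1)
qed

lemma disk_involution_involutive:
  assumes "a \<in> unit_disk" "w \<in> unit_disk"
  shows "disk_involution a (disk_involution a w) = w"
proof -
  let ?d = "1 - cnj a * w"
  have d: "?d \<noteq> 0" using one_minus_cnj_mult_nz[OF assms] .
  have e: "1 - cnj a * a \<noteq> 0" using one_minus_cnj_mult_nz[OF assms(1,1)] .
  have "a - disk_involution a w = w * (1 - cnj a * a) / ?d"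
    using d by (simp add: disk_involution_def field_simps)
  moreover have "1 - cnj a * disk_involution a w = (1 - cnj a * a) / ?d"
    using d by (simp add: disk_involution_def field_simps)
  ultimately show ?thesis
    using d e by (simp add: disk_involution_def[of a "disk_involution a w"])
qed

lemma disk_involution_has_derivative:
  assumes "a \<in> unit_disk" "w \<in> unit_disk"
  shows "(disk_involution a has_field_derivative (cnj a * a - 1) / (1 - cnj a * w)\<^sup>2) (at w)"
  unfolding disk_involution_def[abs_def]
  using one_minus_cnj_mult_nz[OF assms]
  by (auto intro!: derivative_eq_intros simp: field_simps power2_eq_square)

lemma norm_bergman_kernel_squared:
  assumes "a \<in> unit_disk" "w \<in> unit_disk"
  shows "(norm (bergman_kernel \<alpha> a w))\<^sup>2
    = (1 - (norm a)\<^sup>2) powr (\<alpha> + 2) / norm (1 - cnj a * w) powr (2 * (\<alpha> + 2))"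
proof -
  have "norm (bergman_kernel \<alpha> a w) = (1 - (norm a)\<^sup>2) powr ((\<alpha> + 2) / 2) / norm (1 - cnj a * w) powr (\<alpha> + 2)"
    by (simp add: bergman_kernel_def norm_divide norm_powr_real_powr')
  moreover have "(x powr y)\<^sup>2 = x powr (2 * y)" for x y :: real
    by (simp add: power2_eq_square flip: powr_add)
  ultimately show ?thesis by (simp add: power_divide add_divide_distrib)
qed

text \<open>
  Both \<open>1 - |\<tau> w|\<^sup>2\<close> and \<open>(1 - |w|\<^sup>2) * |\<tau>' w|\<close>, with \<open>\<tau>\<close> the involution, equal
  \<open>(1 - |a|\<^sup>2) * (1 - |w|\<^sup>2) / |1 - cnj a * w|\<^sup>2\<close>. Hence \<open>|\<kappa>\<^sub>a|\<^sup>2 dA\<^sub>\<alpha>\<close> is the pullback of \<open>dA\<^sub>\<alpha>\<close> under \<open>\<tau>\<close>.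
\<close>

lemma weight_bergman_kernel:
  assumes "a \<in> unit_disk" "w \<in> unit_disk"
  shows "weight \<alpha> w * (norm (bergman_kernel \<alpha> a w))\<^sup>2
    = weight \<alpha> (disk_involution a w) * (norm (deriv (disk_involution a) w))\<^sup>2"
proof -
  let ?A = "1 - (norm a)\<^sup>2" and ?B = "1 - (norm w)\<^sup>2" and ?d = "norm (1 - cnj a * w)"
  have pos: "0 < ?A" "0 < ?B" "0 < ?d"
    using one_minus_norm_squared_pos assms one_minus_cnj_mult_nz[OF assms] by auto
  have "norm (cnj a * a - 1) = ?A"
  proof -
    have "cnj a * a - 1 = of_real (- ?A)"
      using complex_norm_square[of a] by (simp add: mult.commute)
    then show ?thesis using pos by (simp only: norm_of_real)
  qed
  then have "norm (deriv (disk_involution a) w) = ?A / ?d\<^sup>2"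
    unfolding DERIV_imp_deriv[OF disk_involution_has_derivative[OF assms]] by (simp add: norm_divide norm_power)
  moreover have "?B powr \<alpha> * (?A powr (\<alpha> + 2) / ?d powr (2 * (\<alpha> + 2)))
      = (?A * ?B / ?d\<^sup>2) powr \<alpha> * (?A / ?d\<^sup>2)\<^sup>2"
  proof -
    have "(?A * ?B / ?d\<^sup>2) powr \<alpha> = ?A powr \<alpha> * ?B powr \<alpha> / ?d powr (2 * \<alpha>)"
      using pos by (simp add: powr_divide powr_mult powr_powr flip: powr_numeral)
    moreover have "?A powr (\<alpha> + 2) = ?A powr \<alpha> * ?A\<^sup>2" using pos by (simp add: powr_add)
    moreover have "?d powr (2 * (\<alpha> + 2)) = ?d powr (2 * \<alpha>) * ?d ^ 4"
      using pos by (simp add: distrib_left powr_add)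
    ultimately show ?thesis by (simp add: power_divide power_mult[symmetric])
  qed
  ultimately show ?thesis
    unfolding norm_bergman_kernel_squared[OF assms] weight_def one_minus_norm_disk_involution[OF assms]
    by (simp only: mult.assoc)
qed

lemma bergman_kernel_holomorphic:
  assumes "a \<in> unit_disk"
  shows "bergman_kernel \<alpha> a holomorphic_on unit_disk"
proof -
  have "1 - cnj a * w \<notin> \<real>\<^sub>\<le>\<^sub>0" if "w \<in> unit_disk" for w
  proof -
    have "norm a * norm w < 1 * 1" using assms that by (intro mult_strict_mono') auto
    then have "Re (cnj a * w) < 1"
      using complex_Re_le_cmod[of "cnj a * w"] by (simp add: norm_mult)
    then show ?thesis by (auto simp: complex_nonpos_Reals_iff)
  qed
  moreover have "(1 - cnj a * w) powr complex_of_real (\<alpha> + 2) \<noteq> 0" if "w \<in> unit_disk" for w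
    using one_minus_cnj_mult_nz[OF assms that] by simp
  ultimately show ?thesis
    unfolding bergman_kernel_def[abs_def] by (intro holomorphic_intros) auto
qed

lemma nn_integral_bergman_kernel:
  fixes G :: "complex \<Rightarrow> ennreal"
  assumes \<alpha>: "\<alpha> > -1" and a: "a \<in> unit_disk" and [measurable]: "G \<in> borel_measurable borel"
  shows "(\<integral>\<^sup>+w. ennreal ((norm (bergman_kernel \<alpha> a w))\<^sup>2) * G (disk_involution a w) \<partial>dA \<alpha>)
    = nn_integral (dA \<alpha>) G"
proof -
  have hol: "disk_involution a holomorphic_on unit_disk"
    using disk_involution_has_derivative[OF a]
    by (meson field_differentiable_def field_differentiable_at_within holomorphic_on_def)
  have \<tau>m: "disk_involution a \<in> borel_measurable (dA \<alpha>)"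
    by (rule borel_measurable_weighted_area_holomorphic[OF hol])
  have \<kappa>m: "(\<lambda>w. ennreal ((norm (bergman_kernel \<alpha> a w))\<^sup>2)) \<in> borel_measurable (dA \<alpha>)"
    by (intro measurable_compose[OF _ measurable_ennreal] borel_measurable_weighted_area_continuous
        continuous_intros holomorphic_on_imp_continuous_on bergman_kernel_holomorphic[OF a])
  have "(\<integral>\<^sup>+w. ennreal ((norm (bergman_kernel \<alpha> a w))\<^sup>2) * G (disk_involution a w) \<partial>dA \<alpha>)
      = (\<integral>\<^sup>+w\<in>unit_disk. (ennreal (weight \<alpha> (disk_involution a w)) * G (disk_involution a w))
           * ennreal ((norm (deriv (disk_involution a) w))\<^sup>2) \<partial>lborel)"
  proof (subst nn_integral_weighted_area[OF \<alpha>])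
    show "(\<lambda>w. ennreal ((norm (bergman_kernel \<alpha> a w))\<^sup>2) * G (disk_involution a w)) \<in> borel_measurable (dA \<alpha>)"
      using \<kappa>m measurable_compose[OF \<tau>m, of G] by measurable
    have "ennreal (weight \<alpha> w) * (ennreal ((norm (bergman_kernel \<alpha> a w))\<^sup>2) * G (disk_involution a w))
       = (ennreal (weight \<alpha> (disk_involution a w)) * G (disk_involution a w))
           * ennreal ((norm (deriv (disk_involution a) w))\<^sup>2)" if "w \<in> unit_disk" for w
    proof -
      have "ennreal (weight \<alpha> w) * ennreal ((norm (bergman_kernel \<alpha> a w))\<^sup>2)
         = ennreal (weight \<alpha> (disk_involution a w)) * ennreal ((norm (deriv (disk_involution a) w))\<^sup>2)"
        using weight_bergman_kernel[OF a that, of \<alpha>] weight_nonneg[OF \<alpha>]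
        by (simp add: ennreal_mult[symmetric])
      then show ?thesis by (simp only: mult.assoc[symmetric]) (simp only: mult_ac)
    qed
    then show "(\<integral>\<^sup>+w\<in>unit_disk. ennreal (weight \<alpha> w) * (ennreal ((norm (bergman_kernel \<alpha> a w))\<^sup>2) * G (disk_involution a w)) \<partial>lborel)
      = (\<integral>\<^sup>+w\<in>unit_disk. (ennreal (weight \<alpha> (disk_involution a w)) * G (disk_involution a w))
           * ennreal ((norm (deriv (disk_involution a) w))\<^sup>2) \<partial>lborel)"
      by (intro nn_integral_cong) (auto simp: indicator_def)
  qed
  also have "\<dots> = (\<integral>\<^sup>+w\<in>disk_involution a ` unit_disk. ennreal (weight \<alpha> w) * G w \<partial>lborel)"
  proof (rule nn_integral_holomorphic_inj[symmetric])
    show "inj_on (disk_involution a) unit_disk"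
      using disk_involution_involutive[OF a] by (metis inj_on_def)
    show "bounded (deriv (disk_involution a) ` unit_disk)"
      unfolding bounded_iff
    proof (intro exI ballI, elim imageE)
      fix x w assume w: "w \<in> unit_disk" and x: "x = deriv (disk_involution a) w"
      have "0 < 1 - norm a" using a by simp
      moreover have "1 - norm a \<le> norm (1 - cnj a * w)"
        by (rule norm_one_minus_cnj_mult_ge[OF w])
      ultimately have "norm (cnj a * a - 1) / norm (1 - cnj a * w) ^ 2 \<le> norm (cnj a * a - 1) / (1 - norm a) ^ 2"
        by (intro divide_left_mono power_mono mult_pos_pos zero_less_power) auto
      then show "norm x \<le> norm (cnj a * a - 1) / (1 - norm a) ^ 2"
        unfolding x DERIV_imp_deriv[OF disk_involution_has_derivative[OF a w]]
        by (simp add: norm_divide norm_power)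
    qed
  qed (use hol in auto)
  also have "disk_involution a ` unit_disk = unit_disk"
  proof (intro set_eqI iffI)
    fix w assume "w \<in> unit_disk"
    then show "w \<in> disk_involution a ` unit_disk"
      using disk_involution_involutive[OF a] disk_involution_in_disk[OF a]
      by (intro image_eqI[of _ _ "disk_involution a w"]) auto
  qed (use disk_involution_in_disk[OF a] in auto)
  also have "(\<integral>\<^sup>+w\<in>unit_disk. ennreal (weight \<alpha> w) * G w \<partial>lborel) = nn_integral (dA \<alpha>) G"
    by (rule nn_integral_weighted_area[symmetric]) (auto intro: \<alpha> borel_measurable_weighted_areaI)
  finally show ?thesis .
qed

section \<open>Open sets and exhaustion of the disk\<close>

lemma emeasure_weighted_area:
  assumes "\<alpha> > -1" "A \<in> sets borel" "A \<subseteq> unit_disk"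
  shows "emeasure (dA \<alpha>) A = (\<integral>\<^sup>+z\<in>A. ennreal (weight \<alpha> z) \<partial>lborel)"
proof -
  have [measurable]: "A \<in> sets borel" by fact
  have "A \<in> sets (dA \<alpha>)"
    using assms by (simp add: sets_weighted_area sets_restrict_space_iff)
  then have "emeasure (dA \<alpha>) A = (\<integral>\<^sup>+z. indicator A z \<partial>dA \<alpha>)"
    by simp
  also have "\<dots> = (\<integral>\<^sup>+z\<in>unit_disk. ennreal (weight \<alpha> z) * indicator A z \<partial>lborel)"
    by (rule nn_integral_weighted_area[OF assms(1)]) (intro borel_measurable_weighted_areaI, measurable)
  also have "\<dots> = (\<integral>\<^sup>+z\<in>A. ennreal (weight \<alpha> z) \<partial>lborel)"
    using assms(3) by (intro nn_integral_cong) (auto simp: indicator_def)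
  finally show ?thesis .
qed

lemma emeasure_weighted_area_open_pos:
  assumes "\<alpha> > -1" "open A" "A \<noteq> {}" "A \<subseteq> unit_disk"
  shows "emeasure (dA \<alpha>) A > 0"
proof (rule ccontr)
  assume "\<not> ?thesis"
  then have "emeasure (dA \<alpha>) A = 0" by (simp add: zero_less_iff_neq_zero)
  then have "(\<integral>\<^sup>+z\<in>A. ennreal (weight \<alpha> z) \<partial>lborel) = 0"
    using assms by (simp add: emeasure_weighted_area)
  then have "AE z in lborel. ennreal (weight \<alpha> z) * indicator A z = 0"
    using assms(2) by (subst (asm) nn_integral_0_iff_AE) auto
  then have "AE z in lborel. z \<notin> A"
  proof (rule eventually_mono)
    fix z assume "ennreal (weight \<alpha> z) * indicator A z = 0"
    moreover have "z \<in> A \<Longrightarrow> weight \<alpha> z > 0"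
      using assms(1,4) one_minus_norm_squared_pos[of z] unfolding weight_def
      by (intro mult_pos_pos) auto
    ultimately show "z \<notin> A" by (auto simp: indicator_def split: if_splits)
  qed
  then have "A \<in> null_sets lborel"
    using assms(2) by (subst (asm) AE_iff_null_sets[symmetric]) auto
  then have "negligible A"
    by (simp add: negligible_iff_null_sets null_sets_completionI)
  with open_not_negligible assms show False by blast
qed

lemma nn_integral_weighted_area_exhaust:
  fixes F :: "complex \<Rightarrow> ennreal"
  assumes F [measurable]: "F \<in> borel_measurable (dA \<alpha>)"
    and le: "\<And>\<rho>. 0 < \<rho> \<Longrightarrow> \<rho> < 1 \<Longrightarrow> (\<integral>\<^sup>+z. F z * indicator (ball 0 \<rho>) z \<partial>dA \<alpha>) \<le> C"
  shows "nn_integral (dA \<alpha>) F \<le> C"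
proof -
  define \<rho> where "\<rho> = (\<lambda>i. 1 - 1 / (real i + 2))"
  have \<rho>: "0 < \<rho> i" "\<rho> i < 1" for i by (auto simp: \<rho>_def field_simps)
  have mono: "\<rho> i \<le> \<rho> j" if "i \<le> j" for i j using that by (simp add: \<rho>_def field_simps)
  let ?f = "\<lambda>i z. F z * indicator (ball 0 (\<rho> i)) z"
  have fm: "?f i \<in> borel_measurable (dA \<alpha>)" for i
    by (intro borel_measurable_times_ennreal F borel_measurable_weighted_areaI borel_measurable_indicator) auto
  have "incseq ?f"
    using mono by (intro monoI le_funI mult_left_mono) (auto simp: indicator_def dest: mono less_le_trans)
  moreover have "(SUP i. ?f i z) = F z" if z: "z \<in> unit_disk" for z
  proof -
    obtain i where i: "1 / (real i + 2) < 1 - norm z"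
    proof -
      obtain i where "inverse (real (Suc i)) < 1 - norm z"
        using reals_Archimedean[of "1 - norm z"] z by auto
      moreover have "1 / (real i + 2) \<le> inverse (real (Suc i))" by (simp add: field_simps)
      ultimately show ?thesis using that by (meson le_less_trans)
    qed
    show ?thesis
    proof (rule antisym)
      show "(SUP i. ?f i z) \<le> F z" by (intro SUP_least) (auto simp: indicator_def)
      have "F z = ?f i z" using i by (auto simp: \<rho>_def indicator_def)
      then show "F z \<le> (SUP i. ?f i z)" by (metis SUP_upper UNIV_I)
    qed
  qed
  ultimately have "nn_integral (dA \<alpha>) F = (SUP i. \<integral>\<^sup>+z. ?f i z \<partial>dA \<alpha>)"
    using nn_integral_monotone_convergence_SUP[of ?f "dA \<alpha>"] fm
    by (simp cong: nn_integral_cong_simp)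
  also have "\<dots> \<le> C" using le \<rho> by (intro SUP_least) auto
  finally show ?thesis .
qed

section \<open>Rotations and orthogonality of monomials\<close>

lemma nn_integral_weighted_area_rotate:
  fixes F :: "complex \<Rightarrow> ennreal"
  assumes "\<alpha> > -1" "norm c = 1" and [measurable]: "F \<in> borel_measurable borel"
  shows "(\<integral>\<^sup>+z. F (c * z) \<partial>dA \<alpha>) = nn_integral (dA \<alpha>) F"
proof -
  have c0: "c \<noteq> 0" using assms by auto
  have im: "(*) c ` unit_disk = unit_disk"
  proof (intro set_eqI iffI)
    fix z assume "z \<in> unit_disk"
    then show "z \<in> (*) c ` unit_disk"
      using c0 assms by (intro image_eqI[of _ _ "z / c"]) (auto simp: norm_divide)
  qed (use assms in \<open>auto simp: norm_mult\<close>)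
  have "(\<integral>\<^sup>+z. F (c * z) \<partial>dA \<alpha>)
      = (\<integral>\<^sup>+z\<in>unit_disk. (ennreal (weight \<alpha> (c * z)) * F (c * z)) * ennreal ((norm (deriv ((*) c) z))\<^sup>2) \<partial>lborel)"
    using assms by (subst nn_integral_weighted_area)
      (auto intro!: borel_measurable_weighted_areaI nn_integral_cong simp: weight_def norm_mult)
  also have "\<dots> = (\<integral>\<^sup>+z\<in>(*) c ` unit_disk. ennreal (weight \<alpha> z) * F z \<partial>lborel)"
  proof (rule nn_integral_holomorphic_inj[symmetric])
    show "bounded (deriv ((*) c) ` unit_disk)" by (rule bounded_subset[of "{c}"]) auto
  qed (use c0 in \<open>auto intro!: holomorphic_intros inj_onI\<close>)
  also have "\<dots> = nn_integral (dA \<alpha>) F"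
    unfolding im using assms by (intro nn_integral_weighted_area[symmetric] borel_measurable_weighted_areaI) auto
  finally show ?thesis .
qed

lemma distr_weighted_area_rotate:
  assumes "\<alpha> > -1" "norm c = 1"
  shows "distr (dA \<alpha>) borel ((*) c) = distr (dA \<alpha>) borel (\<lambda>z. z)"
proof (rule measure_eqI)
  have [measurable]: "(*) c \<in> borel_measurable (dA \<alpha>)" "(\<lambda>z. z) \<in> borel_measurable (dA \<alpha>)"
    by (rule borel_measurable_weighted_areaI, simp)+
  fix A :: "complex set" assume "A \<in> sets (distr (dA \<alpha>) borel ((*) c))"
  then have [measurable]: "A \<in> sets borel" by simp
  have "emeasure (distr (dA \<alpha>) borel f) A = (\<integral>\<^sup>+z. indicator A (f z) \<partial>dA \<alpha>)"
    if "f \<in> borel_measurable (dA \<alpha>)" for f :: "complex \<Rightarrow> complex"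
    using that by (subst nn_integral_distr[symmetric, of f _ borel "indicator A"]) auto
  then show "emeasure (distr (dA \<alpha>) borel ((*) c)) A = emeasure (distr (dA \<alpha>) borel (\<lambda>z. z)) A"
    using nn_integral_weighted_area_rotate[OF assms, of "indicator A"] by simp
qed simp

lemma integral_weighted_area_rotate:
  fixes f :: "complex \<Rightarrow> complex"
  assumes "\<alpha> > -1" "norm c = 1" "f \<in> borel_measurable borel"
  shows "(\<integral>z. f (c * z) \<partial>dA \<alpha>) = (\<integral>z. f z \<partial>dA \<alpha>)"
proof -
  have "(\<integral>z. f (c * z) \<partial>dA \<alpha>) = integral\<^sup>L (distr (dA \<alpha>) borel ((*) c)) f"
    using assms by (intro integral_distr[symmetric] borel_measurable_weighted_areaI) auto
  also have "\<dots> = integral\<^sup>L (distr (dA \<alpha>) borel (\<lambda>z. z)) f"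
    by (simp only: distr_weighted_area_rotate[OF assms(1,2)])
  also have "\<dots> = (\<integral>z. f z \<partial>dA \<alpha>)"
    using assms by (subst integral_distr) (auto intro!: borel_measurable_weighted_areaI)
  finally show ?thesis .
qed

text \<open>
  A rotation by \<open>c\<close> multiplies the integrand by \<open>c ^ (j - k)\<close>. For \<open>c\<close> with \<open>c ^ (j - k) = -1\<close> the
  integral equals its own negative.
\<close>

lemma integral_monomials_orthogonal:
  assumes "\<alpha> > -1" "k < j"
  shows "(\<integral>z. indicator (ball 0 \<rho>) z *\<^sub>R (cnj (z ^ k) * z ^ j) \<partial>dA \<alpha>) = 0" (is "?I = 0")
proof -
  define c where "c = cis (pi / real (j - k))"
  have c1: "norm c = 1" by (simp add: c_def)
  have "c ^ (j - k) = -1"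
    using assms by (simp add: c_def Complex.DeMoivre)
  moreover have "cnj (c ^ k) * c ^ j = c ^ (j - k)"
  proof -
    have "cnj (c ^ k) * c ^ j = (cnj c * c) ^ k * c ^ (j - k)"
      using assms by (simp add: power_mult_distrib flip: power_add)
    also have "cnj c * c = 1" using complex_norm_square[of c] c1 by (simp add: mult.commute)
    finally show ?thesis by simp
  qed
  ultimately have cc: "cnj (c ^ k) * c ^ j = -1" by simp
  have "(\<integral>z. indicator (ball 0 \<rho>) (c * z) *\<^sub>R (cnj ((c * z) ^ k) * (c * z) ^ j) \<partial>dA \<alpha>) = ?I"
    by (rule integral_weighted_area_rotate[OF assms(1) c1],
        intro borel_measurable_scaleR borel_measurable_indicator borel_measurable_continuous_onI continuous_intros) auto
  moreover have "(\<lambda>z. indicator (ball 0 \<rho>) (c * z) *\<^sub>R (cnj ((c * z) ^ k) * (c * z) ^ j))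
      = (\<lambda>z. - (indicator (ball 0 \<rho>) z *\<^sub>R (cnj (z ^ k) * z ^ j)))"
  proof
    fix z :: complex
    have "cnj ((c * z) ^ k) * (c * z) ^ j = (cnj (c ^ k) * c ^ j) * (cnj (z ^ k) * z ^ j)"
      by (simp add: power_mult_distrib)
    then have "cnj ((c * z) ^ k) * (c * z) ^ j = - (cnj (z ^ k) * z ^ j)" using cc by simp
    moreover have "(c * z \<in> ball 0 \<rho>) = (z \<in> ball 0 \<rho>)" using c1 by (simp add: norm_mult)
    ultimately show "indicator (ball 0 \<rho>) (c * z) *\<^sub>R (cnj ((c * z) ^ k) * (c * z) ^ j)
      = - (indicator (ball 0 \<rho>) z *\<^sub>R (cnj (z ^ k) * z ^ j))"
      by (simp only: indicator_def scaleR_minus_right)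
  qed
  ultimately have "- ?I = ?I" by simp
  moreover have "- x = x \<Longrightarrow> x = 0" for x :: complex by (simp add: complex_eq_iff)
  ultimately show ?thesis by blast
qed

section \<open>Taylor tails in the weighted Bergman space\<close>

definition taylor_coeff :: "(complex \<Rightarrow> complex) \<Rightarrow> nat \<Rightarrow> complex"
  where "taylor_coeff g k = (deriv ^^ k) g 0 / fact k"

definition taylor_tail :: "nat \<Rightarrow> (complex \<Rightarrow> complex) \<Rightarrow> complex \<Rightarrow> complex"
  where "taylor_tail n g z = g z - (\<Sum>k<n. taylor_coeff g k * z ^ k)"

lemma taylor_tail_Suc: "taylor_tail n g z = taylor_coeff g n * z ^ n + taylor_tail (Suc n) g z"
  by (simp add: taylor_tail_def)

lemma taylor_tail_0 [simp]: "taylor_tail 0 g = g"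
  by (simp add: taylor_tail_def fun_eq_iff)

lemma holomorphic_taylor_tail [holomorphic_intros]:
  "g holomorphic_on S \<Longrightarrow> taylor_tail n g holomorphic_on S"
  unfolding taylor_tail_def[abs_def] by (intro holomorphic_intros)

lemma taylor_tail_sums:
  assumes "g holomorphic_on unit_disk" "z \<in> unit_disk"
  shows "(\<lambda>j. taylor_coeff g (j + n) * z ^ (j + n)) sums taylor_tail n g z"
  using sums_split_initial_segment[OF holomorphic_power_series[OF assms], of n]
  by (simp add: taylor_tail_def taylor_coeff_def)

lemma summable_norm_taylor:
  assumes "g holomorphic_on unit_disk" "0 \<le> \<rho>" "\<rho> < 1"
  shows "summable (\<lambda>j. norm (taylor_coeff g (j + n)) * \<rho> ^ (j + n))"
proof -
  define r where "r = (\<rho> + 1) / 2"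
  have r: "\<rho> < r" "r < 1" "0 \<le> r" using assms by (auto simp: r_def)
  have "summable (\<lambda>j. taylor_coeff g j * complex_of_real r ^ j)"
    using taylor_tail_sums[OF assms(1), of "of_real r" 0] r by (auto simp: sums_iff)
  then have "summable (\<lambda>j. norm (taylor_coeff g j * complex_of_real \<rho> ^ j))"
    by (rule powser_insidea) (use r assms in auto)
  then have "summable (\<lambda>j. norm (taylor_coeff g j) * \<rho> ^ j)"
    using assms by (simp add: norm_mult norm_power)
  then show ?thesis by (rule summable_ignore_initial_segment)
qed

lemma integrable_weighted_area_bounded:
  fixes f :: "complex \<Rightarrow> 'a::{banach, second_countable_topology}"
  assumes "\<alpha> > -1" "f \<in> borel_measurable (dA \<alpha>)" "\<And>z. z \<in> unit_disk \<Longrightarrow> norm (f z) \<le> B"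
  shows "integrable (dA \<alpha>) f"
proof -
  interpret finite_measure "dA \<alpha>" by (rule finite_measure_weighted_area[OF assms(1)])
  show ?thesis
    by (rule integrable_const_bound[where B=B]) (use assms in auto)
qed

lemma integrable_ball_continuous:
  fixes f :: "complex \<Rightarrow> 'a::{banach, second_countable_topology}"
  assumes "\<alpha> > -1" "continuous_on unit_disk f" "\<rho> < 1"
  shows "integrable (dA \<alpha>) (\<lambda>z. indicator (ball 0 \<rho>) z *\<^sub>R f z)"
proof -
  have "cball (0::complex) \<rho> \<subseteq> unit_disk" using assms by auto
  then have "compact (f ` cball 0 \<rho>)"
    using assms(2) by (intro compact_continuous_image continuous_on_subset[OF assms(2)]) auto
  then have "bounded (f ` cball 0 \<rho>)" by (rule compact_imp_bounded)
  then obtain B where B: "\<And>z. z \<in> cball 0 \<rho> \<Longrightarrow> norm (f z) \<le> B"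
    unfolding bounded_iff by blast
  then have "norm (indicator (ball 0 \<rho>) z *\<^sub>R f z) \<le> \<bar>B\<bar>" for z
    using order_trans[OF B[of z] abs_ge_self[of B]] by (auto simp: indicator_def)
  then show ?thesis
    by (intro integrable_weighted_area_bounded[OF assms(1), where B="\<bar>B\<bar>"] borel_measurable_scaleR
        borel_measurable_weighted_area_continuous[OF assms(2)] borel_measurable_weighted_areaI
        borel_measurable_indicator) auto
qed

text \<open>
  On a smaller concentric disk the Taylor series converges absolutely and uniformly, so it may be
  integrated term by term.
\<close>

lemma integral_taylor_tail_orthogonal:
  assumes \<alpha>: "\<alpha> > -1" and g: "g holomorphic_on unit_disk" and \<rho>: "0 \<le> \<rho>" "\<rho> < 1"
  shows "(\<integral>z. indicator (ball 0 \<rho>) z *\<^sub>R (cnj (z ^ k) * taylor_tail (Suc k) g z) \<partial>dA \<alpha>) = 0"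
proof -
  interpret finite_measure "dA \<alpha>" by (rule finite_measure_weighted_area[OF \<alpha>])
  define a where "a = (\<lambda>j. taylor_coeff g (j + Suc k))"
  let ?f = "\<lambda>j z. indicator (ball 0 \<rho>) z *\<^sub>R (cnj (z ^ k) * (a j * z ^ (j + Suc k)))"
  have int: "integrable (dA \<alpha>) (?f j)" for j
    by (rule integrable_ball_continuous[OF \<alpha> _ \<rho>(2)]) (intro continuous_intros)
  have bd: "norm (?f j z) \<le> norm (a j) * \<rho> ^ (j + Suc k)" if "z \<in> unit_disk" for j z
  proof (cases "z \<in> ball 0 \<rho>")
    case True
    have "norm (?f j z) = norm z ^ k * (norm (a j) * norm z ^ (j + Suc k))"
      using True by (simp add: norm_mult norm_power)
    also have "\<dots> \<le> 1 * (norm (a j) * \<rho> ^ (j + Suc k))"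
      using that True \<rho> by (intro mult_mono power_mono power_le_one) auto
    finally show ?thesis by simp
  next
    case False then show ?thesis using \<rho> by simp
  qed
  have sm: "summable (\<lambda>j. norm (a j) * \<rho> ^ (j + Suc k))"
    unfolding a_def by (rule summable_norm_taylor[OF g \<rho>])
  have "(\<integral>z. (\<Sum>j. ?f j z) \<partial>dA \<alpha>) = (\<Sum>j. \<integral>z. ?f j z \<partial>dA \<alpha>)"
  proof (rule integral_suminf[OF int])
    show "AE z in dA \<alpha>. summable (\<lambda>j. norm (?f j z))"
    proof (rule AE_I2)
      fix z assume "z \<in> space (dA \<alpha>)"
      then show "summable (\<lambda>j. norm (?f j z))"
        using bd by (intro summable_comparison_test'[OF sm, of 0]) auto
    qed
    show "summable (\<lambda>j. \<integral>z. norm (?f j z) \<partial>dA \<alpha>)"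
    proof (rule summable_comparison_test'[OF summable_mult2[OF sm], of 0])
      fix j :: nat
      have "(\<integral>z. norm (?f j z) \<partial>dA \<alpha>) \<le> (\<integral>z. norm (a j) * \<rho> ^ (j + Suc k) \<partial>dA \<alpha>)"
        using bd by (intro integral_mono integrable_norm int) auto
      then show "norm (\<integral>z. norm (?f j z) \<partial>dA \<alpha>)
          \<le> norm (a j) * \<rho> ^ (j + Suc k) * measure (dA \<alpha>) unit_disk"
        by (simp add: integral_nonneg_AE mult_ac)
    qed
  qed
  also have "\<dots> = 0"
  proof -
    have "(\<integral>z. ?f j z \<partial>dA \<alpha>) = 0" for j
    proof -
      have "?f j = (\<lambda>z. a j * (indicator (ball 0 \<rho>) z *\<^sub>R (cnj (z ^ k) * z ^ (j + Suc k))))"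
        by (auto simp: fun_eq_iff indicator_def)
      moreover have "(\<integral>z. indicator (ball 0 \<rho>) z *\<^sub>R (cnj (z ^ k) * z ^ (j + Suc k)) \<partial>dA \<alpha>) = 0"
        by (rule integral_monomials_orthogonal[OF \<alpha>]) simp
      ultimately show ?thesis by (simp only: integral_mult_right_zero mult_zero_right)
    qed
    then show ?thesis by (simp only: suminf_zero)
  qed
  finally have "(\<integral>z. (\<Sum>j. ?f j z) \<partial>dA \<alpha>) = 0" .
  moreover have "(\<integral>z. (\<Sum>j. ?f j z) \<partial>dA \<alpha>)
     = (\<integral>z. indicator (ball 0 \<rho>) z *\<^sub>R (cnj (z ^ k) * taylor_tail (Suc k) g z) \<partial>dA \<alpha>)"
  proof (rule Bochner_Integration.integral_cong[OF refl])
    fix z assume "z \<in> space (dA \<alpha>)"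
    then have "(\<lambda>j. a j * z ^ (j + Suc k)) sums taylor_tail (Suc k) g z"
      unfolding a_def by (intro taylor_tail_sums[OF g]) simp
    then have "(\<lambda>j. ?f j z) sums (indicator (ball 0 \<rho>) z *\<^sub>R (cnj (z ^ k) * taylor_tail (Suc k) g z))"
      by (intro sums_scaleR_right sums_mult)
    then show "(\<Sum>j. ?f j z) = indicator (ball 0 \<rho>) z *\<^sub>R (cnj (z ^ k) * taylor_tail (Suc k) g z)"
      by (rule sums_unique[symmetric])
  qed
  ultimately show ?thesis by (simp only:)
qed

text \<open>
  The squared \<open>L\<^sup>2\<close> norm over a concentric disk. For a radius below 1 every function holomorphic on the unit
  disk is bounded there; identities are proved for such radii and transferred by letting the radius tend to 1.
\<close>

definition ball_energy :: "real \<Rightarrow> real \<Rightarrow> (complex \<Rightarrow> complex) \<Rightarrow> real"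
  where "ball_energy \<alpha> \<rho> g = (\<integral>z. indicator (ball 0 \<rho>) z *\<^sub>R (norm (g z))\<^sup>2 \<partial>dA \<alpha>)"

lemma ball_energy_nonneg: "0 \<le> ball_energy \<alpha> \<rho> g"
  unfolding ball_energy_def by (intro integral_nonneg_AE) auto

lemma integral_add_Re_mult:
  fixes F1 F2 :: "'a \<Rightarrow> real" and F3 :: "'a \<Rightarrow> complex"
  assumes F: "integrable M F1" "integrable M F2" "integrable M F3"
  shows "(\<integral>x. F1 x + F2 x + 2 * Re (c * F3 x) \<partial>M)
    = (\<integral>x. F1 x \<partial>M) + (\<integral>x. F2 x \<partial>M) + 2 * Re (c * (\<integral>x. F3 x \<partial>M))"
proof -
  have i: "integrable M (\<lambda>x. c * F3 x)" using F(3) by (rule integrable_mult_right)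
  then have j: "integrable M (\<lambda>x. 2 * Re (c * F3 x))" by (rule integrable_mult_right[OF integrable_Re])
  have "(\<integral>x. F1 x + F2 x + 2 * Re (c * F3 x) \<partial>M)
      = (\<integral>x. F1 x \<partial>M) + (\<integral>x. F2 x \<partial>M) + (\<integral>x. 2 * Re (c * F3 x) \<partial>M)"
    by (subst Bochner_Integration.integral_add[OF Bochner_Integration.integrable_add[OF F(1,2)] j])
      (simp only: Bochner_Integration.integral_add[OF F(1,2)])
  also have "(\<integral>x. 2 * Re (c * F3 x) \<partial>M) = 2 * Re (c * (\<integral>x. F3 x \<partial>M))"
    by (simp only: integral_mult_right_zero integral_Re[OF i])
  finally show ?thesis .
qed

text \<open>
  Pythagoras for the splitting of a tail into its leading monomial and the next tail.
\<close>

lemma ball_energy_taylor_tail: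
  assumes \<alpha>: "\<alpha> > -1" and g: "g holomorphic_on unit_disk" and \<rho>: "0 \<le> \<rho>" "\<rho> < 1"
  shows "ball_energy \<alpha> \<rho> (taylor_tail k g)
    = ball_energy \<alpha> \<rho> (\<lambda>z. taylor_coeff g k * z ^ k) + ball_energy \<alpha> \<rho> (taylor_tail (Suc k) g)"
proof -
  let ?W = "dA \<alpha>" and ?I = "indicator (ball 0 \<rho>) :: complex \<Rightarrow> real"
  let ?b = "taylor_coeff g k" and ?t = "taylor_tail (Suc k) g"
  have ct: "continuous_on unit_disk ?t"
    by (intro holomorphic_on_imp_continuous_on holomorphic_intros g)
  have i1: "integrable ?W (\<lambda>z. ?I z *\<^sub>R (norm (?b * z ^ k))\<^sup>2)"
    and i2: "integrable ?W (\<lambda>z. ?I z *\<^sub>R (norm (?t z))\<^sup>2)"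
    and i3: "integrable ?W (\<lambda>z. ?I z *\<^sub>R (cnj (z ^ k) * ?t z))"
    by (intro integrable_ball_continuous[OF \<alpha> _ \<rho>(2)] continuous_intros ct)+
  have "ball_energy \<alpha> \<rho> (taylor_tail k g) = (\<integral>z. ?I z *\<^sub>R (norm (?b * z ^ k))\<^sup>2 + ?I z *\<^sub>R (norm (?t z))\<^sup>2
      + 2 * Re (cnj ?b * (?I z *\<^sub>R (cnj (z ^ k) * ?t z))) \<partial>?W)"
    unfolding ball_energy_def
  proof (rule Bochner_Integration.integral_cong[OF refl])
    fix z
    have eq: "cnj ?b * (?I z *\<^sub>R (cnj (z ^ k) * ?t z)) = ?I z *\<^sub>R (cnj (?b * z ^ k) * ?t z)"
      by (simp add: mult.assoc)
    have "(norm (x + y))\<^sup>2 = (norm x)\<^sup>2 + (norm y)\<^sup>2 + 2 * Re (cnj x * y)" for x y :: complex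
      unfolding cmod_power2 by (simp add: power2_eq_square algebra_simps)
    then show "?I z *\<^sub>R (norm (taylor_tail k g z))\<^sup>2 = ?I z *\<^sub>R (norm (?b * z ^ k))\<^sup>2 + ?I z *\<^sub>R (norm (?t z))\<^sup>2
      + 2 * Re (cnj ?b * (?I z *\<^sub>R (cnj (z ^ k) * ?t z)))"
      unfolding taylor_tail_Suc[of k] eq by (simp only:) (auto simp: indicator_def)
  qed
  also have "\<dots> = ball_energy \<alpha> \<rho> (\<lambda>z. ?b * z ^ k) + ball_energy \<alpha> \<rho> ?t
      + 2 * Re (cnj ?b * (\<integral>z. ?I z *\<^sub>R (cnj (z ^ k) * ?t z) \<partial>?W))"
    unfolding ball_energy_def by (rule integral_add_Re_mult[OF i1 i2 i3])
  finally show ?thesis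
    using integral_taylor_tail_orthogonal[OF assms] by simp
qed

lemma ball_energy_taylor_tail_le:
  assumes "\<alpha> > -1" "g holomorphic_on unit_disk" "0 \<le> \<rho>" "\<rho> < 1"
  shows "ball_energy \<alpha> \<rho> (taylor_tail k g) \<le> ball_energy \<alpha> \<rho> g"
proof (induction k)
  case (Suc k)
  then show ?case
    using ball_energy_taylor_tail[OF assms, of k] ball_energy_nonneg[of \<alpha> \<rho>] by (smt (verit))
qed simp

text \<open>
  The squared norm of the weighted Bergman space, infinite outside that space.
\<close>

definition energy :: "real \<Rightarrow> (complex \<Rightarrow> complex) \<Rightarrow> ennreal"
  where "energy \<alpha> g = (\<integral>\<^sup>+z. ennreal ((norm (g z))\<^sup>2) \<partial>dA \<alpha>)"

lemma ball_energy_eq_nn_integral: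
  assumes "\<alpha> > -1" "g holomorphic_on unit_disk" "\<rho> < 1"
  shows "(\<integral>\<^sup>+z. ennreal ((norm (g z))\<^sup>2) * indicator (ball 0 \<rho>) z \<partial>dA \<alpha>) = ennreal (ball_energy \<alpha> \<rho> g)"
proof -
  have "integrable (dA \<alpha>) (\<lambda>z. indicator (ball 0 \<rho>) z *\<^sub>R (norm (g z))\<^sup>2)"
    by (intro integrable_ball_continuous[OF assms(1) _ assms(3)] continuous_intros
        holomorphic_on_imp_continuous_on assms)
  then have "(\<integral>\<^sup>+z. ennreal (indicator (ball 0 \<rho>) z *\<^sub>R (norm (g z))\<^sup>2) \<partial>dA \<alpha>) = ennreal (ball_energy \<alpha> \<rho> g)"
    unfolding ball_energy_def by (intro nn_integral_eq_integral) auto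
  then show ?thesis
    by (simp add: ennreal_mult'' ennreal_indicator mult.commute)
qed

lemma borel_measurable_norm_squared:
  assumes "g holomorphic_on unit_disk"
  shows "(\<lambda>z. ennreal ((norm (g z))\<^sup>2)) \<in> borel_measurable (dA \<alpha>)"
  by (intro measurable_compose[OF _ measurable_ennreal] borel_measurable_weighted_area_continuous
      continuous_intros holomorphic_on_imp_continuous_on assms)

lemma ball_energy_le_energy:
  assumes "\<alpha> > -1" "g holomorphic_on unit_disk" "\<rho> < 1"
  shows "ennreal (ball_energy \<alpha> \<rho> g) \<le> energy \<alpha> g"
  unfolding ball_energy_eq_nn_integral[OF assms, symmetric] energy_def
  by (intro nn_integral_mono) (auto simp: indicator_def)

lemma energy_le_if_ball_energy_le:
  assumes "\<alpha> > -1" "f holomorphic_on unit_disk" "g holomorphic_on unit_disk"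
    and le: "\<And>\<rho>. 0 < \<rho> \<Longrightarrow> \<rho> < 1 \<Longrightarrow> ball_energy \<alpha> \<rho> f \<le> ball_energy \<alpha> \<rho> g"
  shows "energy \<alpha> f \<le> energy \<alpha> g"
  unfolding energy_def[of \<alpha> f]
proof (rule nn_integral_weighted_area_exhaust[OF borel_measurable_norm_squared[OF assms(2)]])
  fix \<rho> :: real assume \<rho>: "0 < \<rho>" "\<rho> < 1"
  have "ennreal (ball_energy \<alpha> \<rho> f) \<le> ennreal (ball_energy \<alpha> \<rho> g)"
    by (rule ennreal_leI[OF le[OF \<rho>]])
  also have "\<dots> \<le> energy \<alpha> g" by (rule ball_energy_le_energy[OF assms(1,3) \<rho>(2)])
  finally show "(\<integral>\<^sup>+z. ennreal ((norm (f z))\<^sup>2) * indicator (ball 0 \<rho>) z \<partial>dA \<alpha>) \<le> energy \<alpha> g"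
    unfolding ball_energy_eq_nn_integral[OF assms(1,2) \<rho>(2)] .
qed

lemma energy_taylor_tail_le:
  assumes "\<alpha> > -1" "g holomorphic_on unit_disk"
  shows "energy \<alpha> (taylor_tail n g) \<le> energy \<alpha> g"
  by (intro energy_le_if_ball_energy_le holomorphic_intros ball_energy_taylor_tail_le assms) auto

lemma energy_monomial_le:
  assumes "\<alpha> > -1" "g holomorphic_on unit_disk"
  shows "energy \<alpha> (\<lambda>z. taylor_coeff g k * z ^ k) \<le> energy \<alpha> g"
proof (rule energy_le_if_ball_energy_le)
  fix \<rho> :: real assume \<rho>: "0 < \<rho>" "\<rho> < 1"
  have "ball_energy \<alpha> \<rho> (\<lambda>z. taylor_coeff g k * z ^ k) \<le> ball_energy \<alpha> \<rho> (taylor_tail k g)"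
    using ball_energy_taylor_tail[OF assms, of \<rho> k] ball_energy_nonneg[of \<alpha> \<rho> "taylor_tail (Suc k) g"] \<rho> by simp
  also have "\<dots> \<le> ball_energy \<alpha> \<rho> g" using \<rho> by (intro ball_energy_taylor_tail_le assms) auto
  finally show "ball_energy \<alpha> \<rho> (\<lambda>z. taylor_coeff g k * z ^ k) \<le> ball_energy \<alpha> \<rho> g" .
qed (use assms in \<open>auto intro!: holomorphic_intros\<close>)

text \<open>
  The \<open>k\<close>-th Taylor monomial is an orthogonal component of \<open>g\<close>, so its energy on the annulus
  \<open>r < |z| < 1\<close>, which has positive mass, is at most that of \<open>g\<close>.
\<close>

lemma taylor_coeff_bound:
  assumes \<alpha>: "\<alpha> > -1" and r: "0 < r" "r < 1"
  obtains c where "0 < c"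
    "\<And>g k. g holomorphic_on unit_disk \<Longrightarrow> energy \<alpha> g < \<infinity> \<Longrightarrow> norm (taylor_coeff g k) * r ^ k \<le> c * sqrt (enn2real (energy \<alpha> g))"
proof -
  interpret finite_measure "dA \<alpha>" by (rule finite_measure_weighted_area[OF \<alpha>])
  let ?A = "unit_disk - cball (0::complex) r"
  have A: "open ?A" "?A \<subseteq> unit_disk" "?A \<noteq> {}"
  proof -
    have "complex_of_real ((r + 1) / 2) \<in> ?A" using r by (simp only: mem_ball_0 Diff_iff mem_cball_0 norm_of_real) auto
    then show "?A \<noteq> {}" by blast
  qed auto
  define m where "m = measure (dA \<alpha>) ?A"
  have m: "emeasure (dA \<alpha>) ?A = ennreal m" "0 < m"
    using emeasure_weighted_area_open_pos[OF \<alpha> A(1,3,2)] by (auto simp: m_def emeasure_eq_measure)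
  have As: "?A \<in> sets (dA \<alpha>)" by (auto simp: sets_weighted_area sets_restrict_space_iff)
  have "norm (taylor_coeff g k) * r ^ k \<le> (1 / sqrt m) * sqrt (enn2real (energy \<alpha> g))"
    if g: "g holomorphic_on unit_disk" "energy \<alpha> g < \<infinity>" for g k
  proof -
    have "ennreal ((norm (taylor_coeff g k) * r ^ k)\<^sup>2 * m) = (\<integral>\<^sup>+z. ennreal ((norm (taylor_coeff g k) * r ^ k)\<^sup>2) * indicator ?A z \<partial>dA \<alpha>)"
      using As m by (simp add: nn_integral_cmult_indicator ennreal_mult)
    also have "\<dots> \<le> energy \<alpha> (\<lambda>z. taylor_coeff g k * z ^ k)"
      unfolding energy_def using r
      by (intro nn_integral_mono)
        (auto simp: indicator_def norm_mult norm_power intro!: ennreal_leI power_mono mult_left_mono)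
    also have "\<dots> \<le> energy \<alpha> g" by (rule energy_monomial_le[OF \<alpha> g(1)])
    also have "\<dots> = ennreal (enn2real (energy \<alpha> g))" using g(2) by simp
    finally have "(norm (taylor_coeff g k) * r ^ k)\<^sup>2 * m \<le> enn2real (energy \<alpha> g)"
      by (simp add: ennreal_le_iff)
    then have "sqrt ((norm (taylor_coeff g k) * r ^ k)\<^sup>2 * m) \<le> sqrt (enn2real (energy \<alpha> g))"
      by (rule real_sqrt_le_mono)
    then show ?thesis using m r by (simp add: real_sqrt_mult field_simps)
  qed
  with m show ?thesis by (intro that[of "1 / sqrt m"]) auto
qed

text \<open>
  The coefficient bound at a radius strictly between \<open>\<rho>\<close> and 1 majorises the tail by a geometric series
  that is the same for all \<open>g\<close> in the unit ball.
\<close>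

lemma taylor_tail_uniformly_small:
  assumes \<alpha>: "\<alpha> > -1" and \<rho>: "0 \<le> \<rho>" "\<rho> < 1" and e: "0 < e"
  obtains n0 where
    "\<And>g n (w::complex). g holomorphic_on unit_disk \<Longrightarrow> energy \<alpha> g \<le> 1 \<Longrightarrow> n0 \<le> n \<Longrightarrow> norm w \<le> \<rho> \<Longrightarrow> norm (taylor_tail n g w) \<le> e"
proof -
  define r where "r = (\<rho> + 1) / 2"
  have r: "\<rho> < r" "r < 1" "0 < r" using \<rho> by (auto simp: r_def)
  define q where "q = \<rho> / r"
  have q: "0 \<le> q" "q < 1" using r \<rho> by (auto simp: q_def)
  obtain c where c: "0 < c"
    "\<And>g k. g holomorphic_on unit_disk \<Longrightarrow> energy \<alpha> g < \<infinity> \<Longrightarrow> norm (taylor_coeff g k) * r ^ k \<le> c * sqrt (enn2real (energy \<alpha> g))"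
    using taylor_coeff_bound[OF \<alpha> r(3,2)] by metis
  have "(\<lambda>n. c * q ^ n / (1 - q)) \<longlonglongrightarrow> c * 0 / (1 - q)"
    using q by (intro tendsto_intros LIMSEQ_realpow_zero) auto
  then have "eventually (\<lambda>n. c * q ^ n / (1 - q) < e) sequentially"
    using e by (intro order_tendstoD) auto
  then obtain n0 where n0: "\<And>n. n0 \<le> n \<Longrightarrow> c * q ^ n / (1 - q) < e"
    by (auto simp: eventually_sequentially)
  show ?thesis
  proof (rule that[of n0])
    fix g n and w :: complex assume g: "g holomorphic_on unit_disk" "energy \<alpha> g \<le> 1" and n: "n0 \<le> n" and w: "norm w \<le> \<rho>"
    have fin: "energy \<alpha> g < \<infinity>" using g(2) by (rule le_less_trans) simp
    have "enn2real (energy \<alpha> g) \<le> 1" using g(2) by (simp add: enn2real_leI)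
    then have "sqrt (enn2real (energy \<alpha> g)) \<le> 1" by simp
    then have "c * sqrt (enn2real (energy \<alpha> g)) \<le> c * 1" using c(1) by (intro mult_left_mono) auto
    then have b: "norm (taylor_coeff g k) * r ^ k \<le> c" for k
      using c(2)[OF g(1) fin, of k] by simp
    have t: "norm (taylor_coeff g (j + n) * w ^ (j + n)) \<le> c * q ^ n * q ^ j" for j
    proof -
      have "norm (taylor_coeff g (j + n) * w ^ (j + n)) \<le> norm (taylor_coeff g (j + n)) * \<rho> ^ (j + n)"
        using w by (auto simp: norm_mult norm_power intro!: mult_left_mono power_mono)
      also have "\<dots> = (norm (taylor_coeff g (j + n)) * r ^ (j + n)) * q ^ (j + n)"
        using r by (simp add: q_def power_divide)
      also have "\<dots> \<le> c * q ^ (j + n)" using b q by (intro mult_right_mono) auto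
      finally show ?thesis by (simp add: power_add mult_ac)
    qed
    have s: "(\<lambda>j. c * q ^ n * q ^ j) sums (c * q ^ n * (1 / (1 - q)))"
      using q by (intro sums_mult geometric_sums) auto
    have "w \<in> unit_disk" using w \<rho> by simp
    from taylor_tail_sums[OF g(1) this, of n]
    have "taylor_tail n g w = (\<Sum>j. taylor_coeff g (j + n) * w ^ (j + n))" by (rule sums_unique)
    also have "norm \<dots> \<le> (\<Sum>j. c * q ^ n * q ^ j)"
      using s t by (intro norm_suminf_le) (auto simp: sums_iff)
    also have "\<dots> = c * q ^ n / (1 - q)" using s by (simp add: sums_iff)
    also have "\<dots> \<le> e" using n0[OF n] by simp
    finally show "norm (taylor_tail n g w) \<le> e" .
  qed
qed

section \<open>Compact operators and essential norms\<close>

locale seminormed_function_space =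
  fixes H :: "(complex \<Rightarrow> complex) set" and nrm :: "(complex \<Rightarrow> complex) \<Rightarrow> real"
  assumes zero_in: "(\<lambda>_. 0) \<in> H"
    and add_in: "f \<in> H \<Longrightarrow> g \<in> H \<Longrightarrow> (\<lambda>z. f z + g z) \<in> H"
    and scale_in: "f \<in> H \<Longrightarrow> (\<lambda>z. c * f z) \<in> H"
    and nrm_nonneg: "0 \<le> nrm f"
    and nrm_add: "f \<in> H \<Longrightarrow> g \<in> H \<Longrightarrow> nrm (\<lambda>z. f z + g z) \<le> nrm f + nrm g"
    and nrm_scale: "f \<in> H \<Longrightarrow> nrm (\<lambda>z. c * f z) = norm c * nrm f"
begin

lemma nrm_zero [simp]: "nrm (\<lambda>_. 0) = 0"
  using nrm_scale[OF zero_in, of 0] by simp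

lemma diff_in: "f \<in> H \<Longrightarrow> g \<in> H \<Longrightarrow> (\<lambda>z. f z - g z) \<in> H"
  using add_in[of f "\<lambda>z. (-1) * g z"] scale_in[of g "-1"] by simp

lemma nrm_diff: "f \<in> H \<Longrightarrow> g \<in> H \<Longrightarrow> nrm (\<lambda>z. f z - g z) \<le> nrm f + nrm g"
  using nrm_add[of f "\<lambda>z. (-1) * g z"] scale_in[of g "-1"] nrm_scale[of g "-1"] by simp

lemma nrm_diff_commute: "f \<in> H \<Longrightarrow> g \<in> H \<Longrightarrow> nrm (\<lambda>z. f z - g z) = nrm (\<lambda>z. g z - f z)"
  using nrm_scale[OF diff_in[of f g], of "-1"] by simp

lemma nrm_triangle_diff:
  assumes "f \<in> H" "g \<in> H" "h \<in> H"
  shows "nrm (\<lambda>z. f z - h z) \<le> nrm (\<lambda>z. f z - g z) + nrm (\<lambda>z. g z - h z)"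
  using nrm_add[OF diff_in[OF assms(1,2)] diff_in[OF assms(2,3)]] by simp

lemma linear_op_diff:
  assumes "linear_op H T" "linear_op H K"
  shows "linear_op H (\<lambda>f z. T f z - K f z)"
  using assms unfolding linear_op_def by (auto simp: diff_in fun_eq_iff algebra_simps)

lemma linear_op_apply_diff:
  assumes "linear_op H T" "f \<in> H" "g \<in> H"
  shows "T (\<lambda>z. f z - g z) = (\<lambda>z. T f z - T g z)"
proof -
  have add: "\<forall>f\<in>H. \<forall>g\<in>H. T (\<lambda>z. f z + g z) = (\<lambda>z. T f z + T g z)"
    using assms(1) unfolding linear_op_def by blast
  have "T (\<lambda>z. f z + (-1) * g z) = (\<lambda>z. T f z + T (\<lambda>z. (-1) * g z) z)"
    by (rule add[rule_format, OF assms(2) scale_in[OF assms(3)]])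
  also have "T (\<lambda>z. (-1) * g z) = (\<lambda>z. (-1) * T g z)"
    using assms unfolding linear_op_def by blast
  finally show ?thesis by simp
qed

lemma bounded_op_diff:
  assumes "bounded_op H nrm T" "bounded_op H nrm K"
  shows "bounded_op H nrm (\<lambda>f z. T f z - K f z)"
proof -
  obtain C D where C: "\<And>f. f \<in> H \<Longrightarrow> nrm (T f) \<le> C * nrm f" and D: "\<And>f. f \<in> H \<Longrightarrow> nrm (K f) \<le> D * nrm f"
    using assms unfolding bounded_op_def by metis
  have lin: "linear_op H T" "linear_op H K" using assms unfolding bounded_op_def by auto
  have "nrm (\<lambda>z. T f z - K f z) \<le> (C + D) * nrm f" if "f \<in> H" for f
    using nrm_diff[of "T f" "K f"] C[OF that] D[OF that] lin that
    by (force simp: linear_op_def distrib_right)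
  then show ?thesis
    using linear_op_diff[OF lin] unfolding bounded_op_def by blast
qed

text \<open>
  Scaling by \<open>nrm f + e\<close> instead of \<open>nrm f\<close> also covers functions of norm 0.
\<close>

lemma bounded_opI_ball:
  assumes lin: "linear_op H T" and B: "\<And>f. f \<in> H \<Longrightarrow> nrm f \<le> 1 \<Longrightarrow> nrm (T f) \<le> B" and f: "f \<in> H"
  shows "nrm (T f) \<le> B * nrm f"
proof -
  have B0: "0 \<le> B" using B[OF zero_in] nrm_nonneg[of "T (\<lambda>_. 0)"] by simp
  have "nrm (T f) \<le> B * (nrm f + e)" if e: "0 < e" for e
  proof -
    define t where "t = nrm f + e"
    have t: "0 < t" using nrm_nonneg[of f] e by (simp add: t_def)
    define g where "g = (\<lambda>z. complex_of_real (1 / t) * f z)"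
    have gH: "g \<in> H" unfolding g_def by (rule scale_in[OF f])
    have "nrm g = nrm f / t" unfolding g_def nrm_scale[OF f] norm_of_real using t by simp
    moreover have "nrm f / t \<le> 1" using t e by (simp add: divide_le_eq_1_pos t_def)
    ultimately have g1: "nrm g \<le> 1" by simp
    have "T g = (\<lambda>z. complex_of_real (1 / t) * T f z)"
      using lin f unfolding g_def linear_op_def by blast
    moreover have TH: "T f \<in> H" using lin f by (auto simp: linear_op_def)
    ultimately have "nrm (T g) = nrm (T f) / t"
      using t by (simp only: nrm_scale[OF TH] norm_of_real) simp
    then have "nrm (T f) / t \<le> B" using B[OF gH g1] by simp
    then show ?thesis using t by (simp add: field_simps t_def)
  qed
  then have "nrm (T f) \<le> B * nrm f + e" if "0 < e" for e
  proof (cases "B = 0")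
    case True
    then show ?thesis using \<open>\<And>e. 0 < e \<Longrightarrow> nrm (T f) \<le> B * (nrm f + e)\<close>[of 1] that by simp
  next
    case False
    then have "B * (nrm f + e / B) = B * nrm f + e" by (simp add: field_simps)
    then show ?thesis using \<open>\<And>e. 0 < e \<Longrightarrow> nrm (T f) \<le> B * (nrm f + e)\<close>[of "e / B"] that B0 False by simp
  qed
  then show ?thesis by (rule field_le_epsilon)
qed

text \<open>
  If \<open>K\<close> were unbounded, some functions of norm at most 1 would have images whose norms tend to infinity,
  and no subsequence of the images could converge.
\<close>

lemma compact_op_bounded:
  assumes K: "compact_op H nrm K"
  shows "bounded_op H nrm K"
proof -
  have lin: "linear_op H K" using K by (simp add: compact_op_def)
  have "\<exists>B. \<forall>f\<in>H. nrm f \<le> 1 \<longrightarrow> nrm (K f) \<le> B"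
  proof (rule ccontr)
    assume "\<not> ?thesis"
    then have "\<forall>n::nat. \<exists>f. f \<in> H \<and> nrm f \<le> 1 \<and> real n < nrm (K f)"
      by (meson not_le)
    then obtain f where f: "\<And>n. f n \<in> H" "\<And>n. nrm (f n) \<le> 1" "\<And>n. real n < nrm (K (f n))"
      by metis
    then obtain s g where s: "strict_mono s" "g \<in> H" "(\<lambda>n. nrm (\<lambda>z. K (f (s n)) z - g z)) \<longlonglongrightarrow> 0"
      using K unfolding compact_op_def by blast
    obtain N where N: "nrm (\<lambda>z. K (f (s n)) z - g z) < 1" if "N \<le> n" for n
      using order_tendstoD(2)[OF s(3), of 1] by (auto simp: eventually_sequentially)
    obtain n where n: "N \<le> n" "nrm g + 1 \<le> real n"
      by (metis linorder_linear order_trans real_arch_simple of_nat_le_iff)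
    have Kf: "K (f (s n)) \<in> H" using lin f by (auto simp: linear_op_def)
    have "nrm (K (f (s n))) \<le> nrm (\<lambda>z. K (f (s n)) z - g z) + nrm g"
      using nrm_add[OF diff_in[OF Kf s(2)] s(2)] by simp
    also have "\<dots> < 1 + nrm g" using N[OF n(1)] by simp
    also have "\<dots> \<le> real (s n)" using n(2) seq_suble[OF s(1), of n] by simp
    finally show False using f(3)[of "s n"] by simp
  qed
  then obtain B where "\<And>f. f \<in> H \<Longrightarrow> nrm f \<le> 1 \<Longrightarrow> nrm (K f) \<le> B" by blast
  then show ?thesis using bounded_opI_ball[OF lin] lin unfolding bounded_op_def by blast
qed

text \<open>
  The supremum defining \<open>op_norm\<close> is a supremum of real numbers, so it is meaningful only with this bound.
\<close>

lemma bdd_above_op_norm: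
  assumes "bounded_op H nrm T"
  shows "bdd_above ((\<lambda>f. nrm (T f)) ` {f \<in> H. nrm f \<le> 1})"
proof -
  obtain C where C: "\<And>f. f \<in> H \<Longrightarrow> nrm (T f) \<le> C * nrm f"
    using assms unfolding bounded_op_def by blast
  show ?thesis
  proof (rule bdd_aboveI2)
    fix f assume f: "f \<in> {f \<in> H. nrm f \<le> 1}"
    then have "nrm (T f) \<le> C * nrm f" by (intro C) simp
    also have "\<dots> \<le> \<bar>C\<bar> * 1" using f nrm_nonneg[of f] by (intro mult_mono) auto
    finally show "nrm (T f) \<le> \<bar>C\<bar> * 1" .
  qed
qed

lemma nrm_le_op_norm:
  assumes T: "bounded_op H nrm T" and f: "f \<in> H"
  shows "nrm (T f) \<le> op_norm H nrm T * nrm f"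
proof (rule bounded_opI_ball[OF _ _ f])
  show "linear_op H T" using T by (simp add: bounded_op_def)
  fix f assume "f \<in> H" "nrm f \<le> 1"
  then show "nrm (T f) \<le> op_norm H nrm T"
    unfolding op_norm_def by (intro cSUP_upper[OF _ bdd_above_op_norm[OF T]]) simp
qed

lemma op_norm_le:
  assumes "\<And>f. f \<in> H \<Longrightarrow> nrm f \<le> 1 \<Longrightarrow> nrm (T f) \<le> C"
  shows "op_norm H nrm T \<le> C"
  unfolding op_norm_def using assms zero_in by (intro cSUP_least) (auto intro: exI[of _ "\<lambda>_. 0"])

lemma op_norm_nonneg:
  assumes "bounded_op H nrm T"
  shows "0 \<le> op_norm H nrm T"
proof -
  have "nrm (T (\<lambda>_. 0)) \<le> op_norm H nrm T"
    unfolding op_norm_def by (intro cSUP_upper[OF _ bdd_above_op_norm[OF assms]]) (simp add: zero_in)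
  then show ?thesis using nrm_nonneg[of "T (\<lambda>_. 0)"] by simp
qed

lemma compact_op_zero: "compact_op H nrm (\<lambda>f z. 0)"
proof -
  have "strict_mono (id :: nat \<Rightarrow> nat)" by (simp add: strict_mono_def)
  moreover have "(\<lambda>n::nat. nrm (\<lambda>z. 0 - 0)) \<longlonglongrightarrow> 0" by simp
  ultimately show ?thesis
    unfolding compact_op_def linear_op_def using zero_in
    by (intro conjI ballI allI impI exI[of _ id] exI[of _ "\<lambda>_. 0"]) auto
qed

text \<open>
  The values of a bounded functional on the unit ball lie in a compact disk.
\<close>

lemma compact_op_rank_one:
  assumes e: "e \<in> H" and l: "\<And>f g. f \<in> H \<Longrightarrow> g \<in> H \<Longrightarrow> l (\<lambda>z. f z + g z) = l f + l g"
    "\<And>f c. f \<in> H \<Longrightarrow> l (\<lambda>z. c * f z) = c * l f"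
    and B: "\<And>f. f \<in> H \<Longrightarrow> norm (l f) \<le> B * nrm f"
  shows "compact_op H nrm (\<lambda>f z. l f * e z)"
proof -
  have "linear_op H (\<lambda>f z. l f * e z)"
    unfolding linear_op_def using e l by (auto simp: scale_in distrib_right mult.assoc)
  moreover have "\<exists>s g. strict_mono s \<and> g \<in> H \<and> (\<lambda>n. nrm (\<lambda>z. l (f (s n)) * e z - g z)) \<longlonglongrightarrow> 0"
    if f: "\<And>n. f n \<in> H" "\<And>n. nrm (f n) \<le> 1" for f :: "nat \<Rightarrow> complex \<Rightarrow> complex"
  proof -
    have "norm (l (f n)) \<le> \<bar>B\<bar>" for n
    proof -
      have "norm (l (f n)) \<le> \<bar>B\<bar> * nrm (f n)"
        using B[OF f(1)[of n]] nrm_nonneg[of "f n"] by (meson abs_ge_self mult_right_mono order_trans)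
      also have "\<dots> \<le> \<bar>B\<bar> * 1" using f by (intro mult_left_mono) auto
      finally show ?thesis by simp
    qed
    then have "\<forall>n. l (f n) \<in> cball 0 \<bar>B\<bar>" by simp
    then obtain c s where s: "strict_mono s" "((\<lambda>n. l (f n)) \<circ> s) \<longlonglongrightarrow> c"
      using compact_imp_seq_compact[OF compact_cball, THEN seq_compactE] by metis
    have "nrm (\<lambda>z. l (f (s n)) * e z - c * e z) = norm (l (f (s n)) - c) * nrm e" for n
      using nrm_scale[OF e, of "l (f (s n)) - c"] by (simp add: left_diff_distrib)
    moreover have "(\<lambda>n. norm (l (f (s n)) - c) * nrm e) \<longlonglongrightarrow> 0 * nrm e"
      using s(2) by (intro tendsto_mult tendsto_const tendsto_norm_zero) (simp add: o_def LIM_zero)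
    ultimately show ?thesis
      using s(1) scale_in[OF e, of c] by (intro exI[of _ s] exI[of _ "\<lambda>z. c * e z"]) simp
  qed
  ultimately show ?thesis unfolding compact_op_def by blast
qed

lemma compact_op_add:
  assumes K: "compact_op H nrm K" and L: "compact_op H nrm L"
  shows "compact_op H nrm (\<lambda>f z. K f z + L f z)"
proof -
  have lin: "linear_op H K" "linear_op H L" using K L by (simp_all add: compact_op_def)
  then have "linear_op H (\<lambda>f z. K f z + L f z)"
    unfolding linear_op_def by (auto simp: add_in fun_eq_iff algebra_simps)
  moreover have "\<exists>s g. strict_mono s \<and> g \<in> H \<and> (\<lambda>n. nrm (\<lambda>z. K (f (s n)) z + L (f (s n)) z - g z)) \<longlonglongrightarrow> 0"
    if f: "\<And>n. f n \<in> H \<and> nrm (f n) \<le> 1" for f :: "nat \<Rightarrow> complex \<Rightarrow> complex"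
  proof -
    obtain s g where s: "strict_mono s" "g \<in> H" "(\<lambda>n. nrm (\<lambda>z. K (f (s n)) z - g z)) \<longlonglongrightarrow> 0"
      using K f unfolding compact_op_def by blast
    have "\<forall>n. f (s n) \<in> H \<and> nrm (f (s n)) \<le> 1" using f by blast
    then have "\<exists>t h. strict_mono t \<and> h \<in> H \<and> (\<lambda>n. nrm (\<lambda>z. L ((\<lambda>n. f (s n)) (t n)) z - h z)) \<longlonglongrightarrow> 0"
      using conjunct2[OF L[unfolded compact_op_def], rule_format, of "\<lambda>n. f (s n)"] by simp
    then obtain t h where t: "strict_mono t" "h \<in> H" "(\<lambda>n. nrm (\<lambda>z. L (f (s (t n))) z - h z)) \<longlonglongrightarrow> 0"
      by auto
    let ?a = "\<lambda>n z. K (f (s (t n))) z - g z" and ?b = "\<lambda>n z. L (f (s (t n))) z - h z"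
    have in_H: "?a n \<in> H" "?b n \<in> H" for n
      using f s(2) t(2) lin by (auto intro!: diff_in simp: linear_op_def)
    have "(\<lambda>n. nrm (?a n)) \<longlonglongrightarrow> 0"
      using LIMSEQ_subseq_LIMSEQ[OF s(3) t(1)] by (simp add: o_def)
    then have lim: "(\<lambda>n. nrm (?a n) + nrm (?b n)) \<longlonglongrightarrow> 0"
      using t(3) tendsto_add by fastforce
    have "(\<lambda>n. nrm (\<lambda>z. ?a n z + ?b n z)) \<longlonglongrightarrow> 0"
      by (rule tendsto_sandwich[OF always_eventually always_eventually tendsto_const lim])
        (intro allI nrm_nonneg nrm_add in_H)+
    moreover have "(\<lambda>z. ?a n z + ?b n z) = (\<lambda>z. K (f ((s \<circ> t) n)) z + L (f ((s \<circ> t) n)) z - (g z + h z))" for n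
      by (simp add: fun_eq_iff)
    ultimately show ?thesis
      using s t add_in strict_mono_o[OF s(1) t(1)]
      by (intro exI[of _ "s \<circ> t"] exI[of _ "\<lambda>z. g z + h z"]) simp
  qed
  ultimately show ?thesis unfolding compact_op_def by blast
qed

lemma compact_op_finite_rank:
  assumes "\<And>k. k < n \<Longrightarrow> compact_op H nrm (\<lambda>f z. l k f * e k z)"
  shows "compact_op H nrm (\<lambda>f z. \<Sum>k<(n::nat). l k f * e k z)"
  using assms
proof (induction n)
  case (Suc n)
  then show ?case using compact_op_add[of "\<lambda>f z. \<Sum>k<n. l k f * e k z" "\<lambda>f z. l n f * e n z"] by simp
qed (simp add: compact_op_zero)

text \<open>
  The infimum defining \<open>essential_norm\<close> is taken over a set of reals that is bounded below, because
  \<open>T - K\<close> is bounded for every compact \<open>K\<close>.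
\<close>

lemma essential_norm_le:
  assumes T: "bounded_op H nrm T" and K: "compact_op H nrm K"
    and le: "\<And>f. f \<in> H \<Longrightarrow> nrm f \<le> 1 \<Longrightarrow> nrm (\<lambda>z. T f z - K f z) \<le> C"
  shows "essential_norm H nrm T \<le> C"
proof -
  have "essential_norm H nrm T \<le> op_norm H nrm (\<lambda>f z. T f z - K f z)"
    unfolding essential_norm_def
  proof (rule cINF_lower)
    show "bdd_below ((\<lambda>K. op_norm H nrm (\<lambda>f z. T f z - K f z)) ` {K. compact_op H nrm K})"
      by (intro bdd_belowI2[of _ 0] op_norm_nonneg bounded_op_diff T compact_op_bounded) simp
  qed (use K in simp)
  also have "\<dots> \<le> C" by (rule op_norm_le) (rule le)
  finally show ?thesis .
qed

lemma essential_norm_ge: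
  assumes "\<And>K. compact_op H nrm K \<Longrightarrow> C \<le> op_norm H nrm (\<lambda>f z. T f z - K f z)"
  shows "C \<le> essential_norm H nrm T"
  unfolding essential_norm_def using compact_op_zero assms by (intro cINF_greatest) auto

lemma essential_norm_nonneg:
  assumes "bounded_op H nrm T"
  shows "0 \<le> essential_norm H nrm T"
  by (intro essential_norm_ge op_norm_nonneg bounded_op_diff assms compact_op_bounded)
end

section \<open>The weighted Dirichlet space\<close>

text \<open>
  A weighted form of \<open>(x + y)\<^sup>2 \<le> 2 * x\<^sup>2 + 2 * y\<^sup>2\<close>. It can be integrated pointwise, and optimising over \<open>t\<close>
  afterwards gives the triangle inequality for the Dirichlet norm.
\<close>

lemma norm_add_squared_le:
  fixes x y :: "'a::real_normed_vector"
  assumes "0 < t"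
  shows "(norm (x + y))\<^sup>2 \<le> (1 + t) * (norm x)\<^sup>2 + (1 + 1 / t) * (norm y)\<^sup>2"
proof -
  have "(norm (x + y))\<^sup>2 \<le> (norm x + norm y)\<^sup>2"
    by (intro power_mono norm_triangle_ineq) auto
  also have "\<dots> \<le> (1 + t) * (norm x)\<^sup>2 + (1 + 1 / t) * (norm y)\<^sup>2"
  proof -
    have "0 \<le> (t * norm x - norm y)\<^sup>2 / t" using assms by simp
    also have "\<dots> = t * (norm x)\<^sup>2 + (norm y)\<^sup>2 / t - 2 * norm x * norm y"
      using assms by (simp add: field_simps power2_eq_square)
    finally show ?thesis by (simp add: power2_sum algebra_simps)
  qed
  finally show ?thesis .
qed

text \<open>
  The choice \<open>t = b / a\<close> turns the right-hand side into \<open>(a + b)\<^sup>2\<close>; enlarging \<open>a\<close> and \<open>b\<close> by \<open>e / 2\<close> avoids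
  division by 0.
\<close>

lemma le_add_of_weighted_squares:
  fixes a b c :: real
  assumes "0 \<le> a" "0 \<le> b" and le: "\<And>t. 0 < t \<Longrightarrow> c\<^sup>2 \<le> (1 + t) * a\<^sup>2 + (1 + 1 / t) * b\<^sup>2"
  shows "c \<le> a + b"
proof (rule field_le_epsilon)
  fix e :: real assume e: "0 < e"
  define p q where "p = a + e / 2" and "q = b + e / 2"
  have pq: "0 < p" "0 < q" "a \<le> p" "b \<le> q" using assms e by (auto simp: p_def q_def)
  have "c\<^sup>2 \<le> (1 + q / p) * a\<^sup>2 + (1 + 1 / (q / p)) * b\<^sup>2" using pq by (intro le) simp
  also have "\<dots> \<le> (1 + q / p) * p\<^sup>2 + (1 + 1 / (q / p)) * q\<^sup>2"
    using pq assms by (intro add_mono mult_left_mono power_mono) auto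
  also have "\<dots> = (p + q)\<^sup>2" using pq by (simp add: field_simps power2_eq_square)
  finally have "c\<^sup>2 \<le> (p + q)\<^sup>2" .
  then have "c \<le> p + q" by (rule power2_le_imp_le) (use pq in simp)
  then show "c \<le> a + b + e" by (simp add: p_def q_def)
qed

lemma integrable_iff_energy_finite:
  assumes "g holomorphic_on unit_disk"
  shows "integrable (dA \<alpha>) (\<lambda>z. (norm (g z))\<^sup>2) \<longleftrightarrow> energy \<alpha> g < \<infinity>"
proof -
  have "(\<lambda>z. (norm (g z))\<^sup>2) \<in> borel_measurable (dA \<alpha>)"
    by (intro borel_measurable_weighted_area_continuous continuous_intros holomorphic_on_imp_continuous_on assms)
  then show ?thesis by (simp add: integrable_iff_bounded energy_def)
qed

lemma dirichlet_space_iff: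
  "f \<in> dirichlet_space \<alpha> \<longleftrightarrow> f holomorphic_on unit_disk \<and> (\<forall>z. z \<notin> unit_disk \<longrightarrow> f z = 0)
     \<and> energy \<alpha> (deriv f) < \<infinity>"
  unfolding dirichlet_space_def
  using integrable_iff_energy_finite[of "deriv f" \<alpha>] holomorphic_deriv[of f unit_disk] by auto

lemma dirichlet_norm_nonneg: "0 \<le> dirichlet_norm \<alpha> f"
  by (simp add: dirichlet_norm_def integral_nonneg_AE)

lemma dirichlet_norm_squared:
  "(dirichlet_norm \<alpha> f)\<^sup>2 = (norm (f 0))\<^sup>2 + (\<integral>z. (norm (deriv f z))\<^sup>2 \<partial>dA \<alpha>)"
  by (simp add: dirichlet_norm_def integral_nonneg_AE)

lemma ennreal_dirichlet_norm_squared: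
  assumes "f \<in> dirichlet_space \<alpha>"
  shows "ennreal ((dirichlet_norm \<alpha> f)\<^sup>2) = ennreal ((norm (f 0))\<^sup>2) + energy \<alpha> (deriv f)"
proof -
  have "integrable (dA \<alpha>) (\<lambda>z. (norm (deriv f z))\<^sup>2)"
    using assms by (simp add: dirichlet_space_def)
  then have "energy \<alpha> (deriv f) = ennreal (\<integral>z. (norm (deriv f z))\<^sup>2 \<partial>dA \<alpha>)"
    unfolding energy_def by (intro nn_integral_eq_integral) auto
  then show ?thesis by (simp add: dirichlet_norm_squared integral_nonneg_AE)
qed

lemma energy_cong: "(\<And>z. z \<in> unit_disk \<Longrightarrow> norm (f z) = norm (g z)) \<Longrightarrow> energy \<alpha> f = energy \<alpha> g"
  unfolding energy_def by (intro nn_integral_cong) simp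

lemma energy_add_finite:
  assumes "f holomorphic_on unit_disk" "g holomorphic_on unit_disk" "energy \<alpha> f < \<infinity>" "energy \<alpha> g < \<infinity>"
  shows "energy \<alpha> (\<lambda>z. f z + g z) < \<infinity>"
proof -
  have "energy \<alpha> (\<lambda>z. f z + g z) \<le> (\<integral>\<^sup>+z. 2 * ennreal ((norm (f z))\<^sup>2) + 2 * ennreal ((norm (g z))\<^sup>2) \<partial>dA \<alpha>)"
    unfolding energy_def
  proof (rule nn_integral_mono)
    fix z
    have "(norm (f z + g z))\<^sup>2 \<le> 2 * (norm (f z))\<^sup>2 + 2 * (norm (g z))\<^sup>2"
      using norm_add_squared_le[of 1 "f z" "g z"] by simp
    then have "ennreal ((norm (f z + g z))\<^sup>2) \<le> ennreal (2 * (norm (f z))\<^sup>2 + 2 * (norm (g z))\<^sup>2)"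
      by (rule ennreal_leI)
    then show "ennreal ((norm (f z + g z))\<^sup>2) \<le> 2 * ennreal ((norm (f z))\<^sup>2) + 2 * ennreal ((norm (g z))\<^sup>2)"
      by (simp add: ennreal_plus ennreal_mult)
  qed
  also have "\<dots> = 2 * energy \<alpha> f + 2 * energy \<alpha> g"
  proof -
    note m = borel_measurable_norm_squared[OF assms(1), of \<alpha>] borel_measurable_norm_squared[OF assms(2), of \<alpha>]
    show ?thesis
      unfolding energy_def nn_integral_cmult[OF m(1), symmetric] nn_integral_cmult[OF m(2), symmetric]
      by (rule nn_integral_add) (intro borel_measurable_times_ennreal borel_measurable_const m)+
  qed
  also have "\<dots> < \<infinity>" using assms(3,4) by (simp add: ennreal_mult_less_top)
  finally show ?thesis .
qed

lemma seminormed_dirichlet_space: "seminormed_function_space (dirichlet_space \<alpha>) (dirichlet_norm \<alpha>)"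
proof
  let ?H = "dirichlet_space \<alpha>" and ?n = "dirichlet_norm \<alpha>"
  have da: "deriv (\<lambda>z. f z + g z) z = deriv f z + deriv g z"
    if "f \<in> ?H" "g \<in> ?H" "z \<in> unit_disk" for f g z
    using that unfolding dirichlet_space_def
    by (intro deriv_add) (auto intro: holomorphic_on_imp_differentiable_at)
  have dc: "deriv (\<lambda>z. c * f z) z = c * deriv f z" if "f \<in> ?H" "z \<in> unit_disk" for f c z
    using that unfolding dirichlet_space_def
    by (intro deriv_cmult) (auto intro: holomorphic_on_imp_differentiable_at)
  have int: "integrable (dA \<alpha>) (\<lambda>z. (norm (deriv f z))\<^sup>2)" if "f \<in> ?H" for f
    using that by (simp add: dirichlet_space_def)
  show "(\<lambda>_. 0) \<in> ?H" by (simp add: dirichlet_space_def)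
  show ain: "(\<lambda>z. f z + g z) \<in> ?H" if fg: "f \<in> ?H" "g \<in> ?H" for f g
  proof -
    have h: "f holomorphic_on unit_disk" "g holomorphic_on unit_disk" using fg by (auto simp: dirichlet_space_def)
    have "energy \<alpha> (deriv (\<lambda>z. f z + g z)) = energy \<alpha> (\<lambda>z. deriv f z + deriv g z)"
      using da[OF fg] by (intro energy_cong) simp
    also have "\<dots> < \<infinity>"
      using fg h by (intro energy_add_finite holomorphic_deriv) (auto simp: dirichlet_space_iff)
    finally show ?thesis using fg h by (auto simp: dirichlet_space_iff intro: holomorphic_intros)
  qed
  show cin: "(\<lambda>z. c * f z) \<in> ?H" if f: "f \<in> ?H" for f c
  proof -
    have "integrable (dA \<alpha>) (\<lambda>z. (norm c)\<^sup>2 * (norm (deriv f z))\<^sup>2)"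
      using int[OF f] by (rule integrable_mult_right)
    then have "integrable (dA \<alpha>) (\<lambda>z. (norm (deriv (\<lambda>z. c * f z) z))\<^sup>2)"
      by (rule Bochner_Integration.integrable_cong[THEN iffD1, OF refl, rotated])
        (simp add: dc[OF f] norm_mult power_mult_distrib)
    then show ?thesis using f by (auto simp: dirichlet_space_def intro: holomorphic_intros)
  qed
  show "0 \<le> ?n f" for f by (rule dirichlet_norm_nonneg)
  show "?n (\<lambda>z. f z + g z) \<le> ?n f + ?n g" if fg: "f \<in> ?H" "g \<in> ?H" for f g
  proof (rule le_add_of_weighted_squares[OF dirichlet_norm_nonneg dirichlet_norm_nonneg])
    fix t :: real assume t: "0 < t"
    have "(\<integral>z. (norm (deriv (\<lambda>z. f z + g z) z))\<^sup>2 \<partial>dA \<alpha>)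
        \<le> (\<integral>z. (1 + t) * (norm (deriv f z))\<^sup>2 + (1 + 1 / t) * (norm (deriv g z))\<^sup>2 \<partial>dA \<alpha>)"
    proof (rule integral_mono[OF int[OF ain[OF fg]]])
      show "integrable (dA \<alpha>) (\<lambda>z. (1 + t) * (norm (deriv f z))\<^sup>2 + (1 + 1 / t) * (norm (deriv g z))\<^sup>2)"
        by (intro Bochner_Integration.integrable_add integrable_mult_right int fg)
    qed (simp add: da[OF fg] norm_add_squared_le[OF t])
    also have "\<dots> = (1 + t) * (\<integral>z. (norm (deriv f z))\<^sup>2 \<partial>dA \<alpha>)
        + (1 + 1 / t) * (\<integral>z. (norm (deriv g z))\<^sup>2 \<partial>dA \<alpha>)"
      by (subst Bochner_Integration.integral_add) (auto intro!: integrable_mult_right int fg)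
    finally have "(\<integral>z. (norm (deriv (\<lambda>z. f z + g z) z))\<^sup>2 \<partial>dA \<alpha>)
      \<le> (1 + t) * (\<integral>z. (norm (deriv f z))\<^sup>2 \<partial>dA \<alpha>)
        + (1 + 1 / t) * (\<integral>z. (norm (deriv g z))\<^sup>2 \<partial>dA \<alpha>)" .
    with norm_add_squared_le[OF t, of "f 0" "g 0"]
    show "(?n (\<lambda>z. f z + g z))\<^sup>2 \<le> (1 + t) * (?n f)\<^sup>2 + (1 + 1 / t) * (?n g)\<^sup>2"
      unfolding dirichlet_norm_squared by (simp only: distrib_left)
  qed
  show "?n (\<lambda>z. c * f z) = norm c * ?n f" if f: "f \<in> ?H" for f c
  proof -
    have "(\<integral>z. (norm (deriv (\<lambda>z. c * f z) z))\<^sup>2 \<partial>dA \<alpha>)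
        = (\<integral>z. (norm c)\<^sup>2 * (norm (deriv f z))\<^sup>2 \<partial>dA \<alpha>)"
      by (rule Bochner_Integration.integral_cong) (auto simp: dc[OF f] norm_mult power_mult_distrib)
    then have "(?n (\<lambda>z. c * f z))\<^sup>2 = (norm c * ?n f)\<^sup>2"
      unfolding dirichlet_norm_squared power_mult_distrib by (simp add: norm_mult power_mult_distrib distrib_left)
    then show ?thesis by (simp add: dirichlet_norm_nonneg)
  qed
qed

lemma deriv_comp_op:
  assumes "\<phi> holomorphic_on unit_disk" "\<phi> ` unit_disk \<subseteq> unit_disk" "f holomorphic_on unit_disk" "z \<in> unit_disk"
  shows "deriv (comp_op \<phi> f) z = deriv f (\<phi> z) * deriv \<phi> z"
proof -
  have "eventually (\<lambda>u. u \<in> unit_disk) (nhds z)" using assms(4) by (intro eventually_nhds_in_open) auto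
  then have "eventually (\<lambda>u. comp_op \<phi> f u = (f \<circ> \<phi>) u) (nhds z)"
    by eventually_elim (simp add: comp_op_def)
  then have "deriv (comp_op \<phi> f) z = deriv (f \<circ> \<phi>) z" by (rule deriv_cong_ev) simp
  also have "\<dots> = deriv f (\<phi> z) * deriv \<phi> z"
  proof (rule deriv_chain)
    have "\<phi> z \<in> unit_disk" using assms(2,4) by blast
    then show "f field_differentiable at (\<phi> z)"
      by (rule holomorphic_on_imp_differentiable_at[OF assms(3) open_ball])
    show "\<phi> field_differentiable at z"
      by (rule holomorphic_on_imp_differentiable_at[OF assms(1) open_ball assms(4)])
  qed
  finally show ?thesis .
qed

text \<open>
  On derivatives, composition with \<open>\<phi>\<close> acts as the embedding of the Bergman space into \<open>L\<^sup>2(\<psi> dA\<^sub>\<alpha>)\<close>.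
\<close>

lemma energy_deriv_comp_op:
  assumes \<alpha>: "\<alpha> > -1" and \<phi>: "\<phi> holomorphic_on unit_disk" "\<phi> ` unit_disk \<subseteq> unit_disk"
    and nc: "\<not> \<phi> constant_on unit_disk"
    and \<psi>: "counting_ratio \<phi> \<alpha> \<in> borel_measurable (restrict_space borel unit_disk)"
    and f: "f holomorphic_on unit_disk"
  shows "energy \<alpha> (deriv (comp_op \<phi> f))
    = (\<integral>\<^sup>+w. ennreal ((norm (deriv f w))\<^sup>2) * counting_ratio \<phi> \<alpha> w \<partial>dA \<alpha>)"
proof -
  have "energy \<alpha> (deriv (comp_op \<phi> f))
      = (\<integral>\<^sup>+z. ennreal ((norm (deriv f (\<phi> z)))\<^sup>2) * ennreal ((norm (deriv \<phi> z))\<^sup>2) \<partial>dA \<alpha>)"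
    unfolding energy_def
    by (intro nn_integral_cong) (simp add: deriv_comp_op[OF \<phi> f] norm_mult power_mult_distrib ennreal_mult)
  also have "\<dots> = (\<integral>\<^sup>+w. ennreal ((norm (deriv f w))\<^sup>2) * counting_ratio \<phi> \<alpha> w \<partial>dA \<alpha>)"
    by (rule nn_integral_comp_counting_ratio[OF \<alpha> \<phi> nc \<psi>])
      (intro borel_measurable_norm_squared holomorphic_deriv f open_ball)
  finally show ?thesis .
qed

section \<open>The upper estimate of the essential norm\<close>

definition disk_monomial :: "nat \<Rightarrow> complex \<Rightarrow> complex"
  where "disk_monomial k z = (if z \<in> unit_disk then z ^ k else 0)"

lemma disk_restriction_in_dirichlet_space:
  assumes \<alpha>: "\<alpha> > -1" and g: "g holomorphic_on unit_disk"
    and B: "\<And>z. z \<in> unit_disk \<Longrightarrow> norm (deriv g z) \<le> B"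
  shows "(\<lambda>z. if z \<in> unit_disk then g z else 0) \<in> dirichlet_space \<alpha>" (is "?f \<in> _")
proof -
  have hol: "?f holomorphic_on unit_disk" using g by (rule holomorphic_transform) simp
  have d: "deriv ?f z = deriv g z" if "z \<in> unit_disk" for z
  proof (rule deriv_cong_ev)
    have "eventually (\<lambda>u. u \<in> unit_disk) (nhds z)" using that by (intro eventually_nhds_in_open) auto
    then show "eventually (\<lambda>u. ?f u = g u) (nhds z)" by eventually_elim simp
  qed simp
  have "integrable (dA \<alpha>) (\<lambda>z. (norm (deriv ?f z))\<^sup>2)"
  proof (rule integrable_weighted_area_bounded[OF \<alpha>])
    show "(\<lambda>z. (norm (deriv ?f z))\<^sup>2) \<in> borel_measurable (dA \<alpha>)"
      by (intro borel_measurable_weighted_area_continuous continuous_intros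
          holomorphic_on_imp_continuous_on holomorphic_deriv hol open_ball)
    show "norm ((norm (deriv ?f z))\<^sup>2) \<le> B\<^sup>2" if "z \<in> unit_disk" for z
      using B[OF that] d[OF that] by (simp add: power_mono)
  qed
  with hol show ?thesis by (simp add: dirichlet_space_def)
qed

lemma disk_monomial_in_dirichlet_space:
  assumes "\<alpha> > -1"
  shows "disk_monomial k \<in> dirichlet_space \<alpha>"
  unfolding disk_monomial_def[abs_def]
proof (rule disk_restriction_in_dirichlet_space[OF assms])
  show "(\<lambda>z. z ^ k) holomorphic_on unit_disk" by (intro holomorphic_intros)
  fix z :: complex assume "z \<in> unit_disk"
  then have "norm z ^ (k - 1) \<le> 1" by (intro power_le_one) auto
  moreover have "deriv (\<lambda>z. z ^ k) z = of_nat k * z ^ (k - 1)"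
    by (rule DERIV_imp_deriv) (auto intro!: derivative_eq_intros)
  ultimately show "norm (deriv (\<lambda>z. z ^ k) z) \<le> real k"
    using mult_left_mono[of "norm z ^ (k - 1)" 1 "real k"]
    by (simp add: norm_mult norm_power)
qed

lemma energy_deriv_le_dirichlet_norm:
  assumes "f \<in> dirichlet_space \<alpha>"
  shows "energy \<alpha> (deriv f) \<le> ennreal ((dirichlet_norm \<alpha> f)\<^sup>2)"
  unfolding ennreal_dirichlet_norm_squared[OF assms] by simp

lemma taylor_coeff_Suc: "taylor_coeff f (Suc k) = taylor_coeff (deriv f) k / of_nat (Suc k)"
  by (simp add: taylor_coeff_def funpow_Suc_right del: funpow.simps)

lemma taylor_coeff_bounded_functional:
  assumes \<alpha>: "\<alpha> > -1"
  shows "\<exists>B. \<forall>f\<in>dirichlet_space \<alpha>. norm (taylor_coeff f k) \<le> B * dirichlet_norm \<alpha> f"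
proof (cases k)
  case 0
  have "norm (taylor_coeff f 0) \<le> 1 * dirichlet_norm \<alpha> f" for f
  proof -
    have "(norm (f 0))\<^sup>2 \<le> (dirichlet_norm \<alpha> f)\<^sup>2"
      unfolding dirichlet_norm_squared by (simp add: integral_nonneg_AE)
    then show ?thesis
      using power2_le_imp_le[OF _ dirichlet_norm_nonneg] by (simp add: taylor_coeff_def)
  qed
  then show ?thesis unfolding 0 by blast
next
  case (Suc j)
  obtain c where c: "0 < c"
    "\<And>g k. g holomorphic_on unit_disk \<Longrightarrow> energy \<alpha> g < \<infinity> \<Longrightarrow> norm (taylor_coeff g k) * (1/2) ^ k \<le> c * sqrt (enn2real (energy \<alpha> g))"
    using taylor_coeff_bound[OF \<alpha>, of "1/2"] by auto
  have "norm (taylor_coeff f (Suc j)) \<le> (2 ^ j * c) * dirichlet_norm \<alpha> f" if f: "f \<in> dirichlet_space \<alpha>" for f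
  proof -
    have hd: "deriv f holomorphic_on unit_disk" "energy \<alpha> (deriv f) < \<infinity>"
      using f by (auto simp: dirichlet_space_iff intro: holomorphic_deriv)
    have "enn2real (energy \<alpha> (deriv f)) \<le> (dirichlet_norm \<alpha> f)\<^sup>2"
      using energy_deriv_le_dirichlet_norm[OF f] by (intro enn2real_leI) auto
    then have "sqrt (enn2real (energy \<alpha> (deriv f))) \<le> dirichlet_norm \<alpha> f"
      by (intro real_le_lsqrt dirichlet_norm_nonneg) auto
    then have "c * sqrt (enn2real (energy \<alpha> (deriv f))) \<le> c * dirichlet_norm \<alpha> f"
      using c(1) by (intro mult_left_mono) auto
    then have "norm (taylor_coeff (deriv f) j) * (1/2) ^ j \<le> c * dirichlet_norm \<alpha> f"
      using c(2)[OF hd, of j] by simp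
    then have "norm (taylor_coeff (deriv f) j) \<le> 2 ^ j * c * dirichlet_norm \<alpha> f"
      by (simp add: field_simps power_one_over)
    moreover have "norm (taylor_coeff f (Suc j)) \<le> norm (taylor_coeff (deriv f) j)"
      unfolding taylor_coeff_Suc norm_divide norm_of_nat
      by (simp add: divide_le_eq mult_right_mono mult_le_cancel_left1)
    ultimately show ?thesis by simp
  qed
  then show ?thesis unfolding Suc by blast
qed

lemma taylor_coeff_add:
  assumes "f holomorphic_on unit_disk" "g holomorphic_on unit_disk"
  shows "taylor_coeff (\<lambda>z. f z + g z) k = taylor_coeff f k + taylor_coeff g k"
  using higher_deriv_add[OF assms open_ball, of 0 k] by (simp add: taylor_coeff_def add_divide_distrib)

lemma taylor_coeff_cmult:
  assumes "f holomorphic_on unit_disk"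
  shows "taylor_coeff (\<lambda>z. c * f z) k = c * taylor_coeff f k"
  using higher_deriv_cmult[OF assms _ open_ball, of 0 k c] by (simp add: taylor_coeff_def)

lemma deriv_taylor_tail:
  assumes "f holomorphic_on unit_disk" "z \<in> unit_disk"
  shows "(taylor_tail (Suc n) f has_field_derivative taylor_tail n (deriv f) z) (at z)"
proof -
  have "((\<lambda>z. f z - (\<Sum>k<Suc n. taylor_coeff f k * z ^ k)) has_field_derivative
      deriv f z - (\<Sum>k<Suc n. taylor_coeff f k * (of_nat k * z ^ (k - 1)))) (at z)"
    by (auto intro!: derivative_eq_intros holomorphic_derivI[OF assms(1) open_ball assms(2)] simp: mult_ac)
  moreover have "(\<Sum>k<Suc n. taylor_coeff f k * (of_nat k * z ^ (k - 1))) = (\<Sum>k<n. taylor_coeff (deriv f) k * z ^ k)"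
    unfolding sum.lessThan_Suc_shift by (simp add: taylor_coeff_Suc del: of_nat_Suc)
  ultimately show ?thesis unfolding taylor_tail_def[abs_def] by simp
qed

locale bounded_composition =
  fixes \<alpha> :: real and \<phi> :: "complex \<Rightarrow> complex"
  assumes alpha: "\<alpha> > -1"
    and hol: "\<phi> holomorphic_on unit_disk" and self_map: "\<phi> ` unit_disk \<subseteq> unit_disk"
    and nonconst: "\<not> \<phi> constant_on unit_disk"
    and bounded: "bounded_op (dirichlet_space \<alpha>) (dirichlet_norm \<alpha>) (comp_op \<phi>)"
    and measurable_ratio: "counting_ratio \<phi> \<alpha> \<in> borel_measurable (restrict_space borel unit_disk)"
begin

abbreviation \<psi> :: "complex \<Rightarrow> ennreal"
  where "\<psi> \<equiv> counting_ratio \<phi> \<alpha>"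

abbreviation ess_norm :: real
  where "ess_norm \<equiv> essential_norm (dirichlet_space \<alpha>) (dirichlet_norm \<alpha>) (comp_op \<phi>)"

sublocale D: seminormed_function_space "dirichlet_space \<alpha>" "dirichlet_norm \<alpha>"
  by (rule seminormed_dirichlet_space)

lemma comp_op_in: "f \<in> dirichlet_space \<alpha> \<Longrightarrow> comp_op \<phi> f \<in> dirichlet_space \<alpha>"
  using bounded by (simp add: bounded_op_def linear_op_def)

lemma measurable_ratio_W: "\<psi> \<in> borel_measurable (dA \<alpha>)"
  using measurable_ratio by (simp add: borel_measurable_weighted_area_iff)

lemma energy_comp:
  "f holomorphic_on unit_disk \<Longrightarrow> energy \<alpha> (deriv (comp_op \<phi> f))
    = (\<integral>\<^sup>+w. ennreal ((norm (deriv f w))\<^sup>2) * \<psi> w \<partial>dA \<alpha>)"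
  by (rule energy_deriv_comp_op[OF alpha hol self_map nonconst measurable_ratio])

text \<open>
  This is the boundedness of the composition operator applied to the identity function.
\<close>

lemma nn_integral_ratio_finite: "(\<integral>\<^sup>+w. \<psi> w \<partial>dA \<alpha>) < \<infinity>"
proof -
  have m: "disk_monomial 1 \<in> dirichlet_space \<alpha>" by (rule disk_monomial_in_dirichlet_space[OF alpha])
  have "deriv (disk_monomial 1) w = 1" if "w \<in> unit_disk" for w
  proof -
    have "eventually (\<lambda>u. u \<in> unit_disk) (nhds w)" using that by (intro eventually_nhds_in_open) auto
    then have "eventually (\<lambda>u. disk_monomial 1 u = u) (nhds w)" by eventually_elim (simp add: disk_monomial_def)
    then show ?thesis by (subst deriv_cong_ev[where g="\<lambda>u. u"]) auto
  qed
  then have "(\<integral>\<^sup>+w. \<psi> w \<partial>dA \<alpha>)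
      = (\<integral>\<^sup>+w. ennreal ((norm (deriv (disk_monomial 1) w))\<^sup>2) * \<psi> w \<partial>dA \<alpha>)"
    by (intro nn_integral_cong) simp
  also have "\<dots> = energy \<alpha> (deriv (comp_op \<phi> (disk_monomial 1)))"
    using m by (intro energy_comp[symmetric]) (simp add: dirichlet_space_def)
  also have "\<dots> < \<infinity>" using comp_op_in[OF m] by (simp add: dirichlet_space_iff)
  finally show ?thesis .
qed

text \<open>
  Composing the \<open>n\<close>-th Taylor polynomial of \<open>f\<close> with \<open>\<phi>\<close> is an operator of finite rank.
\<close>

lemma compact_taylor_comp:
  "compact_op (dirichlet_space \<alpha>) (dirichlet_norm \<alpha>)
     (\<lambda>f z. \<Sum>k<(n::nat). taylor_coeff f k * comp_op \<phi> (disk_monomial k) z)"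
proof (rule D.compact_op_finite_rank)
  fix k
  obtain B where B: "\<And>f. f \<in> dirichlet_space \<alpha> \<Longrightarrow> norm (taylor_coeff f k) \<le> B * dirichlet_norm \<alpha> f"
    using taylor_coeff_bounded_functional[OF alpha] by blast
  show "compact_op (dirichlet_space \<alpha>) (dirichlet_norm \<alpha>) (\<lambda>f z. taylor_coeff f k * comp_op \<phi> (disk_monomial k) z)"
    by (rule D.compact_op_rank_one[OF comp_op_in[OF disk_monomial_in_dirichlet_space[OF alpha]] _ _ B])
      (auto simp: dirichlet_space_def taylor_coeff_add taylor_coeff_cmult)
qed

lemma comp_op_minus_taylor_comp:
  "(\<lambda>z. comp_op \<phi> f z - (\<Sum>k<n. taylor_coeff f k * comp_op \<phi> (disk_monomial k) z)) = comp_op \<phi> (taylor_tail n f)"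
proof
  fix z
  show "comp_op \<phi> f z - (\<Sum>k<n. taylor_coeff f k * comp_op \<phi> (disk_monomial k) z) = comp_op \<phi> (taylor_tail n f) z"
    using self_map by (cases "z \<in> unit_disk") (auto simp: comp_op_def taylor_tail_def disk_monomial_def image_subset_iff)
qed

text \<open>
  Subtract the composition with a Taylor polynomial of high degree; what remains is the composition
  with a Taylor tail \<open>R\<close>. On a compact subdisk, which is chosen to contain \<open>\<phi> 0\<close>, both \<open>R\<close> and its derivative
  are uniformly small. Outside of it \<open>\<psi> \<le> M\<close>, and the energy of the derivative of \<open>R\<close> is at most that of
  the derivative of \<open>f\<close>.
\<close>

lemma essential_norm_squared_le:
  assumes \<rho>: "\<rho> < 1" and M: "0 \<le> M" "\<And>w. \<rho> < norm w \<Longrightarrow> norm w < 1 \<Longrightarrow> \<psi> w \<le> ennreal M"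
  shows "(ess_norm)\<^sup>2 \<le> M"
proof (rule field_le_epsilon)
  fix e :: real assume e: "0 < e"
  define P where "P = enn2real (\<integral>\<^sup>+w. \<psi> w \<partial>dA \<alpha>)"
  have P: "(\<integral>\<^sup>+w. \<psi> w \<partial>dA \<alpha>) = ennreal P" "0 \<le> P"
    using nn_integral_ratio_finite by (auto simp: P_def)
  \<comment> \<open>Chosen so that the error from \<open>\<phi> 0\<close> and the error from the subdisk, \<open>\<delta>\<^sup>2\<close> and \<open>\<delta>\<^sup>2 * P\<close>, add up to \<open>e\<close>.\<close>
  define \<delta> where "\<delta> = sqrt (e / (1 + P))"
  have \<delta>: "0 < \<delta>" "\<delta>\<^sup>2 * (1 + P) = e" using e P(2) by (auto simp: \<delta>_def)
  have \<phi>0: "norm (\<phi> 0) < 1" using self_map by (auto simp: image_subset_iff)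
  define \<rho>' where "\<rho>' = max \<rho> (norm (\<phi> 0))"
  have \<rho>': "0 \<le> \<rho>'" "\<rho>' < 1" "\<rho> \<le> \<rho>'" "norm (\<phi> 0) \<le> \<rho>'" using \<rho> \<phi>0 by (auto simp: \<rho>'_def le_max_iff_disj)
  obtain n where n: "\<And>g m (w::complex). g holomorphic_on unit_disk \<Longrightarrow> energy \<alpha> g \<le> 1 \<Longrightarrow> n \<le> m \<Longrightarrow> norm w \<le> \<rho>' \<Longrightarrow> norm (taylor_tail m g w) \<le> \<delta>"
    using taylor_tail_uniformly_small[OF alpha \<rho>'(1,2) \<delta>(1)] by metis
  have "ess_norm \<le> sqrt (M + e)"
  proof (rule D.essential_norm_le[OF bounded compact_taylor_comp[of "Suc n"]])
    fix f assume f: "f \<in> dirichlet_space \<alpha>" and f1: "dirichlet_norm \<alpha> f \<le> 1"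
    have fh: "f holomorphic_on unit_disk" and gh: "deriv f holomorphic_on unit_disk"
      using f by (auto simp: dirichlet_space_def intro: holomorphic_deriv)
    let ?R = "taylor_tail (Suc n) f" and ?t = "taylor_tail n (deriv f)"
    have Rh: "?R holomorphic_on unit_disk" by (intro holomorphic_intros fh)
    have th: "?t holomorphic_on unit_disk" by (intro holomorphic_intros gh)
    have g1: "energy \<alpha> (deriv f) \<le> 1"
    proof -
      have "(dirichlet_norm \<alpha> f)\<^sup>2 \<le> 1" using f1 by (simp add: power_le_one dirichlet_norm_nonneg)
      then have "ennreal ((dirichlet_norm \<alpha> f)\<^sup>2) \<le> 1" by (metis ennreal_1 ennreal_leI)
      then show ?thesis using energy_deriv_le_dirichlet_norm[OF f] by (rule order_trans[rotated])
    qed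
    have t_small: "norm (?t w) \<le> \<delta>" if "norm w \<le> \<rho>'" for w
      by (rule n[OF gh g1 order_refl that])
    have t1: "energy \<alpha> ?t \<le> 1"
      using energy_taylor_tail_le[OF alpha gh] g1 by (rule order_trans)
    \<comment> \<open>The tail vanishes at 0, and its derivative is at most \<open>\<delta>\<close> on the segment from 0 to \<open>\<phi> 0\<close>.\<close>
    have R0: "norm (?R (\<phi> 0)) \<le> \<delta>"
    proof -
      have "norm (?R (\<phi> 0) - ?R 0) \<le> \<delta> * norm (\<phi> 0 - 0)"
      proof (rule field_differentiable_bound[of "cball 0 \<rho>'"])
        fix z :: complex assume "z \<in> cball 0 \<rho>'"
        then have "z \<in> unit_disk" "norm z \<le> \<rho>'" using \<rho>' by auto
        then show "(?R has_field_derivative ?t z) (at z within cball 0 \<rho>')" "norm (?t z) \<le> \<delta>"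
          using deriv_taylor_tail[OF fh, of z n] t_small by (auto intro: has_field_derivative_at_within)
      qed (use \<rho>' in auto)
      moreover have "?R 0 = 0"
      proof -
        have "(\<Sum>k<Suc n. taylor_coeff f k * 0 ^ k) = taylor_coeff f 0"
          unfolding sum.lessThan_Suc_shift by simp
        then show ?thesis by (simp add: taylor_tail_def taylor_coeff_def)
      qed
      ultimately have "norm (?R (\<phi> 0)) \<le> \<delta> * norm (\<phi> 0)" by simp
      also have "\<dots> \<le> \<delta> * 1" using \<phi>0 \<delta> by (intro mult_left_mono) auto
      finally show ?thesis by simp
    qed
    have RH: "comp_op \<phi> ?R \<in> dirichlet_space \<alpha>"
    proof -
      have "linear_op (dirichlet_space \<alpha>) (\<lambda>f z. comp_op \<phi> f z - (\<Sum>k<Suc n. taylor_coeff f k * comp_op \<phi> (disk_monomial k) z))"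
        using bounded compact_taylor_comp[of "Suc n"]
        by (intro D.linear_op_diff) (auto simp: bounded_op_def compact_op_def)
      then show ?thesis
        using f unfolding linear_op_def comp_op_minus_taylor_comp by blast
    qed
    have "energy \<alpha> (deriv (comp_op \<phi> ?R)) = (\<integral>\<^sup>+w. ennreal ((norm (deriv ?R w))\<^sup>2) * \<psi> w \<partial>dA \<alpha>)"
      by (rule energy_comp[OF Rh])
    also have "\<dots> = (\<integral>\<^sup>+w. ennreal ((norm (?t w))\<^sup>2) * \<psi> w \<partial>dA \<alpha>)"
      by (intro nn_integral_cong) (simp add: DERIV_imp_deriv[OF deriv_taylor_tail[OF fh]])
    also have "\<dots> \<le> (\<integral>\<^sup>+w. ennreal (\<delta>\<^sup>2) * \<psi> w + ennreal M * ennreal ((norm (?t w))\<^sup>2) \<partial>dA \<alpha>)"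
    proof (rule nn_integral_mono)
      fix w assume "w \<in> space (dA \<alpha>)"
      then have w: "norm w < 1" by simp
      show "ennreal ((norm (?t w))\<^sup>2) * \<psi> w \<le> ennreal (\<delta>\<^sup>2) * \<psi> w + ennreal M * ennreal ((norm (?t w))\<^sup>2)"
      proof (cases "norm w \<le> \<rho>'")
        case True
        then have "ennreal ((norm (?t w))\<^sup>2) * \<psi> w \<le> ennreal (\<delta>\<^sup>2) * \<psi> w"
          using t_small by (intro mult_right_mono ennreal_leI power_mono) auto
        then show ?thesis by (rule order_trans) simp
      next
        case False
        then have "ennreal ((norm (?t w))\<^sup>2) * \<psi> w \<le> ennreal ((norm (?t w))\<^sup>2) * ennreal M"
          using M(2)[of w] w \<rho>' by (intro mult_left_mono) auto
        also have "\<dots> \<le> ennreal (\<delta>\<^sup>2) * \<psi> w + ennreal M * ennreal ((norm (?t w))\<^sup>2)"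
          by (simp only: mult.commute[of "ennreal M"]) simp
        finally show ?thesis .
      qed
    qed
    also have "\<dots> = ennreal (\<delta>\<^sup>2) * (\<integral>\<^sup>+w. \<psi> w \<partial>dA \<alpha>) + ennreal M * energy \<alpha> ?t"
      unfolding energy_def nn_integral_cmult[OF measurable_ratio_W, symmetric]
        nn_integral_cmult[OF borel_measurable_norm_squared[OF th], symmetric]
      by (rule nn_integral_add)
        (intro borel_measurable_times_ennreal borel_measurable_const measurable_ratio_W borel_measurable_norm_squared th)+
    also have "\<dots> \<le> ennreal (\<delta>\<^sup>2) * ennreal P + ennreal M * 1"
      unfolding P(1) by (intro add_mono mult_left_mono t1 order_refl) auto
    also have "\<dots> = ennreal (\<delta>\<^sup>2 * P + M)"
      using P(2) M(1) by (simp add: ennreal_mult ennreal_plus)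
    finally have E: "energy \<alpha> (deriv (comp_op \<phi> ?R)) \<le> ennreal (\<delta>\<^sup>2 * P + M)" .
    have "ennreal ((dirichlet_norm \<alpha> (comp_op \<phi> ?R))\<^sup>2) \<le> ennreal (\<delta>\<^sup>2) + ennreal (\<delta>\<^sup>2 * P + M)"
      unfolding ennreal_dirichlet_norm_squared[OF RH]
      by (intro add_mono E ennreal_leI power_mono) (use R0 in \<open>auto simp: comp_op_def\<close>)
    also have "\<dots> = ennreal (M + e)"
      using P(2) M(1) \<delta>(2) by (subst ennreal_plus[symmetric]) (auto simp: algebra_simps)
    finally have "(dirichlet_norm \<alpha> (comp_op \<phi> ?R))\<^sup>2 \<le> M + e"
      using M(1) e by (subst (asm) ennreal_le_iff) simp
    then have "dirichlet_norm \<alpha> (comp_op \<phi> ?R) \<le> sqrt (M + e)"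
      using real_le_rsqrt by blast
    then show "dirichlet_norm \<alpha> (\<lambda>z. comp_op \<phi> f z - (\<Sum>k<Suc n. taylor_coeff f k * comp_op \<phi> (disk_monomial k) z)) \<le> sqrt (M + e)"
      unfolding comp_op_minus_taylor_comp .
  qed
  then have "(ess_norm)\<^sup>2 \<le> (sqrt (M + e))\<^sup>2"
    by (intro power_mono D.essential_norm_nonneg bounded)
  then show "(ess_norm)\<^sup>2 \<le> M + e"
    using M(1) e by simp
qed

end

section \<open>The lower estimate of the essential norm\<close>

text \<open>
  Bounded second moments give uniform integrability: \<open>k \<le> min k (1 / \<delta>) + \<delta> * k\<^sup>2\<close>, where the first
  summand is dominated by a constant and the second has integral at most \<open>\<delta> * B\<close>.
\<close>

lemma nn_integral_tendsto_0_if_second_moment_bounded: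
  fixes k :: "nat \<Rightarrow> 'a \<Rightarrow> real"
  assumes "finite_measure \<nu>" and k [measurable]: "\<And>n. k n \<in> borel_measurable \<nu>" and nonneg: "\<And>n x. 0 \<le> k n x"
    and sq: "\<And>n. (\<integral>\<^sup>+x. ennreal ((k n x)\<^sup>2) \<partial>\<nu>) \<le> ennreal B"
    and lim: "\<And>x. x \<in> space \<nu> \<Longrightarrow> (\<lambda>n. k n x) \<longlonglongrightarrow> 0"
  shows "(\<lambda>n. \<integral>\<^sup>+x. ennreal (k n x) \<partial>\<nu>) \<longlonglongrightarrow> 0"
proof (rule order_tendstoI)
  interpret finite_measure \<nu> by fact
  fix a :: ennreal assume a: "0 < a"
  then obtain r where r: "0 < r" "ennreal r \<le> a"
  proof (cases a)
    case (real r)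
    then show ?thesis using a that[of r] by simp
  next
    case top
    then show ?thesis using that[of 1] by simp
  qed
  \<comment> \<open>The truncated part will contribute less than \<open>r / 2\<close> and the second moment at most \<open>r / 4\<close>.\<close>
  define \<delta> where "\<delta> = r / (4 * (\<bar>B\<bar> + 1))"
  have \<delta>: "0 < \<delta>" "\<delta> * \<bar>B\<bar> \<le> r / 4"
    using r by (auto simp: \<delta>_def field_simps)
  have "(\<lambda>n. \<integral>\<^sup>+x. ennreal (min (k n x) (1 / \<delta>)) \<partial>\<nu>) \<longlonglongrightarrow> (\<integral>\<^sup>+x. 0 \<partial>\<nu>)"
  proof (rule nn_integral_dominated_convergence[where w="\<lambda>_. ennreal (1 / \<delta>)"])
    show "(\<integral>\<^sup>+x. ennreal (1 / \<delta>) \<partial>\<nu>) < \<infinity>"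
      using emeasure_finite[of "space \<nu>"] unfolding infinity_ennreal_def less_top
      by (simp add: ennreal_mult_less_top)
    show "AE x in \<nu>. (\<lambda>n. ennreal (min (k n x) (1 / \<delta>))) \<longlonglongrightarrow> 0"
    proof (rule AE_I2)
      fix x assume "x \<in> space \<nu>"
      then have "(\<lambda>n. min (k n x) (1 / \<delta>)) \<longlonglongrightarrow> min 0 (1 / \<delta>)"
        by (intro tendsto_min lim tendsto_const)
      then have "(\<lambda>n. ennreal (min (k n x) (1 / \<delta>))) \<longlonglongrightarrow> ennreal (min 0 (1 / \<delta>))"
        by (rule tendsto_ennrealI)
      then show "(\<lambda>n. ennreal (min (k n x) (1 / \<delta>))) \<longlonglongrightarrow> 0" using \<delta> by simp
    qed
  qed (auto intro!: ennreal_leI)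
  then have "eventually (\<lambda>n. (\<integral>\<^sup>+x. ennreal (min (k n x) (1 / \<delta>)) \<partial>\<nu>) < ennreal (r / 2)) sequentially"
    using r by (intro order_tendstoD(2)) auto
  then show "eventually (\<lambda>n. (\<integral>\<^sup>+x. ennreal (k n x) \<partial>\<nu>) < a) sequentially"
  proof eventually_elim
    case (elim n)
    have "(\<integral>\<^sup>+x. ennreal (k n x) \<partial>\<nu>) \<le> (\<integral>\<^sup>+x. ennreal (min (k n x) (1 / \<delta>)) + ennreal \<delta> * ennreal ((k n x)\<^sup>2) \<partial>\<nu>)"
    proof (rule nn_integral_mono)
      fix x
      have "k n x \<le> min (k n x) (1 / \<delta>) + \<delta> * (k n x)\<^sup>2"
      proof (cases "k n x \<le> 1 / \<delta>")
        case False
        then have "1 \<le> \<delta> * k n x" using \<delta> by (simp add: field_simps)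
        then have "1 * k n x \<le> (\<delta> * k n x) * k n x" using nonneg by (intro mult_right_mono) auto
        then show ?thesis using False \<delta> by (simp add: power2_eq_square mult.assoc add_increasing)
      qed (use \<delta> in simp)
      then have "ennreal (k n x) \<le> ennreal (min (k n x) (1 / \<delta>) + \<delta> * (k n x)\<^sup>2)" by (rule ennreal_leI)
      also have "\<dots> = ennreal (min (k n x) (1 / \<delta>)) + ennreal \<delta> * ennreal ((k n x)\<^sup>2)"
        using \<delta> nonneg by (simp add: ennreal_plus ennreal_mult)
      finally show "ennreal (k n x) \<le> ennreal (min (k n x) (1 / \<delta>)) + ennreal \<delta> * ennreal ((k n x)\<^sup>2)" .
    qed
    also have "\<dots> = (\<integral>\<^sup>+x. ennreal (min (k n x) (1 / \<delta>)) \<partial>\<nu>) + ennreal \<delta> * (\<integral>\<^sup>+x. ennreal ((k n x)\<^sup>2) \<partial>\<nu>)"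
      by (subst nn_integral_add) (auto simp: nn_integral_cmult)
    also have "\<dots> \<le> ennreal (r / 2) + ennreal \<delta> * ennreal \<bar>B\<bar>"
      using elim sq[of n] by (intro add_mono mult_left_mono) (auto intro: order_trans[OF _ ennreal_leI])
    also have "\<dots> \<le> ennreal (r / 2 + r / 4)"
      using \<delta> r by (simp add: ennreal_mult[symmetric] ennreal_plus[symmetric] ennreal_leI del: ennreal_plus)
    also have "\<dots> < ennreal r" using r by (intro ennreal_lessI) auto
    finally show ?case using r(2) by simp
  qed
qed simp

lemma norm_bergman_kernel_le:
  assumes "0 < d" "d \<le> norm (1 - cnj a * w)" "\<alpha> > -2"
  shows "norm (bergman_kernel \<alpha> a w) \<le> (1 - (norm a)\<^sup>2) powr ((\<alpha> + 2) / 2) / d powr (\<alpha> + 2)"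
proof -
  have "d powr (\<alpha> + 2) \<le> norm (1 - cnj a * w) powr (\<alpha> + 2)"
    using assms by (intro powr_mono2) auto
  then have "(1 - (norm a)\<^sup>2) powr ((\<alpha> + 2) / 2) / norm (1 - cnj a * w) powr (\<alpha> + 2)
      \<le> (1 - (norm a)\<^sup>2) powr ((\<alpha> + 2) / 2) / d powr (\<alpha> + 2)"
    using assms by (intro divide_left_mono mult_pos_pos) (auto intro: less_le_trans)
  then show ?thesis by (simp add: bergman_kernel_def norm_divide norm_powr_real_powr')
qed

lemma bergman_kernel_tendsto_0:
  assumes "\<alpha> > -2" "w \<in> unit_disk" "((\<lambda>x. norm (z x)) \<longlongrightarrow> 1) F" "eventually (\<lambda>x. z x \<in> unit_disk) F"
  shows "((\<lambda>x. norm (bergman_kernel \<alpha> (z x) w)) \<longlongrightarrow> 0) F"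
proof -
  have "((\<lambda>x. 1 - (norm (z x))\<^sup>2) \<longlongrightarrow> 1 - 1\<^sup>2) F" by (intro tendsto_intros assms)
  then have "((\<lambda>x. (1 - (norm (z x))\<^sup>2) powr ((\<alpha> + 2) / 2)) \<longlongrightarrow> 0) F"
    by (intro tendsto_zero_powrI[where b="(\<alpha> + 2) / 2"] tendsto_const)
      (use assms(1,4) in \<open>auto elim!: eventually_mono simp: abs_square_le_1 less_imp_le\<close>)
  then have lim: "((\<lambda>x. (1 - (norm (z x))\<^sup>2) powr ((\<alpha> + 2) / 2) / (1 - norm w) powr (\<alpha> + 2)) \<longlongrightarrow> 0) F"
    by (rule tendsto_divide_zero)
  show ?thesis
  proof (rule tendsto_sandwich[OF _ _ tendsto_const lim])
    show "eventually (\<lambda>x. norm (bergman_kernel \<alpha> (z x) w) \<le> (1 - (norm (z x))\<^sup>2) powr ((\<alpha> + 2) / 2) / (1 - norm w) powr (\<alpha> + 2)) F"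
      using assms(4)
    proof (rule eventually_mono)
      fix x assume "z x \<in> unit_disk"
      then have "1 - norm w \<le> norm (1 - cnj w * z x)" by (rule norm_one_minus_cnj_mult_ge)
      also have "\<dots> = norm (cnj (1 - cnj w * z x))" by (rule complex_mod_cnj[symmetric])
      also have "cnj (1 - cnj w * z x) = 1 - cnj (z x) * w" by (simp add: mult.commute)
      finally show "norm (bergman_kernel \<alpha> (z x) w) \<le> (1 - (norm (z x))\<^sup>2) powr ((\<alpha> + 2) / 2) / (1 - norm w) powr (\<alpha> + 2)"
        using assms(1,2) by (intro norm_bergman_kernel_le) auto
    qed
  qed simp
qed

lemma energy_bergman_kernel:
  assumes "\<alpha> > -1" "a \<in> unit_disk"
  shows "energy \<alpha> (bergman_kernel \<alpha> a) = 1"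
  using nn_integral_bergman_kernel[OF assms, of "\<lambda>_. 1"] emeasure_weighted_area_disk[OF assms(1)]
  by (simp add: energy_def)

text \<open>
  These primitives have norm 1 in the Dirichlet space and are the test functions of the lower estimate.
\<close>

lemma bergman_kernel_primitive:
  assumes "\<alpha> > -1" "a \<in> unit_disk"
  obtains f where "f \<in> dirichlet_space \<alpha>" "f 0 = 0" "\<And>w. w \<in> unit_disk \<Longrightarrow> deriv f w = bergman_kernel \<alpha> a w"
proof -
  obtain F where F: "\<And>w. w \<in> unit_disk \<Longrightarrow> (F has_field_derivative bergman_kernel \<alpha> a w) (at w within unit_disk)"
    using holomorphic_convex_primitive'[OF convex_ball open_ball bergman_kernel_holomorphic[OF assms(2)]] by metis
  define f where "f = (\<lambda>w. if w \<in> unit_disk then F w - F 0 else 0)"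
  have d: "(f has_field_derivative bergman_kernel \<alpha> a w) (at w)" if w: "w \<in> unit_disk" for w
  proof -
    have "((\<lambda>w. F w - F 0) has_field_derivative bergman_kernel \<alpha> a w) (at w within unit_disk)"
      using F[OF w] by (auto intro!: derivative_eq_intros)
    then have "((\<lambda>w. F w - F 0) has_field_derivative bergman_kernel \<alpha> a w) (at w)"
      using w by (simp add: at_within_open[OF _ open_ball])
    then show ?thesis
      by (rule has_field_derivative_transform_within_open[OF _ open_ball w]) (simp add: f_def)
  qed
  have "f holomorphic_on unit_disk"
    using d by (meson field_differentiable_def field_differentiable_at_within holomorphic_on_def)
  moreover have "energy \<alpha> (deriv f) = energy \<alpha> (bergman_kernel \<alpha> a)"
    using d by (intro energy_cong) (simp add: DERIV_imp_deriv[OF d])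
  ultimately have "f \<in> dirichlet_space \<alpha>"
    using energy_bergman_kernel[OF assms] by (auto simp: dirichlet_space_iff f_def)
  then show ?thesis using that[of f] DERIV_imp_deriv[OF d] by (auto simp: f_def)
qed

text \<open>
  Up to a cross term, \<open>|x - y|\<^sup>2\<close> integrates to the sum of the squared norms.
\<close>

lemma nn_integral_norm_diff_squared_le:
  fixes x y :: "'a \<Rightarrow> complex"
  assumes [measurable]: "x \<in> borel_measurable \<nu>" "y \<in> borel_measurable \<nu>"
  defines "I \<equiv> \<lambda>f. \<integral>\<^sup>+w. ennreal ((norm (f w))\<^sup>2) \<partial>\<nu>"
    and "c \<equiv> \<integral>\<^sup>+w. ennreal (norm (x w) * norm (y w)) \<partial>\<nu>"
  shows "I (\<lambda>w. x w - y w) \<le> I x + I y + 2 * c" "I x + I y \<le> I (\<lambda>w. x w - y w) + 2 * c"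
proof -
  have le1: "(norm (u - v))\<^sup>2 \<le> (norm u)\<^sup>2 + (norm v)\<^sup>2 + 2 * (norm u * norm v)"
   and le2: "(norm u)\<^sup>2 + (norm v)\<^sup>2 \<le> (norm (u - v))\<^sup>2 + 2 * (norm u * norm v)" for u v :: complex
  proof -
    have "(norm (u - v))\<^sup>2 \<le> (norm u + norm v)\<^sup>2" by (intro power_mono norm_triangle_ineq4) auto
    then show "(norm (u - v))\<^sup>2 \<le> (norm u)\<^sup>2 + (norm v)\<^sup>2 + 2 * (norm u * norm v)" by (simp add: power2_sum)
    have "(norm u - norm v)\<^sup>2 \<le> (norm (u - v))\<^sup>2"
      using norm_triangle_ineq3[of u v] by (metis abs_ge_zero power2_abs power_mono)
    then show "(norm u)\<^sup>2 + (norm v)\<^sup>2 \<le> (norm (u - v))\<^sup>2 + 2 * (norm u * norm v)" by (simp add: power2_diff)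
  qed
  have "I (\<lambda>w. x w - y w) \<le> (\<integral>\<^sup>+w. ennreal ((norm (x w))\<^sup>2) + ennreal ((norm (y w))\<^sup>2) + 2 * ennreal (norm (x w) * norm (y w)) \<partial>\<nu>)"
    unfolding I_def
  proof (rule nn_integral_mono)
    fix w show "ennreal ((norm (x w - y w))\<^sup>2) \<le> ennreal ((norm (x w))\<^sup>2) + ennreal ((norm (y w))\<^sup>2) + 2 * ennreal (norm (x w) * norm (y w))"
      using ennreal_leI[OF le1[of "x w" "y w"]] by (simp add: ennreal_plus ennreal_mult)
  qed
  also have "\<dots> = I x + I y + 2 * c"
    unfolding I_def c_def by (simp add: nn_integral_add nn_integral_cmult)
  finally show "I (\<lambda>w. x w - y w) \<le> I x + I y + 2 * c" .
  have "I x + I y = (\<integral>\<^sup>+w. ennreal ((norm (x w))\<^sup>2) + ennreal ((norm (y w))\<^sup>2) \<partial>\<nu>)"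
    unfolding I_def by (simp add: nn_integral_add)
  also have "\<dots> \<le> (\<integral>\<^sup>+w. ennreal ((norm (x w - y w))\<^sup>2) + 2 * ennreal (norm (x w) * norm (y w)) \<partial>\<nu>)"
  proof (rule nn_integral_mono)
    fix w show "ennreal ((norm (x w))\<^sup>2) + ennreal ((norm (y w))\<^sup>2) \<le> ennreal ((norm (x w - y w))\<^sup>2) + 2 * ennreal (norm (x w) * norm (y w))"
      using ennreal_leI[OF le2[of "x w" "y w"]] by (simp add: ennreal_plus ennreal_mult)
  qed
  also have "\<dots> = I (\<lambda>w. x w - y w) + 2 * c"
    unfolding I_def c_def by (simp add: nn_integral_add nn_integral_cmult)
  finally show "I x + I y \<le> I (\<lambda>w. x w - y w) + 2 * c" .
qed

text \<open>
  The kernels at points tending to the boundary become orthogonal to any fixed kernel, because the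
  latter is bounded and the former tend to 0 in \<open>L\<^sup>1(\<nu>)\<close>. This is used for \<open>dA\<^sub>\<alpha>\<close> and for \<open>\<psi> dA\<^sub>\<alpha>\<close>.
\<close>

lemma bergman_kernel_cross_term_tendsto_0:
  assumes \<alpha>: "\<alpha> > -1" and \<nu>: "finite_measure \<nu>" "space \<nu> = unit_disk"
    and meas: "\<And>a. a \<in> unit_disk \<Longrightarrow> bergman_kernel \<alpha> a \<in> borel_measurable \<nu>"
    and z: "\<And>n::nat. z n \<in> unit_disk" "(\<lambda>n. norm (z n)) \<longlonglongrightarrow> 1"
    and sq: "\<And>n. (\<integral>\<^sup>+w. ennreal ((norm (bergman_kernel \<alpha> (z n) w))\<^sup>2) \<partial>\<nu>) \<le> ennreal B"
    and a: "a \<in> unit_disk"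
  shows "(\<lambda>n. \<integral>\<^sup>+w. ennreal (norm (bergman_kernel \<alpha> a w) * norm (bergman_kernel \<alpha> (z n) w)) \<partial>\<nu>) \<longlonglongrightarrow> 0"
proof -
  have [measurable]: "bergman_kernel \<alpha> (z n) \<in> borel_measurable \<nu>" for n using meas z by blast
  define C where "C = (1 - (norm a)\<^sup>2) powr ((\<alpha> + 2) / 2) / (1 - norm a) powr (\<alpha> + 2)"
  have "(\<lambda>n. \<integral>\<^sup>+w. ennreal (norm (bergman_kernel \<alpha> (z n) w)) \<partial>\<nu>) \<longlonglongrightarrow> 0"
    by (rule nn_integral_tendsto_0_if_second_moment_bounded[OF \<nu>(1) _ _ sq])
      (use \<alpha> z \<nu>(2) in \<open>auto intro!: bergman_kernel_tendsto_0\<close>)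
  then have lim: "(\<lambda>n. ennreal C * (\<integral>\<^sup>+w. ennreal (norm (bergman_kernel \<alpha> (z n) w)) \<partial>\<nu>)) \<longlonglongrightarrow> ennreal C * 0"
    by (intro ennreal_tendsto_cmult) auto
  show ?thesis
  proof (rule tendsto_sandwich[OF _ _ tendsto_const lim[simplified]])
    show "eventually (\<lambda>n. (\<integral>\<^sup>+w. ennreal (norm (bergman_kernel \<alpha> a w) * norm (bergman_kernel \<alpha> (z n) w)) \<partial>\<nu>)
        \<le> ennreal C * (\<integral>\<^sup>+w. ennreal (norm (bergman_kernel \<alpha> (z n) w)) \<partial>\<nu>)) sequentially"
    proof (intro always_eventually allI)
      fix n
      have "(\<integral>\<^sup>+w. ennreal (norm (bergman_kernel \<alpha> a w) * norm (bergman_kernel \<alpha> (z n) w)) \<partial>\<nu>)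
          \<le> (\<integral>\<^sup>+w. ennreal C * ennreal (norm (bergman_kernel \<alpha> (z n) w)) \<partial>\<nu>)"
      proof (rule nn_integral_mono)
        fix w assume "w \<in> space \<nu>"
        then have "norm (bergman_kernel \<alpha> a w) \<le> C"
          unfolding C_def using \<alpha> a \<nu>(2) by (intro norm_bergman_kernel_le norm_one_minus_cnj_mult_ge) auto
        then show "ennreal (norm (bergman_kernel \<alpha> a w) * norm (bergman_kernel \<alpha> (z n) w))
            \<le> ennreal C * ennreal (norm (bergman_kernel \<alpha> (z n) w))"
          unfolding ennreal_mult''[OF norm_ge_zero] by (intro mult_right_mono ennreal_leI) auto
      qed
      also have "\<dots> = ennreal C * (\<integral>\<^sup>+w. ennreal (norm (bergman_kernel \<alpha> (z n) w)) \<partial>\<nu>)"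
        by (intro nn_integral_cmult) simp
      finally show "(\<integral>\<^sup>+w. ennreal (norm (bergman_kernel \<alpha> a w) * norm (bergman_kernel \<alpha> (z n) w)) \<partial>\<nu>)
        \<le> ennreal C * (\<integral>\<^sup>+w. ennreal (norm (bergman_kernel \<alpha> (z n) w)) \<partial>\<nu>)" .
    qed
  qed simp
qed

lemma eventually_at_boundary:
  "eventually P at_boundary \<longleftrightarrow> (\<exists>\<rho><1. \<forall>z. \<rho> < norm z \<and> norm z < 1 \<longrightarrow> P z)"
proof -
  have at_left_1: "eventually Q (at_left 1) \<longleftrightarrow> (\<exists>b<1. \<forall>y>b. y < 1 \<longrightarrow> Q y)" for Q :: "real \<Rightarrow> bool"
    by (rule eventually_at_left[of 0]) simp
  show ?thesis
    unfolding at_boundary_def eventually_filtercomap at_left_1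
  proof safe
    fix \<rho> :: real assume "\<rho> < 1" "\<forall>z. \<rho> < norm z \<and> norm z < 1 \<longrightarrow> P z"
    then show "\<exists>Q. (\<exists>b<1. \<forall>y>b. y < 1 \<longrightarrow> Q y) \<and> (\<forall>x. Q (norm x) \<longrightarrow> P x)"
      by (intro exI[of _ "\<lambda>y. \<rho> < y \<and> y < 1"]) auto
  qed blast
qed

context bounded_composition
begin

lemma berezin_eq_energy:
  assumes f: "f \<in> dirichlet_space \<alpha>" and d: "\<And>w. w \<in> unit_disk \<Longrightarrow> deriv f w = bergman_kernel \<alpha> a w"
  shows "berezin \<alpha> (\<psi>) a = energy \<alpha> (deriv (comp_op \<phi> f))"
proof -
  have "energy \<alpha> (deriv (comp_op \<phi> f))
      = (\<integral>\<^sup>+w. ennreal ((norm (deriv f w))\<^sup>2) * \<psi> w \<partial>dA \<alpha>)"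
    using f by (intro energy_comp) (simp add: dirichlet_space_def)
  also have "\<dots> = berezin \<alpha> (\<psi>) a"
    unfolding berezin_def by (intro nn_integral_cong) (simp add: d)
  finally show ?thesis by simp
qed

text \<open>
  Let \<open>f\<^sub>n\<close> be unit vectors whose derivatives are the normalised kernels at points tending to the boundary
  along which the Berezin transform exceeds \<open>m\<close>. For a compact operator \<open>K\<close>, a subsequence of \<open>K f\<^sub>n\<close>
  converges, so \<open>K\<close> is small on differences \<open>f\<^sub>a - f\<^sub>b\<close>, whatever the limit is. By asymptotic
  orthogonality such a difference has squared norm about 2, and its composition with \<open>\<phi>\<close> has squared norm at
  least about \<open>2 * m\<close>. Hence \<open>m\<close> is at most the square of the norm of \<open>C\<^sub>\<phi> - K\<close>.
\<close>

lemma Limsup_berezin_le_essential_norm: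
  "Limsup at_boundary (berezin \<alpha> (\<psi>))
    \<le> ennreal ((ess_norm)\<^sup>2)"
proof (rule ccontr)
  let ?H = "dirichlet_space \<alpha>" and ?n = "dirichlet_norm \<alpha>" and ?T = "comp_op \<phi>"
    and ?W = "dA \<alpha>"
  assume "\<not> ?thesis"
  then obtain m' where m': "ennreal (ess_norm\<^sup>2) < m'" "m' < Limsup at_boundary (berezin \<alpha> \<psi>)"
    using dense by (meson not_le)
  then obtain m where m: "m' = ennreal m" "0 \<le> m"
    by (cases m') (auto dest: less_trans)
  have em: "ess_norm\<^sup>2 < m" using m'(1) m by (simp add: ennreal_less_iff)
  have e0: "0 \<le> ess_norm" by (rule D.essential_norm_nonneg[OF bounded])
  \<comment> \<open>Otherwise \<open>sqrt m\<close> would be a lower bound of the essential norm.\<close>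
  obtain K where K: "compact_op ?H ?n K" "op_norm ?H ?n (\<lambda>f z. ?T f z - K f z) < sqrt m"
  proof (rule ccontr)
    assume "\<not> thesis"
    then have "\<And>K. compact_op ?H ?n K \<Longrightarrow> sqrt m \<le> op_norm ?H ?n (\<lambda>f z. ?T f z - K f z)"
      using that by (meson not_le)
    then have "sqrt m \<le> ess_norm" by (rule D.essential_norm_ge)
    then have "(sqrt m)\<^sup>2 \<le> ess_norm\<^sup>2" using m by (intro power_mono) auto
    with em m show False by simp
  qed
  have Kb: "bounded_op ?H ?n K" by (rule D.compact_op_bounded[OF K(1)])
  have Klin: "linear_op ?H K" using Kb by (simp add: bounded_op_def)
  have Db: "bounded_op ?H ?n (\<lambda>f z. ?T f z - K f z)" by (rule D.bounded_op_diff[OF bounded Kb])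
  define C where "C = op_norm ?H ?n (\<lambda>f z. ?T f z - K f z)"
  have C: "0 \<le> C" "C\<^sup>2 < m"
  proof -
    show "0 \<le> C" unfolding C_def by (rule D.op_norm_nonneg[OF Db])
    then have "C\<^sup>2 < (sqrt m)\<^sup>2" using K(2) unfolding C_def by (intro power_strict_mono) auto
    then show "C\<^sup>2 < m" using m by simp
  qed
  have "\<exists>z. 1 - 1 / (real n + 2) < norm z \<and> norm z < 1 \<and> m' < berezin \<alpha> \<psi> z" for n
  proof (rule ccontr)
    assume "\<not> ?thesis"
    then have "eventually (\<lambda>z. berezin \<alpha> \<psi> z \<le> m') at_boundary"
      unfolding eventually_at_boundary by (intro exI[of _ "1 - 1 / (real n + 2)"] conjI) (simp, metis linorder_not_le)
    then have "Limsup at_boundary (berezin \<alpha> \<psi>) \<le> m'" by (rule Limsup_bounded)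
    with m'(2) show False by simp
  qed
  then obtain z0 where z0: "\<And>n. 1 - 1 / (real n + 2) < norm (z0 n)" "\<And>n. norm (z0 n) < 1"
    "\<And>n. m' < berezin \<alpha> \<psi> (z0 n)" by metis
  have z0_lim: "(\<lambda>n. norm (z0 n)) \<longlonglongrightarrow> 1"
  proof (rule tendsto_sandwich[OF _ _ _ tendsto_const])
    show "(\<lambda>n. 1 - 1 / (real n + 2)) \<longlonglongrightarrow> 1" by real_asymp
  qed (use z0 in \<open>auto intro!: always_eventually less_imp_le\<close>)
  have "\<exists>f. f \<in> ?H \<and> f 0 = 0 \<and> (\<forall>w\<in>unit_disk. deriv f w = bergman_kernel \<alpha> (z0 n) w)" for n
    using bergman_kernel_primitive[OF alpha, of "z0 n"] z0(2)[of n] by (metis mem_ball_0)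
  then obtain f0 where f0: "\<And>n. f0 n \<in> ?H" "\<And>n. f0 n 0 = 0"
    "\<And>n w. w \<in> unit_disk \<Longrightarrow> deriv (f0 n) w = bergman_kernel \<alpha> (z0 n) w" by metis
  have "?n (f0 n) \<le> 1" for n
  proof -
    have "energy \<alpha> (deriv (f0 n)) = energy \<alpha> (bergman_kernel \<alpha> (z0 n))"
      using f0(3) by (intro energy_cong) simp
    then have "ennreal ((?n (f0 n))\<^sup>2) = ennreal 1"
      unfolding ennreal_dirichlet_norm_squared[OF f0(1)] f0(2)
      using energy_bergman_kernel[OF alpha, of "z0 n"] z0(2)[of n] by simp
    then have "(?n (f0 n))\<^sup>2 = 1" by (simp only: ennreal_inj zero_le_power2 zero_le_one)
    then show ?thesis unfolding power2_eq_1_iff by linarith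
  qed
  then obtain s g where s: "strict_mono s" "g \<in> ?H" "(\<lambda>n. ?n (\<lambda>z. K (f0 (s n)) z - g z)) \<longlonglongrightarrow> 0"
    using conjunct2[OF K(1)[unfolded compact_op_def], rule_format, of f0] f0(1) by metis
  define z where "z = (\<lambda>n. z0 (s n))"
  define f where "f = (\<lambda>n. f0 (s n))"
  define \<eta> where "\<eta> = (\<lambda>n. ?n (\<lambda>z. K (f n) z - g z))"
  define h where "h = (\<lambda>n. bergman_kernel \<alpha> (z n))"
  have z: "z n \<in> unit_disk" "m' < berezin \<alpha> \<psi> (z n)" for n using z0 by (auto simp: z_def)
  have z_lim: "(\<lambda>n. norm (z n)) \<longlonglongrightarrow> 1"
    using LIMSEQ_subseq_LIMSEQ[OF z0_lim s(1)] by (simp add: z_def o_def)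
  have f: "f n \<in> ?H" "f n 0 = 0" "w \<in> unit_disk \<Longrightarrow> deriv (f n) w = h n w" for n w
    using f0 by (auto simp: f_def h_def z_def)
  have f_hol: "f n holomorphic_on unit_disk" for n using f(1) by (auto simp: dirichlet_space_def)
  have f_norm: "?n (f n) \<le> 1" for n using \<open>\<And>n. ?n (f0 n) \<le> 1\<close> by (simp add: f_def)
  have \<eta>_lim: "\<eta> \<longlonglongrightarrow> 0" using s(3) by (simp add: \<eta>_def f_def)
  have KH: "K (f n) \<in> ?H" for n using Klin f(1) by (auto simp: linear_op_def)
  \<comment> \<open>The energy of the composition is the energy with respect to \<open>\<nu>\<close>.\<close>
  define \<nu> where "\<nu> = density ?W \<psi>"
  have nn\<nu>: "nn_integral \<nu> F = (\<integral>\<^sup>+w. F w * \<psi> w \<partial>?W)" if "F \<in> borel_measurable ?W" for F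
    unfolding \<nu>_def using that measurable_ratio_W by (subst nn_integral_density) (auto simp: mult.commute)
  have fin\<nu>: "finite_measure \<nu>"
  proof (rule finite_measureI)
    have "emeasure \<nu> (space \<nu>) = (\<integral>\<^sup>+w. 1 \<partial>\<nu>)" by simp
    also have "\<dots> = (\<integral>\<^sup>+w. \<psi> w \<partial>?W)" by (subst nn\<nu>) auto
    finally show "emeasure \<nu> (space \<nu>) \<noteq> \<infinity>" using nn_integral_ratio_finite by simp
  qed
  have sets\<nu>: "sets \<nu> = sets ?W" by (simp add: \<nu>_def)
  have hm: "bergman_kernel \<alpha> a \<in> borel_measurable ?W" "bergman_kernel \<alpha> a \<in> borel_measurable \<nu>" if "a \<in> unit_disk" for a
    using borel_measurable_weighted_area_holomorphic[OF bergman_kernel_holomorphic[OF that]]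
    by (auto simp: measurable_cong_sets[OF sets\<nu> refl])
  have h_hol: "h n holomorphic_on unit_disk" for n unfolding h_def by (rule bergman_kernel_holomorphic[OF z(1)])
  define cW where "cW = (\<lambda>a b. \<integral>\<^sup>+w. ennreal (norm (h a w) * norm (h b w)) \<partial>?W)"
  define c\<nu> where "c\<nu> = (\<lambda>a b. \<integral>\<^sup>+w. ennreal (norm (h a w) * norm (h b w)) \<partial>\<nu>)"
  have IW: "(\<integral>\<^sup>+w. ennreal ((norm (h n w))\<^sup>2) \<partial>?W) = 1" for n
    using energy_bergman_kernel[OF alpha z(1)[of n]] by (simp add: energy_def h_def)
  have I\<nu>: "(\<integral>\<^sup>+w. ennreal ((norm (h n w))\<^sup>2) \<partial>\<nu>) = berezin \<alpha> \<psi> (z n)" for n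
    unfolding berezin_def h_def
    by (rule nn\<nu>[OF borel_measurable_norm_squared[OF bergman_kernel_holomorphic[OF z(1)]]])
  obtain B where B: "\<And>f. f \<in> ?H \<Longrightarrow> ?n (?T f) \<le> B * ?n f" using bounded unfolding bounded_op_def by blast
  have I\<nu>_le: "berezin \<alpha> \<psi> (z n) \<le> ennreal (B\<^sup>2)" for n
  proof -
    have "berezin \<alpha> \<psi> (z n) = energy \<alpha> (deriv (?T (f n)))"
      by (rule berezin_eq_energy[OF f(1)]) (simp add: f(3) h_def)
    also have "\<dots> \<le> ennreal ((?n (?T (f n)))\<^sup>2)"
      by (rule energy_deriv_le_dirichlet_norm[OF comp_op_in[OF f(1)]])
    also have "\<dots> \<le> ennreal ((\<bar>B\<bar> * 1)\<^sup>2)"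
    proof (intro ennreal_leI power_mono dirichlet_norm_nonneg)
      have "?n (?T (f n)) \<le> \<bar>B\<bar> * ?n (f n)"
        using B[OF f(1)[of n]] dirichlet_norm_nonneg[of \<alpha> "f n"] by (meson abs_ge_self mult_right_mono order_trans)
      also have "\<dots> \<le> \<bar>B\<bar> * 1" by (intro mult_left_mono f_norm) simp
      finally show "?n (?T (f n)) \<le> \<bar>B\<bar> * 1" .
    qed
    finally show ?thesis by simp
  qed
  have cW_lim: "cW a \<longlonglongrightarrow> 0" for a
    unfolding cW_def h_def
    by (rule bergman_kernel_cross_term_tendsto_0[OF alpha finite_measure_weighted_area[OF alpha] _ hm(1) z(1) z_lim _ z(1), where B=1])
      (use IW in \<open>auto simp: h_def\<close>)
  have c\<nu>_lim: "c\<nu> a \<longlonglongrightarrow> 0" for a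
    unfolding c\<nu>_def h_def
    by (rule bergman_kernel_cross_term_tendsto_0[OF alpha fin\<nu> _ hm(2) z(1) z_lim _ z(1), where B="B\<^sup>2"])
      (use I\<nu> I\<nu>_le in \<open>auto simp: h_def \<nu>_def\<close>)
  \<comment> \<open>First fix \<open>a\<close> with \<open>K f\<^sub>a\<close> close to the limit \<open>g\<close>, then take \<open>b\<close> so large that the cross terms are small.\<close>
  have main: "2 * m \<le> (C * sqrt (2 + \<epsilon>) + 2 * \<epsilon>)\<^sup>2 + \<epsilon>" if \<epsilon>: "0 < \<epsilon>" for \<epsilon>
  proof -
    have ev\<eta>: "eventually (\<lambda>n. \<eta> n < \<epsilon>) sequentially" using \<eta>_lim \<epsilon> by (rule order_tendstoD)
    then obtain a where a: "\<eta> a < \<epsilon>" by (auto simp: eventually_sequentially)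
    have "eventually (\<lambda>n. \<eta> n < \<epsilon> \<and> cW a n < ennreal (\<epsilon> / 2) \<and> c\<nu> a n < ennreal (\<epsilon> / 2)) sequentially"
      using ev\<eta> order_tendstoD(2)[OF cW_lim[of a], of "ennreal (\<epsilon> / 2)"]
        order_tendstoD(2)[OF c\<nu>_lim[of a], of "ennreal (\<epsilon> / 2)"] \<epsilon> by (intro eventually_conj) auto
    then obtain b where b: "\<eta> b < \<epsilon>" "cW a b < ennreal (\<epsilon> / 2)" "c\<nu> a b < ennreal (\<epsilon> / 2)"
      by (auto simp: eventually_sequentially)
    have two: "2 * x \<le> ennreal \<epsilon>" if "x < ennreal (\<epsilon> / 2)" for x
    proof -
      have "2 * x \<le> 2 * ennreal (\<epsilon> / 2)" using that by (intro mult_left_mono) auto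
      also have "\<dots> = ennreal \<epsilon>" using \<epsilon> by (simp add: ennreal_mult[of 2 "\<epsilon> / 2", simplified, symmetric])
      finally show ?thesis .
    qed
    define d where "d = (\<lambda>w. f a w - f b w)"
    have dH: "d \<in> ?H" unfolding d_def by (rule D.diff_in[OF f(1) f(1)])
    have dd: "deriv d w = h a w - h b w" if "w \<in> unit_disk" for w
      unfolding d_def using that f(3)
      by (subst deriv_diff) (auto intro: holomorphic_on_imp_differentiable_at[OF f_hol open_ball])
    have habm: "(\<lambda>w. ennreal ((norm (h a w - h b w))\<^sup>2)) \<in> borel_measurable ?W"
      by (intro borel_measurable_norm_squared holomorphic_intros h_hol)
    have "ennreal ((?n d)\<^sup>2) = energy \<alpha> (deriv d)"
      unfolding ennreal_dirichlet_norm_squared[OF dH] by (simp add: d_def f(2))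
    also have "\<dots> = (\<integral>\<^sup>+w. ennreal ((norm (h a w - h b w))\<^sup>2) \<partial>?W)"
      unfolding energy_def by (intro nn_integral_cong) (simp add: dd)
    also have "\<dots> \<le> 1 + 1 + 2 * cW a b"
      using nn_integral_norm_diff_squared_le(1)[of "h a" ?W "h b"] hm(1)[OF z(1)]
      unfolding IW cW_def by (simp add: h_def)
    also have "\<dots> \<le> ennreal (2 + \<epsilon>)"
      using two[OF b(2)] \<epsilon> by (simp add: ennreal_plus add_left_mono one_add_one)
    finally have "(?n d)\<^sup>2 \<le> 2 + \<epsilon>" using \<epsilon> by (subst (asm) ennreal_le_iff) auto
    then have nd: "?n d \<le> sqrt (2 + \<epsilon>)" by (rule real_le_rsqrt)
    have "ennreal (2 * m) = ennreal m + ennreal m" using m by (simp add: ennreal_plus[symmetric] del: ennreal_plus)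
    also have "\<dots> \<le> berezin \<alpha> \<psi> (z a) + berezin \<alpha> \<psi> (z b)"
      using z(2)[of a] z(2)[of b] m by (intro add_mono) auto
    also have "\<dots> \<le> (\<integral>\<^sup>+w. ennreal ((norm (h a w - h b w))\<^sup>2) \<partial>\<nu>) + 2 * c\<nu> a b"
      using nn_integral_norm_diff_squared_le(2)[of "h a" \<nu> "h b"] hm(2)[OF z(1)]
      unfolding I\<nu> c\<nu>_def by (simp add: h_def)
    also have "(\<integral>\<^sup>+w. ennreal ((norm (h a w - h b w))\<^sup>2) \<partial>\<nu>) = energy \<alpha> (deriv (?T d))"
    proof -
      have "energy \<alpha> (deriv (?T d)) = (\<integral>\<^sup>+w. ennreal ((norm (deriv d w))\<^sup>2) * \<psi> w \<partial>?W)"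
        using dH by (intro energy_comp) (simp add: dirichlet_space_def)
      also have "\<dots> = (\<integral>\<^sup>+w. ennreal ((norm (h a w - h b w))\<^sup>2) * \<psi> w \<partial>?W)"
        by (intro nn_integral_cong) (simp add: dd)
      finally show ?thesis by (simp add: nn\<nu>[OF habm])
    qed
    also have "energy \<alpha> (deriv (?T d)) + 2 * c\<nu> a b \<le> ennreal ((?n (?T d))\<^sup>2) + ennreal \<epsilon>"
      by (intro add_mono energy_deriv_le_dirichlet_norm comp_op_in dH two b)
    also have "\<dots> = ennreal ((?n (?T d))\<^sup>2 + \<epsilon>)" using \<epsilon> by simp
    finally have 1: "2 * m \<le> (?n (?T d))\<^sup>2 + \<epsilon>" using \<epsilon> by (subst (asm) ennreal_le_iff) auto
    have Kd: "K d = (\<lambda>w. K (f a) w - K (f b) w)"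
      unfolding d_def by (rule D.linear_op_apply_diff[OF Klin f(1) f(1)])
    have KdH: "K d \<in> ?H" using Klin dH by (auto simp: linear_op_def)
    have "?n (K d) \<le> \<eta> a + \<eta> b"
      unfolding Kd \<eta>_def
      using D.nrm_triangle_diff[OF KH[of a] s(2) KH[of b]] D.nrm_diff_commute[OF s(2) KH[of b]] by simp
    moreover have "?n (?T d) \<le> ?n (\<lambda>w. ?T d w - K d w) + ?n (K d)"
      using D.nrm_add[OF D.diff_in[OF comp_op_in[OF dH] KdH] KdH] by simp
    moreover have "?n (\<lambda>w. ?T d w - K d w) \<le> C * ?n d"
      unfolding C_def by (rule D.nrm_le_op_norm[OF Db dH])
    moreover have "C * ?n d \<le> C * sqrt (2 + \<epsilon>)" using nd C by (intro mult_left_mono) auto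
    ultimately have "?n (?T d) \<le> C * sqrt (2 + \<epsilon>) + 2 * \<epsilon>" using a b(1) by simp
    then have "(?n (?T d))\<^sup>2 \<le> (C * sqrt (2 + \<epsilon>) + 2 * \<epsilon>)\<^sup>2"
      by (intro power_mono dirichlet_norm_nonneg)
    with 1 show ?thesis by simp
  qed
  have "((\<lambda>\<epsilon>. (C * sqrt (2 + \<epsilon>) + 2 * \<epsilon>)\<^sup>2 + \<epsilon>) \<longlongrightarrow> (C * sqrt (2 + 0) + 2 * 0)\<^sup>2 + 0) (at_right 0)"
    by (intro tendsto_intros)
  then have "2 * m \<le> (C * sqrt (2 + 0) + 2 * 0)\<^sup>2 + 0"
    by (rule tendsto_lowerbound) (auto simp: eventually_at_right_less main intro!: eventually_at_rightI[of 0 1])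
  then have "2 * m \<le> 2 * C\<^sup>2" by (simp add: power_mult_distrib)
  with C(2) show False by simp
qed

end

section \<open>Bergman disks\<close>

lemma artanh_less_iff:
  assumes "0 \<le> x" "x < (1::real)"
  shows "artanh x < s \<longleftrightarrow> x < tanh s"
proof -
  have t: "tanh s < 1" "- 1 < tanh s" using tanh_real_lt_1[of s] tanh_real_gt_neg1[of s] by auto
  have "artanh x < s \<longleftrightarrow> artanh x < artanh (tanh s)" by (simp add: artanh_tanh_real)
  also have "\<dots> \<longleftrightarrow> (1 + x) / (1 - x) < (1 + tanh s) / (1 - tanh s)"
    unfolding artanh_def using assms t by (subst divide_less_cancel) (simp add: ln_less_cancel_iff)
  also have "\<dots> \<longleftrightarrow> x < tanh s"
    using assms t by (simp add: divide_simps) (simp add: algebra_simps)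
  finally show ?thesis .
qed

lemma bergman_disk_eq:
  assumes "a \<in> unit_disk"
  shows "bergman_disk a s = {w \<in> unit_disk. norm (disk_involution a w) < tanh s}"
proof -
  have "artanh (norm (disk_involution a w)) < s \<longleftrightarrow> norm (disk_involution a w) < tanh s" if "w \<in> unit_disk" for w
    using disk_involution_in_disk[OF assms that] by (intro artanh_less_iff) auto
  then show ?thesis by (auto simp: bergman_disk_def disk_involution_def)
qed

lemma bergman_disk_subset: "bergman_disk a s \<subseteq> unit_disk"
  by (auto simp: bergman_disk_def)

lemma open_bergman_disk:
  assumes "a \<in> unit_disk"
  shows "open (bergman_disk a s)"
proof -
  have "continuous_on unit_disk (disk_involution a)"
    using disk_involution_has_derivative[OF assms] by (meson DERIV_continuous continuous_at_imp_continuous_on)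
  then have "open (unit_disk \<inter> disk_involution a -` ball 0 (tanh s))"
    by (intro continuous_open_preimage) auto
  also have "unit_disk \<inter> disk_involution a -` ball 0 (tanh s) = bergman_disk a s"
    unfolding bergman_disk_eq[OF assms] by auto
  finally show ?thesis .
qed

lemma sets_bergman_disk:
  assumes "a \<in> unit_disk"
  shows "bergman_disk a s \<in> sets borel" "bergman_disk a s \<in> sets (dA \<alpha>)"
  using open_bergman_disk[OF assms] bergman_disk_subset
  by (auto simp: sets_weighted_area sets_restrict_space_iff)

lemma emeasure_bergman_disk:
  assumes "\<alpha> > -1" "a \<in> unit_disk" "0 < s"
  shows "0 < emeasure (dA \<alpha>) (bergman_disk a s)" "emeasure (dA \<alpha>) (bergman_disk a s) < \<infinity>"
proof -
  have "a \<in> bergman_disk a s" unfolding bergman_disk_eq[OF assms(2)] using assms by (simp add: disk_involution_def)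
  then show "0 < emeasure (dA \<alpha>) (bergman_disk a s)"
    using open_bergman_disk[OF assms(2)] bergman_disk_subset
    by (intro emeasure_weighted_area_open_pos[OF assms(1)]) auto
  show "emeasure (dA \<alpha>) (bergman_disk a s) < \<infinity>"
    using finite_measure.emeasure_finite[OF finite_measure_weighted_area[OF assms(1)], of "bergman_disk a s"]
    by (simp add: less_top)
qed

text \<open>
  The involution maps \<open>bergman_disk a s\<close> onto the disk of radius \<open>tanh s\<close> about 0, so the mass that
  \<open>|\<kappa>\<^sub>a|\<^sup>2 dA\<^sub>\<alpha>\<close> gives to it is independent of \<open>a\<close>.
\<close>

lemma nn_integral_bergman_kernel_disk:
  assumes "\<alpha> > -1" "a \<in> unit_disk"
  shows "(\<integral>\<^sup>+w. ennreal ((norm (bergman_kernel \<alpha> a w))\<^sup>2) * indicator (bergman_disk a s) w \<partial>dA \<alpha>)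
    = emeasure (dA \<alpha>) (unit_disk \<inter> ball 0 (tanh s))"
proof -
  have "(\<integral>\<^sup>+w. ennreal ((norm (bergman_kernel \<alpha> a w))\<^sup>2) * indicator (bergman_disk a s) w \<partial>dA \<alpha>)
     = (\<integral>\<^sup>+w. ennreal ((norm (bergman_kernel \<alpha> a w))\<^sup>2) * indicator (unit_disk \<inter> ball 0 (tanh s)) (disk_involution a w) \<partial>dA \<alpha>)"
    using disk_involution_in_disk[OF assms(2)]
    by (intro nn_integral_cong) (auto simp: indicator_def bergman_disk_eq[OF assms(2)])
  also have "\<dots> = (\<integral>\<^sup>+w. indicator (unit_disk \<inter> ball 0 (tanh s)) w \<partial>dA \<alpha>)"
    by (rule nn_integral_bergman_kernel[OF assms]) (intro borel_measurable_indicator, auto)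
  also have "\<dots> = emeasure (dA \<alpha>) (unit_disk \<inter> ball 0 (tanh s))"
    by (rule nn_integral_indicator) (auto simp: sets_weighted_area sets_restrict_space_iff)
  finally show ?thesis .
qed

lemma SUP_emeasure_tanh_balls:
  assumes "\<alpha> > -1"
  shows "(SUP n. emeasure (dA \<alpha>) (unit_disk \<inter> ball 0 (tanh (real (Suc n))))) = 1"
proof -
  have "(SUP n. emeasure (dA \<alpha>) (unit_disk \<inter> ball 0 (tanh (real (Suc n)))))
      = emeasure (dA \<alpha>) (\<Union>n. unit_disk \<inter> ball 0 (tanh (real (Suc n))))"
  proof (rule SUP_emeasure_incseq)
    show "range (\<lambda>n. unit_disk \<inter> ball 0 (tanh (real (Suc n)))) \<subseteq> sets (dA \<alpha>)"
      by (auto simp: sets_weighted_area sets_restrict_space_iff)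
    show "incseq (\<lambda>n. unit_disk \<inter> ball (0::complex) (tanh (real (Suc n))))"
    proof (rule incseq_SucI)
      fix n
      have "tanh (real (Suc n)) \<le> tanh (real (Suc (Suc n)))" by (simp del: of_nat_Suc)
      then show "unit_disk \<inter> ball (0::complex) (tanh (real (Suc n))) \<subseteq> unit_disk \<inter> ball 0 (tanh (real (Suc (Suc n))))"
        by (intro Int_mono subset_ball order_refl)
    qed
  qed
  also have "(\<Union>n. unit_disk \<inter> ball (0::complex) (tanh (real (Suc n)))) = unit_disk"
  proof -
    have "\<exists>n. norm z < tanh (real (Suc n))" if "z \<in> unit_disk" for z :: complex
    proof -
      have "(\<lambda>n. tanh (real (Suc n))) \<longlonglongrightarrow> 1"
        by (rule filterlim_compose[OF tanh_real_at_top])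
          (rule filterlim_compose[OF filterlim_real_sequentially filterlim_Suc])
      then have "eventually (\<lambda>n. norm z < tanh (real (Suc n))) sequentially"
        using that by (intro order_tendstoD(1)) auto
      then show ?thesis by (auto simp: eventually_sequentially)
    qed
    then show ?thesis by auto
  qed
  finally show ?thesis by (simp only: emeasure_weighted_area_disk[OF assms])
qed

section \<open>Vanishing oscillation and limits superior at the boundary\<close>

lemma at_boundary_neq_bot: "at_boundary \<noteq> bot"
proof
  assume "at_boundary = bot"
  then have "eventually (\<lambda>_. False) at_boundary" by simp
  then obtain \<rho> where \<rho>: "\<rho> < 1" "\<And>z::complex. \<rho> < norm z \<Longrightarrow> norm z < 1 \<Longrightarrow> False"
    unfolding eventually_at_boundary by blast
  let ?t = "(max 0 \<rho> + 1) / 2"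
  have "\<rho> < ?t" "?t < 1" "0 \<le> ?t" using \<rho>(1) by (auto simp: max_def)
  then have "\<rho> < norm (complex_of_real ?t)" "norm (complex_of_real ?t) < 1"
    by (simp_all only: norm_of_real abs_of_nonneg)
  then show False by (rule \<rho>(2))
qed

lemma eventually_at_boundary_disk: "eventually (\<lambda>z. z \<in> unit_disk) at_boundary"
  unfolding eventually_at_boundary by (intro exI[of _ 0]) auto

lemma Limsup_le_Limsup_approx:
  fixes f g :: "'a \<Rightarrow> ennreal"
  assumes "\<And>\<epsilon>. 0 < \<epsilon> \<Longrightarrow> eventually (\<lambda>x. f x \<le> g x + ennreal \<epsilon>) F"
  shows "Limsup F f \<le> Limsup F g"
proof (rule ennreal_le_epsilon)
  fix e :: real assume e: "0 < e" and fin: "Limsup F g < top"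
  have "Limsup F g < Limsup F g + ennreal (e / 2)"
    using fin e by (cases "Limsup F g") (auto simp: ennreal_less_iff simp flip: ennreal_plus)
  then have "eventually (\<lambda>x. g x < Limsup F g + ennreal (e / 2)) F"
    using Limsup_le_iff[of F g "Limsup F g"] by blast
  moreover have "eventually (\<lambda>x. f x \<le> g x + ennreal (e / 2)) F" using assms e by simp
  ultimately have "eventually (\<lambda>x. f x \<le> Limsup F g + ennreal e) F"
  proof eventually_elim
    case (elim x)
    have "f x \<le> g x + ennreal (e / 2)" by fact
    also have "\<dots> \<le> (Limsup F g + ennreal (e / 2)) + ennreal (e / 2)"
      using elim by (intro add_mono) auto
    also have "\<dots> = Limsup F g + ennreal e"
      unfolding add.assoc using e by (subst ennreal_plus[symmetric]) auto
    finally show ?case .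
  qed
  then show "Limsup F f \<le> Limsup F g + ennreal e" by (rule Limsup_bounded)
qed

lemma Limsup_cmult_ennreal:
  fixes f :: "'a \<Rightarrow> ennreal"
  assumes "F \<noteq> bot" "c < top"
  shows "Limsup F (\<lambda>x. c * f x) = c * Limsup F f"
proof (rule Limsup_compose_continuous_mono[OF _ _ assms(1)])
  show "continuous_on UNIV (\<lambda>x. c * x)"
    using assms(2) by (auto simp: continuous_on_def intro!: ennreal_tendsto_cmult tendsto_intros)
qed (auto intro!: monoI mult_left_mono)

lemma ennreal_le_add_of_abs_diff_less:
  assumes "\<bar>enn2ereal a - enn2ereal b\<bar> < ereal \<epsilon>" "0 < \<epsilon>"
  shows "a \<le> b + ennreal \<epsilon>" "b \<le> a + ennreal \<epsilon>"
proof -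
  have "a \<le> b + ennreal \<epsilon> \<and> b \<le> a + ennreal \<epsilon>"
  proof (cases a; cases b)
    fix r t assume r: "a = ennreal r" "0 \<le> r" and t: "b = ennreal t" "0 \<le> t"
    then have "\<bar>r - t\<bar> < \<epsilon>" using assms by (simp add: enn2ereal_ennreal)
    then have "ennreal r \<le> ennreal (t + \<epsilon>)" "ennreal t \<le> ennreal (r + \<epsilon>)" by (auto intro!: ennreal_leI)
    then show ?thesis using r t assms(2) by simp
  qed (use assms in \<open>auto simp: enn2ereal_ennreal\<close>)
  then show "a \<le> b + ennreal \<epsilon>" "b \<le> a + ennreal \<epsilon>" by auto
qed

lemma VO_boundary_oscillation:
  assumes "q \<in> VO_boundary" "0 < s" "0 < \<epsilon>"
  shows "eventually (\<lambda>z. \<forall>w\<in>bergman_disk z s. q w \<le> q z + ennreal \<epsilon> \<and> q z \<le> q w + ennreal \<epsilon>) at_boundary"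
proof -
  have "((\<lambda>z. SUP w\<in>bergman_disk z s. \<bar>enn2ereal (q w) - enn2ereal (q z)\<bar>) \<longlongrightarrow> 0) at_boundary"
    using assms by (auto simp: VO_boundary_def)
  then have "eventually (\<lambda>z. (SUP w\<in>bergman_disk z s. \<bar>enn2ereal (q w) - enn2ereal (q z)\<bar>) < ereal \<epsilon>) at_boundary"
    using assms by (intro order_tendstoD(2)) auto
  then show ?thesis
  proof (rule eventually_mono, intro ballI)
    fix z w assume *: "(SUP w\<in>bergman_disk z s. \<bar>enn2ereal (q w) - enn2ereal (q z)\<bar>) < ereal \<epsilon>"
      and w: "w \<in> bergman_disk z s"
    have "\<bar>enn2ereal (q w) - enn2ereal (q z)\<bar> < ereal \<epsilon>"
      using SUP_upper[OF w, of "\<lambda>w. \<bar>enn2ereal (q w) - enn2ereal (q z)\<bar>"] * by (rule le_less_trans)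
    from ennreal_le_add_of_abs_diff_less[OF this assms(3)]
    show "q w \<le> q z + ennreal \<epsilon> \<and> q z \<le> q w + ennreal \<epsilon>" by simp
  qed
qed

text \<open>
  On \<open>bergman_disk z s\<close> the function \<open>q\<close> is at least \<open>q z - \<epsilon>\<close> when \<open>z\<close> is close to the boundary, and the kernel
  gives this disk the mass \<open>A\<close>, which is independent of \<open>z\<close> and tends to 1 as \<open>s\<close> grows.
\<close>

lemma Limsup_le_Limsup_berezin:
  assumes \<alpha>: "\<alpha> > -1" and q: "q \<in> VO_boundary"
  shows "Limsup at_boundary q \<le> Limsup at_boundary (berezin \<alpha> q)"
proof -
  define A where "A = (\<lambda>n. emeasure (dA \<alpha>) (unit_disk \<inter> ball 0 (tanh (real (Suc n)))))"
  have qm: "q \<in> borel_measurable (dA \<alpha>)"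
    using q by (simp add: VO_boundary_def borel_measurable_weighted_area_iff)
  have A1: "A n \<le> 1" for n
  proof -
    have "A n \<le> emeasure (dA \<alpha>) unit_disk" unfolding A_def
      by (intro emeasure_mono) (auto simp: sets_weighted_area sets_restrict_space_iff)
    then show ?thesis by (simp add: emeasure_weighted_area_disk[OF \<alpha>])
  qed
  \<comment> \<open>It suffices to let \<open>n\<close> tend to infinity in this bound.\<close>
  have "A n * Limsup at_boundary q \<le> Limsup at_boundary (berezin \<alpha> q)" for n
  proof -
    have "A n < top" using A1[of n] by (rule le_less_trans) simp
    then have "A n * Limsup at_boundary q = Limsup at_boundary (\<lambda>z. A n * q z)"
      by (rule Limsup_cmult_ennreal[OF at_boundary_neq_bot, symmetric])
    also have "\<dots> \<le> Limsup at_boundary (berezin \<alpha> q)"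
    proof (rule Limsup_le_Limsup_approx)
      fix \<epsilon> :: real assume \<epsilon>: "0 < \<epsilon>"
      let ?s = "real (Suc n)"
      have "eventually (\<lambda>z. \<forall>w\<in>bergman_disk z ?s. q w \<le> q z + ennreal \<epsilon> \<and> q z \<le> q w + ennreal \<epsilon>) at_boundary"
        using \<epsilon> by (intro VO_boundary_oscillation[OF q]) auto
      then show "eventually (\<lambda>z. A n * q z \<le> berezin \<alpha> q z + ennreal \<epsilon>) at_boundary"
        using eventually_at_boundary_disk
      proof eventually_elim
        case (elim z)
        let ?k = "\<lambda>w. ennreal ((norm (bergman_kernel \<alpha> z w))\<^sup>2)" and ?i = "indicator (bergman_disk z ?s) :: complex \<Rightarrow> ennreal"
        have km: "?k \<in> borel_measurable (dA \<alpha>)"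
          by (rule borel_measurable_norm_squared[OF bergman_kernel_holomorphic[OF elim(2)]])
        have im: "?i \<in> borel_measurable (dA \<alpha>)"
          by (intro borel_measurable_indicator sets_bergman_disk elim)
        have "A n * q z = (\<integral>\<^sup>+w. (?k w * ?i w) * q z \<partial>dA \<alpha>)"
          unfolding A_def nn_integral_bergman_kernel_disk[OF \<alpha> elim(2), symmetric]
          by (intro nn_integral_multc[symmetric] borel_measurable_times_ennreal km im)
        also have "\<dots> \<le> (\<integral>\<^sup>+w. ?k w * q w + ennreal \<epsilon> * ?k w \<partial>dA \<alpha>)"
        proof (rule nn_integral_mono)
          fix w
          show "(?k w * ?i w) * q z \<le> ?k w * q w + ennreal \<epsilon> * ?k w"
          proof (cases "w \<in> bergman_disk z ?s")
            case True
            then have "?k w * q z \<le> ?k w * (q w + ennreal \<epsilon>)" using elim(1) by (intro mult_left_mono) auto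
            then show ?thesis using True by (simp add: distrib_left distrib_right mult.commute)
          qed simp
        qed
        also have "\<dots> = berezin \<alpha> q z + ennreal \<epsilon> * energy \<alpha> (bergman_kernel \<alpha> z)"
          unfolding berezin_def energy_def nn_integral_cmult[OF km, symmetric]
          by (intro nn_integral_add borel_measurable_times_ennreal borel_measurable_const km qm)
        also have "\<dots> = berezin \<alpha> q z + ennreal \<epsilon>"
          by (simp add: energy_bergman_kernel[OF \<alpha> elim(2)])
        finally show ?case .
      qed
    qed
    finally show ?thesis .
  qed
  then have "(SUP n. Limsup at_boundary q * A n) \<le> Limsup at_boundary (berezin \<alpha> q)"
    by (intro SUP_least) (simp add: mult.commute)
  then have "Limsup at_boundary q * (SUP n. A n) \<le> Limsup at_boundary (berezin \<alpha> q)"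
    by (simp only: SUP_mult_left_ennreal)
  then show ?thesis using SUP_emeasure_tanh_balls[OF \<alpha>] by (simp add: A_def)
qed

text \<open>
  Near the boundary \<open>q\<close> differs from \<open>q z\<close> by at most \<open>\<epsilon>\<close> on the disk over which it is averaged.
\<close>

lemma Limsup_averages_eq_Limsup:
  assumes \<alpha>: "\<alpha> > -1" and q: "q \<in> VO_boundary" and s: "0 < s"
  shows "Limsup at_boundary (\<lambda>z. (\<integral>\<^sup>+w\<in>bergman_disk z s. q w \<partial>dA \<alpha>) / emeasure (dA \<alpha>) (bergman_disk z s))
    = Limsup at_boundary q"
proof -
  let ?W = "dA \<alpha>"
  have qm: "q \<in> borel_measurable ?W"
    using q by (simp add: VO_boundary_def borel_measurable_weighted_area_iff)
  define Q where "Q = (\<lambda>z. (\<integral>\<^sup>+w\<in>bergman_disk z s. q w \<partial>?W) / emeasure ?W (bergman_disk z s))"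
  have close: "eventually (\<lambda>z. Q z \<le> q z + ennreal \<epsilon> \<and> q z \<le> Q z + ennreal \<epsilon>) at_boundary" if \<epsilon>: "0 < \<epsilon>" for \<epsilon>
    using VO_boundary_oscillation[OF q s \<epsilon>] eventually_at_boundary_disk
  proof eventually_elim
    case (elim z)
    let ?D = "bergman_disk z s"
    define V where "V = emeasure ?W ?D"
    have V: "V \<noteq> 0" "V \<noteq> top" using emeasure_bergman_disk[OF \<alpha> elim(2) s] by (auto simp: V_def)
    have Dm: "?D \<in> sets ?W" by (rule sets_bergman_disk[OF elim(2)])
    have "(\<integral>\<^sup>+w\<in>?D. q w \<partial>?W) \<le> (\<integral>\<^sup>+w. (q z + ennreal \<epsilon>) * indicator ?D w \<partial>?W)"
      using elim(1) by (intro nn_integral_mono) (auto simp: indicator_def)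
    also have "\<dots> = (q z + ennreal \<epsilon>) * V" unfolding V_def by (rule nn_integral_cmult_indicator[OF Dm])
    finally have "Q z \<le> (q z + ennreal \<epsilon>) * V / V" unfolding Q_def V_def[symmetric] by (rule divide_right_mono_ennreal)
    also have "\<dots> = q z + ennreal \<epsilon>" by (rule ennreal_mult_divide_eq[OF V])
    finally have 1: "Q z \<le> q z + ennreal \<epsilon>" .
    have "q z * V = (\<integral>\<^sup>+w. q z * indicator ?D w \<partial>?W)" unfolding V_def by (rule nn_integral_cmult_indicator[OF Dm, symmetric])
    also have "\<dots> \<le> (\<integral>\<^sup>+w. q w * indicator ?D w + ennreal \<epsilon> * indicator ?D w \<partial>?W)"
      using elim(1) by (intro nn_integral_mono) (auto simp: indicator_def)
    also have "\<dots> = (\<integral>\<^sup>+w\<in>?D. q w \<partial>?W) + ennreal \<epsilon> * V"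
      unfolding V_def nn_integral_cmult_indicator[OF Dm, symmetric]
      by (intro nn_integral_add borel_measurable_times_ennreal borel_measurable_const borel_measurable_indicator qm Dm)
    finally have "q z * V / V \<le> ((\<integral>\<^sup>+w\<in>?D. q w \<partial>?W) + ennreal \<epsilon> * V) / V" by (rule divide_right_mono_ennreal)
    also have "\<dots> = Q z + ennreal \<epsilon>"
      by (simp only: add_divide_distrib_ennreal ennreal_mult_divide_eq[OF V] Q_def V_def[symmetric])
    finally have "q z \<le> Q z + ennreal \<epsilon>" unfolding ennreal_mult_divide_eq[OF V] .
    with 1 show ?case by simp
  qed
  have "Limsup at_boundary Q \<le> Limsup at_boundary q"
    by (rule Limsup_le_Limsup_approx, rule eventually_mono[OF close]) blast+
  moreover have "Limsup at_boundary q \<le> Limsup at_boundary Q"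
    by (rule Limsup_le_Limsup_approx, rule eventually_mono[OF close]) blast+
  ultimately show ?thesis unfolding Q_def by (rule antisym)
qed

text \<open>
  The denominator of the counting ratio cancels the power of \<open>1 - |w|\<^sup>2\<close> in the density of \<open>dA \<alpha>\<close>.
\<close>

lemma averages_counting_fun:
  assumes \<alpha>: "\<alpha> > -1" and qm: "counting_ratio \<phi> \<alpha> \<in> borel_measurable (restrict_space borel unit_disk)" and z: "z \<in> unit_disk"
  shows "ennreal (1 + \<alpha>) * ((\<integral>\<^sup>+w\<in>bergman_disk z r. counting_fun \<phi> \<alpha> w \<partial>area_measure) / V)
    = (\<integral>\<^sup>+w\<in>bergman_disk z r. counting_ratio \<phi> \<alpha> w \<partial>dA \<alpha>) / V"
proof -
  let ?D = "bergman_disk z r"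
  have sp: "space area_measure = unit_disk" and st: "sets area_measure = sets (restrict_space borel unit_disk)"
    by (simp_all add: area_measure_def space_restrict_space sets_restrict_space)
  have Dm: "?D \<in> sets (restrict_space borel unit_disk)"
    using sets_bergman_disk[OF z] bergman_disk_subset by (simp add: sets_restrict_space_iff)
  have Fm: "(\<lambda>w. counting_ratio \<phi> \<alpha> w * indicator ?D w) \<in> borel_measurable (restrict_space borel unit_disk)"
    using qm Dm by (intro borel_measurable_times_ennreal borel_measurable_indicator)
  have Nm: "(\<lambda>w. counting_fun \<phi> \<alpha> w * indicator ?D w) \<in> borel_measurable area_measure"
  proof -
    have "(\<lambda>w. ennreal ((1 - (norm w)\<^sup>2) powr \<alpha>) * (counting_ratio \<phi> \<alpha> w * indicator ?D w)) \<in> borel_measurable (restrict_space borel unit_disk)"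
      by (intro borel_measurable_times_ennreal Fm measurable_restrict_space1) measurable
    then have "(\<lambda>w. ennreal ((1 - (norm w)\<^sup>2) powr \<alpha>) * (counting_ratio \<phi> \<alpha> w * indicator ?D w)) \<in> borel_measurable area_measure"
      by (simp add: measurable_cong_sets[OF st refl])
    then show ?thesis
      by (rule measurable_cong[THEN iffD1, rotated]) (simp add: sp counting_fun_eq_ratio mult.assoc)
  qed
  have "(\<integral>\<^sup>+w\<in>?D. counting_ratio \<phi> \<alpha> w \<partial>dA \<alpha>)
      = (\<integral>\<^sup>+w. ennreal ((1 + \<alpha>) * (1 - (norm w)\<^sup>2) powr \<alpha>) * (counting_ratio \<phi> \<alpha> w * indicator ?D w) \<partial>area_measure)"
    by (rule nn_integral_weighted_area_eq_area) (use Fm in \<open>simp add: borel_measurable_weighted_area_iff\<close>)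
  also have "\<dots> = (\<integral>\<^sup>+w. ennreal (1 + \<alpha>) * (counting_fun \<phi> \<alpha> w * indicator ?D w) \<partial>area_measure)"
    using \<alpha> by (intro nn_integral_cong) (simp add: sp counting_fun_eq_ratio ennreal_mult mult_ac)
  also have "\<dots> = ennreal (1 + \<alpha>) * (\<integral>\<^sup>+w\<in>?D. counting_fun \<phi> \<alpha> w \<partial>area_measure)"
    by (rule nn_integral_cmult[OF Nm])
  finally show ?thesis by (simp only: ennreal_times_divide)
qed

context bounded_composition
begin

lemma essential_norm_le_Limsup:
  "ennreal ((ess_norm)\<^sup>2)
    \<le> Limsup at_boundary (\<psi>)"
proof (rule dense_ge)
  fix y assume y: "Limsup at_boundary (\<psi>) < y"
  show "ennreal ((ess_norm)\<^sup>2) \<le> y"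
  proof (cases y)
    case (real M)
    have "eventually (\<lambda>z. \<psi> z < y) at_boundary"
      using Limsup_le_iff[of at_boundary "\<psi>" "Limsup at_boundary (\<psi>)"] y by blast
    then obtain \<rho> where "\<rho> < 1" "\<And>z. \<rho> < norm z \<Longrightarrow> norm z < 1 \<Longrightarrow> \<psi> z < y"
      unfolding eventually_at_boundary by blast
    then have "(ess_norm)\<^sup>2 \<le> M"
      using real by (intro essential_norm_squared_le[of \<rho> M]) (auto intro: less_imp_le)
    then show ?thesis using real by (simp add: ennreal_leI)
  qed simp
qed

end

theorem theorem3p8:
  fixes \<alpha> :: real and \<phi> :: "complex \<Rightarrow> complex"
  assumes "\<alpha> > -1"
    and "\<phi> holomorphic_on unit_disk" and "\<phi> ` unit_disk \<subseteq> unit_disk"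
    and "\<not> \<phi> constant_on unit_disk"
    and "bounded_op (dirichlet_space \<alpha>) (dirichlet_norm \<alpha>) (comp_op \<phi>)"
    and "counting_ratio \<phi> \<alpha> \<in> VO_boundary"
  shows "ennreal ((essential_norm (dirichlet_space \<alpha>) (dirichlet_norm \<alpha>) (comp_op \<phi>))\<^sup>2)
           = Limsup at_boundary (counting_ratio \<phi> \<alpha>)
       \<and> Limsup at_boundary (counting_ratio \<phi> \<alpha>)
           = Limsup at_boundary (berezin \<alpha> (counting_ratio \<phi> \<alpha>))
       \<and> (\<forall>r>0. ennreal ((essential_norm (dirichlet_space \<alpha>) (dirichlet_norm \<alpha>) (comp_op \<phi>))\<^sup>2)
           = ennreal (1 + \<alpha>) * Limsup at_boundary
               (\<lambda>z. (\<integral>\<^sup>+w\<in>bergman_disk z r. counting_fun \<phi> \<alpha> w \<partial>area_measure)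
                     / emeasure (weighted_area \<alpha>) (bergman_disk z r)))"
proof -
  let ?E = "ennreal ((essential_norm (dirichlet_space \<alpha>) (dirichlet_norm \<alpha>) (comp_op \<phi>))\<^sup>2)"
    and ?L = "Limsup at_boundary (counting_ratio \<phi> \<alpha>)"
    and ?B = "Limsup at_boundary (berezin \<alpha> (counting_ratio \<phi> \<alpha>))"
  have qm: "counting_ratio \<phi> \<alpha> \<in> borel_measurable (restrict_space borel unit_disk)"
    using assms(6) by (simp add: VO_boundary_def)
  interpret bounded_composition \<alpha> \<phi>
    by unfold_locales (use assms qm in auto)
  have "?E \<le> ?L" by (rule essential_norm_le_Limsup)
  moreover have "?L \<le> ?B" by (rule Limsup_le_Limsup_berezin[OF assms(1,6)])
  moreover have "?B \<le> ?E" by (rule Limsup_berezin_le_essential_norm)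
  ultimately have EL: "?E = ?L" "?L = ?B" by auto
  moreover have "?E = ennreal (1 + \<alpha>) * Limsup at_boundary
      (\<lambda>z. (\<integral>\<^sup>+w\<in>bergman_disk z r. counting_fun \<phi> \<alpha> w \<partial>area_measure)
         / emeasure (weighted_area \<alpha>) (bergman_disk z r))" if r: "0 < r" for r
  proof -
    have "ennreal (1 + \<alpha>) * Limsup at_boundary
        (\<lambda>z. (\<integral>\<^sup>+w\<in>bergman_disk z r. counting_fun \<phi> \<alpha> w \<partial>area_measure)
           / emeasure (weighted_area \<alpha>) (bergman_disk z r))
      = Limsup at_boundary (\<lambda>z. ennreal (1 + \<alpha>) * ((\<integral>\<^sup>+w\<in>bergman_disk z r. counting_fun \<phi> \<alpha> w \<partial>area_measure)
           / emeasure (weighted_area \<alpha>) (bergman_disk z r)))"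
      by (rule Limsup_cmult_ennreal[OF at_boundary_neq_bot, symmetric]) simp
    also have "\<dots> = Limsup at_boundary (\<lambda>z. (\<integral>\<^sup>+w\<in>bergman_disk z r. counting_ratio \<phi> \<alpha> w \<partial>weighted_area \<alpha>)
           / emeasure (weighted_area \<alpha>) (bergman_disk z r))"
      by (rule Limsup_eq, rule eventually_mono[OF eventually_at_boundary_disk])
        (rule averages_counting_fun[OF assms(1) qm])
    also have "\<dots> = ?L" by (rule Limsup_averages_eq_Limsup[OF assms(1,6) r])
    finally show ?thesis using EL by simp
  qed
  ultimately show ?thesis by blast
qed

end
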